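(* Let $\mathcal{M}$ be a closely packed $d$-dimensional lattice with $d\ge2$ (see context), and consider the Hubbard model described in the context on it. There is a constant $C'>0$, depending only on the structure of the lattice and not on its size, such that the following holds for every $\nu\in(0,1)$. If the electron number $N_e$ satisfies $|\mathcal{M}|\ge N_e\ge|\mathcal{M}|-C'(1-\nu)^{(d-1)/(d+2)}|\mathcal{M}|^{(d+1)/(d+2)}$, then, in the limits $U\uparrow\infty$ and $s\uparrow\infty$, every ground state of the model has total spin $S_{\mathrm{tot}}\ge\nu S_{\max}$, where $S_{\max}=N_e/2$.
   Context: Closely packed lattice: $\mathcal{M}$ is a uniform (translation-invariant) $d$-dimensional lattice with periodic boundary conditions, with $d\ge2$. It carries a set of bonds $\mathcal{B}$ and a symmetrized bond set $\mathcal{E}$ as described below, is connected, and has uniform coordination number $\zeta$. It satisfies the condition that, for every $x_0\in\mathcal{M}$, the set $\{y\in\mathcal{M}:(x_0,y)\in\mathcal{E}\}$ is connected via bonds in $\mathcal{E}$. Examples are the triangular lattice and the $d$-dimensional checkerboard lattices for $d\ge3$. Lattice: $\mathcal{B}$ is a set of ordered pairs $(x,y)$ of distinct sites of $\mathcal{M}$ (bonds) such that for any $x,y$ at most one of $(x,y),(y,x)$ lies in $\mathcal{B}$. Put $\mathcal{E}=\mathcal{B}\cup\{(y,x):(x,y)\in\mathcal{B}\}$. Every $x$ has exactly $\zeta$ sites $y$ with $(x,y)\in\mathcal{E}$. For each $(x,y)\in\mathcal{B}$ introduce two additional sites $u(x,y)$ and $\bar u(x,y)$; let $\mathcal{O}$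 and $\bar{\mathcal{O}}$ be the sets of all $u(x,y)$ and all $\bar u(x,y)$ respectively, and let $\Lambda=\mathcal{M}\cup\mathcal{O}\cup\bar{\mathcal{O}}$. Operators: $c_{z,\sigma}$ ($z\in\Lambda$, $\sigma\in\{\uparrow,\downarrow\}$) are the fermion annihilation operators, $n_{z,\sigma}=c^\dagger_{z,\sigma}c_{z,\sigma}$. Fix $\mu>0$. For $x\in\mathcal{M}$, $a_{x,\sigma}=(1+2\zeta\mu^2)^{-1/2}\{c_{x,\sigma}+\mu\sum_{y:(x,y)\in\mathcal{B}}(c_{u(x,y),\sigma}-c_{\bar u(x,y),\sigma})+\mu\sum_{y:(y,x)\in\mathcal{B}}(c_{u(y,x),\sigma}+c_{\bar u(y,x),\sigma})\}$. For $u=u(x,y)$, $b_{u,\sigma}=c_{u,\sigma}-\mu(c_{x,\sigma}+c_{y,\sigma})$; for $\bar u=\bar u(x,y)$, $b_{\bar u,\sigma}=c_{\bar u,\sigma}+\mu(c_{x,\sigma}-c_{y,\sigma})$. Hamiltonian, with $s,t,U>0$: $H=t\sum_{(x,y)\in\mathcal{E},\sigma}a^\dagger_{x,\sigma}a_{y,\sigma}+s\sum_{v\in\mathcal{O}\cup\bar{\mathcal{O}},\sigma}b^\dagger_{v,\sigma}b_{v,\sigma}+U\sum_{z\in\Lambda}n_{z,\uparrow}n_{z,\downarrow}$. It acts on the $N_e$-electron space with $N_e\le|\mathcal{M}|$. Spin: $S^+_z=c^\dagger_{z,\uparrow}c_{z,\downarrow}$, $S^-_z=c^\dagger_{z,\downarrow}c_{z,\uparrow}$,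 $S^{(3)}_z=\tfrac12(n_{z,\uparrow}-n_{z,\downarrow})$, $S^{(1)}_z=(S^+_z+S^-_z)/2$, $S^{(2)}_z=(S^+_z-S^-_z)/(2i)$. The total spin is $\mathbf{S}_{\mathrm{tot}}=\sum_{z\in\Lambda}\mathbf{S}_z$, with eigenvalues of $(\mathbf{S}_{\mathrm{tot}})^2$ written $S_{\mathrm{tot}}(S_{\mathrm{tot}}+1)$. Ground states in the limits: a fixed state $|\Phi\rangle$ is a finite-energy state if $\lim_{s\uparrow\infty}\lim_{U\uparrow\infty}\langle\Phi|H|\Phi\rangle<\infty$. The ground states in the limits $U\uparrow\infty$, $s\uparrow\infty$ are the normalized $N_e$-electron states minimizing this limiting energy. *)

theory Defs
  imports Complex_Main "HOL-Library.Extended_Real"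
begin

section \<open>Sites of the extended lattice Lambda, modes and wavefunctions\<close>

(* LM x : a site x of the lattice M;  LU (x,y) : the site u(x,y);  LUb (x,y) : the site ubar(x,y) *)
datatype 'a lsite = LM 'a | LU "'a \<times> 'a" | LUb "'a \<times> 'a"

(* a one-electron mode (z, sigma); sigma = True means spin up, False spin down *)
type_synonym 'a mode = "'a lsite \<times> bool"

(* N-electron states in first quantization: antisymmetric functions of N modes *)
type_synonym 'a wavefn = "'a mode list \<Rightarrow> complex"

definition symE :: "('a \<times> 'a) set \<Rightarrow> ('a \<times> 'a) set" where
  "symE B = B \<union> {(y, x). (x, y) \<in> B}"

definition nbrs :: "('a \<times> 'a) set \<Rightarrow> 'a \<Rightarrow> 'a set" where
  "nbrs B x = {y. (x, y) \<in> symE B}"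

definition Lam :: "'a set \<Rightarrow> ('a \<times> 'a) set \<Rightarrow> 'a lsite set" where
  "Lam M B = LM ` M \<union> LU ` B \<union> LUb ` B"

definition Ovs :: "('a \<times> 'a) set \<Rightarrow> 'a lsite set" where
  "Ovs B = LU ` B \<union> LUb ` B"

definition modes :: "'a set \<Rightarrow> ('a \<times> 'a) set \<Rightarrow> 'a mode set" where
  "modes M B = Lam M B \<times> UNIV"

definition configs :: "'a set \<Rightarrow> ('a \<times> 'a) set \<Rightarrow> nat \<Rightarrow> 'a mode list set" where
  "configs M B N = {xs. length xs = N \<and> set xs \<subseteq> modes M B}"

section \<open>Closely packed lattices\<close>

definition closely_packed :: "'a set \<Rightarrow> ('a \<times> 'a) set \<Rightarrow> bool" where
  "closely_packed M B \<longleftrightarrow>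
     (\<forall>(x, y) \<in> B. x \<in> M \<and> y \<in> M \<and> x \<noteq> y \<and> (y, x) \<notin> B) \<and>
     (\<forall>x \<in> M. \<forall>y \<in> M. (x, y) \<in> (symE B)\<^sup>*) \<and>
     (\<exists>\<zeta>::nat. \<forall>x \<in> M. card (nbrs B x) = \<zeta>) \<and>
     (\<forall>x0 \<in> M. \<forall>y \<in> nbrs B x0. \<forall>z \<in> nbrs B x0.
        (y, z) \<in> (symE B \<inter> (nbrs B x0 \<times> nbrs B x0))\<^sup>*)"

(* translation-invariant d-dimensional lattices with periodic boundary conditions:
   unit cells indexed by (Z/LZ)^d (int lists with entries in [0,L)), K = sites in a unit cell,
   T = bond types (k, k', v): bond from (x,k) to (x+v mod L, k') *)
definition cells :: "nat \<Rightarrow> nat \<Rightarrow> int list set" where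
  "cells d L = {x. length x = d \<and> (\<forall>i<d. 0 \<le> x ! i \<and> x ! i < int L)}"

definition lsites :: "nat \<Rightarrow> nat \<Rightarrow> 'k set \<Rightarrow> (int list \<times> 'k) set" where
  "lsites d L K = cells d L \<times> K"

definition lbonds :: "nat \<Rightarrow> nat \<Rightarrow> ('k \<times> 'k \<times> int list) set
                      \<Rightarrow> ((int list \<times> 'k) \<times> (int list \<times> 'k)) set" where
  "lbonds d L T = {((x, k), (map2 (\<lambda>a b. (a + b) mod int L) x v, k')) | x k k' v.
                     x \<in> cells d L \<and> (k, k', v) \<in> T}"

section \<open>The single-particle states a_x and b_v\<close>

(* coefficient of c_z in a_x (spin independent) *)
definition acoef :: "('a \<times> 'a) set \<Rightarrow> real \<Rightarrow> 'a \<Rightarrow> 'a lsite \<Rightarrow> real" where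
  "acoef B \<mu> x z = (1 / sqrt (1 + 2 * real (card (nbrs B x)) * \<mu>\<^sup>2)) *
     (case z of
        LM y \<Rightarrow> (if y = x then 1 else 0)
      | LU (p, q) \<Rightarrow> (if (p, q) \<in> B \<and> p = x then \<mu> else 0) + (if (p, q) \<in> B \<and> q = x then \<mu> else 0)
      | LUb (p, q) \<Rightarrow> (if (p, q) \<in> B \<and> p = x then - \<mu> else 0) + (if (p, q) \<in> B \<and> q = x then \<mu> else 0))"

(* coefficient of c_z in b_v, v in O or Obar *)
definition bcoef :: "real \<Rightarrow> 'a lsite \<Rightarrow> 'a lsite \<Rightarrow> real" where
  "bcoef \<mu> v z =
     (case v of
        LM _ \<Rightarrow> 0
      | LU (x, y) \<Rightarrow> (if z = v then 1 else 0) - \<mu> * (if z = LM x then 1 else 0) - \<mu> * (if z = LM y then 1 else 0)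
      | LUb (x, y) \<Rightarrow> (if z = v then 1 else 0) + \<mu> * (if z = LM x then 1 else 0) - \<mu> * (if z = LM y then 1 else 0))"

(* single-particle matrix <m| t sum_{(x,y) in E} a_x^dag a_y |m'> *)
definition hop_mat :: "('a \<times> 'a) set \<Rightarrow> real \<Rightarrow> real \<Rightarrow> 'a mode \<Rightarrow> 'a mode \<Rightarrow> real" where
  "hop_mat B t \<mu> m m' = (if snd m = snd m' then
      t * (\<Sum>(x, y) \<in> symE B. acoef B \<mu> x (fst m) * acoef B \<mu> y (fst m')) else 0)"

(* single-particle matrix <m| s sum_v b_v^dag b_v |m'> *)
definition b_mat :: "('a \<times> 'a) set \<Rightarrow> real \<Rightarrow> real \<Rightarrow> 'a mode \<Rightarrow> 'a mode \<Rightarrow> real" where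
  "b_mat B s \<mu> m m' = (if snd m = snd m' then
      s * (\<Sum>v \<in> Ovs B. bcoef \<mu> v (fst m) * bcoef \<mu> v (fst m')) else 0)"

section \<open>Operators on N-electron wavefunctions\<close>

(* second-quantized sum_{m,m'} h(m,m') c_m^dag c_m' acting on first-quantized states *)
definition one_body :: "'a mode set \<Rightarrow> ('a mode \<Rightarrow> 'a mode \<Rightarrow> complex) \<Rightarrow> 'a wavefn \<Rightarrow> 'a wavefn" where
  "one_body Md h \<psi> xs = (\<Sum>i < length xs. \<Sum>m \<in> Md. h (xs ! i) m * \<psi> (xs[i := m]))"

(* sum_z n_{z,up} n_{z,down} as a multiplication operator *)
definition double_occ :: "'a mode list \<Rightarrow> nat" where
  "double_occ xs = card {(i, j). i < length xs \<and> j < length xs \<and>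
      fst (xs ! i) = fst (xs ! j) \<and> snd (xs ! i) \<and> \<not> snd (xs ! j)}"

definition hamiltonian :: "'a set \<Rightarrow> ('a \<times> 'a) set \<Rightarrow> real \<Rightarrow> real \<Rightarrow> real \<Rightarrow> real
                           \<Rightarrow> 'a wavefn \<Rightarrow> 'a wavefn" where
  "hamiltonian M B t \<mu> s U \<psi> xs =
     one_body (modes M B) (\<lambda>m m'. complex_of_real (hop_mat B t \<mu> m m' + b_mat B s \<mu> m m')) \<psi> xs
     + complex_of_real (U * real (double_occ xs)) * \<psi> xs"

definition in_space :: "'a set \<Rightarrow> ('a \<times> 'a) set \<Rightarrow> nat \<Rightarrow> 'a wavefn \<Rightarrow> bool" where
  "in_space M B N \<Phi> \<longleftrightarrow>
     (\<forall>xs. xs \<notin> configs M B N \<longrightarrow> \<Phi> xs = 0) \<and>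
     (\<forall>xs i j. i < length xs \<longrightarrow> j < length xs \<longrightarrow> i \<noteq> j \<longrightarrow>
        \<Phi> (xs[i := xs ! j, j := xs ! i]) = - \<Phi> xs)"

definition braket :: "'a set \<Rightarrow> ('a \<times> 'a) set \<Rightarrow> nat \<Rightarrow> 'a wavefn \<Rightarrow> 'a wavefn \<Rightarrow> complex" where
  "braket M B N \<phi> \<psi> = (\<Sum>xs \<in> configs M B N. cnj (\<phi> xs) * \<psi> xs)"

definition normalized :: "'a set \<Rightarrow> ('a \<times> 'a) set \<Rightarrow> nat \<Rightarrow> 'a wavefn \<Rightarrow> bool" where
  "normalized M B N \<Phi> \<longleftrightarrow> (\<Sum>xs \<in> configs M B N. (cmod (\<Phi> xs))\<^sup>2) = 1"

definition energy :: "'a set \<Rightarrow> ('a \<times> 'a) set \<Rightarrow> nat \<Rightarrow> real \<Rightarrow> real \<Rightarrow> real \<Rightarrow> real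
                      \<Rightarrow> 'a wavefn \<Rightarrow> real" where
  "energy M B N t \<mu> s U \<Phi> = Re (braket M B N \<Phi> (hamiltonian M B t \<mu> s U \<Phi>))"

(* lim_{s -> oo} lim_{U -> oo} <Phi|H|Phi>, as an extended real *)
definition lim_energy :: "'a set \<Rightarrow> ('a \<times> 'a) set \<Rightarrow> nat \<Rightarrow> real \<Rightarrow> real \<Rightarrow> 'a wavefn \<Rightarrow> ereal" where
  "lim_energy M B N t \<mu> \<Phi> =
     Lim at_top (\<lambda>s. Lim at_top (\<lambda>U. ereal (energy M B N t \<mu> s U \<Phi>)))"

definition ground_state_lim :: "'a set \<Rightarrow> ('a \<times> 'a) set \<Rightarrow> nat \<Rightarrow> real \<Rightarrow> real \<Rightarrow> 'a wavefn \<Rightarrow> bool" where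
  "ground_state_lim M B N t \<mu> \<Phi> \<longleftrightarrow>
     in_space M B N \<Phi> \<and> normalized M B N \<Phi> \<and> lim_energy M B N t \<mu> \<Phi> < \<infinity> \<and>
     (\<forall>\<Psi>. in_space M B N \<Psi> \<and> normalized M B N \<Psi> \<longrightarrow>
        lim_energy M B N t \<mu> \<Phi> \<le> lim_energy M B N t \<mu> \<Psi>)"

section \<open>Spin operators\<close>

(* single-site matrices of S^+ = c_up^dag c_down and S^- = c_down^dag c_up *)
definition splus_mat :: "'a mode \<Rightarrow> 'a mode \<Rightarrow> complex" where
  "splus_mat m m' = (if fst m = fst m' \<and> snd m \<and> \<not> snd m' then 1 else 0)"

definition sminus_mat :: "'a mode \<Rightarrow> 'a mode \<Rightarrow> complex" where
  "sminus_mat m m' = (if fst m = fst m' \<and> \<not> snd m \<and> snd m' then 1 else 0)"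

definition s1_mat :: "'a mode \<Rightarrow> 'a mode \<Rightarrow> complex" where
  "s1_mat m m' = (splus_mat m m' + sminus_mat m m') / 2"

definition s2_mat :: "'a mode \<Rightarrow> 'a mode \<Rightarrow> complex" where
  "s2_mat m m' = (splus_mat m m' - sminus_mat m m') / (2 * \<i>)"

definition s3_mat :: "'a mode \<Rightarrow> 'a mode \<Rightarrow> complex" where
  "s3_mat m m' = (if m = m' then (if snd m then 1 / 2 else - 1 / 2) else 0)"

(* (S_tot)^2 = sum_a (S_tot^(a))^2 *)
definition Stot_sq :: "'a set \<Rightarrow> ('a \<times> 'a) set \<Rightarrow> 'a wavefn \<Rightarrow> 'a wavefn" where
  "Stot_sq M B \<psi> =
     (\<lambda>xs. one_body (modes M B) s1_mat (one_body (modes M B) s1_mat \<psi>) xs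
         + one_body (modes M B) s2_mat (one_body (modes M B) s2_mat \<psi>) xs
         + one_body (modes M B) s3_mat (one_body (modes M B) s3_mat \<psi>) xs)"

(* Phi lies in the sum of the eigenspaces of (S_tot)^2 with eigenvalue S(S+1), S >= S0 *)
definition total_spin_ge :: "'a set \<Rightarrow> ('a \<times> 'a) set \<Rightarrow> nat \<Rightarrow> real \<Rightarrow> 'a wavefn \<Rightarrow> bool" where
  "total_spin_ge M B N S0 \<Phi> \<longleftrightarrow>
     (\<exists>n (\<psi>s :: nat \<Rightarrow> 'a wavefn) (Ss :: nat \<Rightarrow> real).
        \<Phi> = (\<lambda>xs. \<Sum>i<n. \<psi>s i xs) \<and>
        (\<forall>i<n. in_space M B N (\<psi>s i) \<and> Ss i \<ge> S0 \<and>
               Stot_sq M B (\<psi>s i) = (\<lambda>xs. complex_of_real (Ss i * (Ss i + 1)) * \<psi>s i xs)))"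

end

theory Submission
  imports Defs "HOL-Computational_Algebra.Fundamental_Theorem_Algebra" "HOL-Combinatorics.Permutations"
    "HOL-Library.Function_Algebras"
begin

text \<open>
  A state of finite limiting energy is annihilated by all b-orbitals and has no doubly occupied site,
  so it is determined by its values on the sites of M, and the spins of electrons on neighbouring
  sites are symmetric (excluding double occupancy of u(x,y) forbids a singlet on the bond).  In the
  remaining Hamiltonian the holes hop with amplitude -t, and comparing amplitudes by AM-GM the energy
  is at least -t (zeta h - q), where h is the number of holes and q counts ordered pairs of adjacent
  holes.  A Slater determinant whose holes sit in disjoint boxes has energy at most
  -t (zeta h - C h / l^2), where l is the side of the boxes, so that h l^d is of order |M|.

  Since the total spin commutes with the Hamiltonian, a ground state is a sum of spin eigenstates each
  of minimal energy.  In a configuration contributing to total spin below nu N/2, many pairs of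
  electrons lie in different clusters of occupied sites, because each connected cluster carries
  maximal spin.  Because the lattice is closely packed, holes without a neighbouring hole separate
  nothing, so by an isoperimetric inequality at least of order ((1 - nu) |M|)^((d-1)/d) holes have an
  adjacent hole.  This exceeds C h / l^2 under the hypothesis on the electron number.
\<close>

section \<open>Spectral decomposition for a symmetric operator\<close>

text \<open>The exponents come from balancing two powers. With h l^d of order |M| the loss h / l^2
  is of order h^((d+2)/d) |M|^(-2/d); requiring it to stay below ((1 - nu) |M|)^((d-1)/d) is the
  stated bound on h. Both energies share the term -t zeta h, so only these corrections are compared,
  and t drops out. The obstacle is uniformity: one constant must serve all sizes L, although
  connectedness is a hypothesis on each torus separately and bond vectors may wrap around small
  tori. Displacements are therefore followed in Z^d rather than modulo L. One connected torus with L
  at least 2 already yields closed walks with displacement N e_i; they exist on every torus, with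
  lengths independent of L, and they drive the isoperimetric inequality. If there is no such torus,
  only L = 1 remains, with at most \<open>card K\<close> sites. The spectral theorem is proved on a
  subspace, because the parts of a ground state must again have finite energy in order to compete
  for the minimum.\<close>

lemma sum_apply: "(\<Sum>y\<in>X. F y) x = (\<Sum>y\<in>X. (F y x :: 'c :: comm_monoid_add))"
  by (induction X rule: infinite_finite_induct) auto

text \<open>The functions lie in the span of \<open>card X\<close> point masses, so
  \<open>card X + 1\<close> of them are dependent. A repetition among them is treated apart, since
  \<open>vs.dependent\<close> speaks of a set of vectors and not of a family.\<close>

lemma finite_dim_dependent:
  fixes g :: "nat \<Rightarrow> 'b \<Rightarrow> complex"
  assumes "finite X" and supp: "\<And>k x. x \<notin> X \<Longrightarrow> g k x = 0"
  obtains n c where "\<exists>k\<le>n. c k \<noteq> 0" "\<And>x. (\<Sum>k\<le>n. c k * g k x) = (0::complex)"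
proof -
  interpret vs: vector_space "\<lambda>(c::complex) (f::'b \<Rightarrow> complex) x. c * f x"
    by unfold_locales (auto simp: fun_eq_iff algebra_simps)
  define \<delta> where "\<delta> y = (\<lambda>x. if x = y then 1 else 0::complex)" for y :: 'b
  have span: "f \<in> vs.span (\<delta> ` X)" if "\<And>x. x \<notin> X \<Longrightarrow> f x = 0" for f
  proof -
    have "f = (\<Sum>y\<in>X. (\<lambda>x. f y * \<delta> y x))"
    proof
      fix x
      have "(\<Sum>y\<in>X. f y * \<delta> y x) = f x"
        using assms(1) that[of x] by (auto simp: \<delta>_def if_distrib[of "\<lambda>t. _ * t"] sum.delta cong: if_cong)
      then show "f x = (\<Sum>y\<in>X. (\<lambda>x. f y * \<delta> y x)) x"
        by (simp add: sum_apply)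
    qed
    moreover have "\<dots> \<in> vs.span (\<delta> ` X)"
      by (intro vs.span_sum vs.span_scale vs.span_base) auto
    ultimately show ?thesis by simp
  qed
  let ?n = "card X"
  show ?thesis
  proof (cases "inj_on g {..?n}")
    case True
    have "vs.dependent (g ` {..?n})"
    proof (rule ccontr)
      assume "\<not> vs.dependent (g ` {..?n})"
      moreover have "g ` {..?n} \<subseteq> vs.span (\<delta> ` X)" using span supp by blast
      ultimately have "card (g ` {..?n}) \<le> card (\<delta> ` X)"
        using vs.independent_span_bound[of "\<delta> ` X" "g ` {..?n}"] assms(1) by auto
      moreover have "card (\<delta> ` X) \<le> ?n" using assms(1) card_image_le by blast
      ultimately show False using card_image[OF True] by simp
    qed
    then obtain u where u: "\<exists>v\<in>g ` {..?n}. u v \<noteq> 0" "(\<Sum>v\<in>g ` {..?n}. (\<lambda>x. u v * v x)) = 0"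
      using vs.dependent_finite[of "g ` {..?n}"] by auto
    have "(\<Sum>k\<le>?n. u (g k) * g k x) = 0" for x
    proof -
      have "(\<Sum>k\<le>?n. u (g k) * g k x) = (\<Sum>v\<in>g ` {..?n}. (\<lambda>x. u v * v x)) x"
        by (simp add: sum_apply sum.reindex[OF True])
      then show ?thesis by (simp add: u(2))
    qed
    with u(1) show ?thesis by (intro that[of ?n "\<lambda>k. u (g k)"]) auto
  next
    case False
    then obtain i j where ij: "i \<le> ?n" "j \<le> ?n" "i \<noteq> j" "g i = g j"
      by (auto simp: inj_on_def)
    define c where "c k = (if k = i then 1 else if k = j then -1 else 0::complex)" for k
    have "(\<Sum>k\<le>?n. c k * g k x) = 0" for x
    proof -
      have "(\<Sum>k\<le>?n. c k * g k x) = (\<Sum>k\<in>{i,j}. c k * g k x)"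
        using ij by (intro sum.mono_neutral_right) (auto simp: c_def)
      then show ?thesis using ij by (simp add: c_def)
    qed
    then show ?thesis using ij by (intro that[of ?n c]) (auto simp: c_def)
  qed
qed

text \<open>The subspace \<open>V\<close> is part of the data because the spectral parts must stay
  in it: for the spin operator it is the space of finite-energy states.\<close>

locale symmetric_operator =
  fixes X :: "'b set" and V :: "('b \<Rightarrow> complex) set"
    and A :: "('b \<Rightarrow> complex) \<Rightarrow> 'b \<Rightarrow> complex"
  assumes finite_X: "finite X"
    and supp: "f \<in> V \<Longrightarrow> x \<notin> X \<Longrightarrow> f x = 0"
    and comb: "f \<in> V \<Longrightarrow> g \<in> V \<Longrightarrow> (\<lambda>x. a * f x + b * g x) \<in> V"
    and maps: "f \<in> V \<Longrightarrow> A f \<in> V"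
    and lin: "f \<in> V \<Longrightarrow> g \<in> V \<Longrightarrow> A (\<lambda>x. a * f x + b * g x) = (\<lambda>x. a * A f x + b * A g x)"
    and sym: "f \<in> V \<Longrightarrow> g \<in> V \<Longrightarrow> (\<Sum>x\<in>X. cnj (f x) * A g x) = (\<Sum>x\<in>X. cnj (A f x) * g x)"
begin

lemma norm_zero:
  assumes "f \<in> V" "(\<Sum>x\<in>X. cnj (f x) * f x) = 0"
  shows "f = (\<lambda>x. 0)"
proof -
  have "complex_of_real (\<Sum>x\<in>X. (cmod (f x))\<^sup>2) = 0"
    using assms(2) by (simp only: of_real_sum complex_norm_square mult.commute)
  then have "(\<Sum>x\<in>X. (cmod (f x))\<^sup>2) = 0" using of_real_eq_0_iff by blast
  then have "\<forall>x\<in>X. f x = 0" using finite_X by (subst (asm) sum_nonneg_eq_0_iff) auto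
  then show ?thesis using supp[OF assms(1)] by auto
qed

lemma zero_in: "f \<in> V \<Longrightarrow> (\<lambda>x. 0) \<in> V"
  using comb[of f f 0 0] by simp

lemma sum_in:
  assumes "finite R" "\<And>r. r \<in> R \<Longrightarrow> g r \<in> V" "f \<in> V"
  shows "(\<lambda>x. \<Sum>r\<in>R. b r * g r x) \<in> V \<and> A (\<lambda>x. \<Sum>r\<in>R. b r * g r x) = (\<lambda>x. \<Sum>r\<in>R. b r * A (g r) x)"
  using assms
proof (induction R rule: finite_induct)
  case empty
  then show ?case using zero_in[of f] lin[of f f 0 0] by simp
next
  case (insert r R)
  then have "(\<lambda>x. \<Sum>r\<in>R. b r * g r x) \<in> V" "A (\<lambda>x. \<Sum>r\<in>R. b r * g r x) = (\<lambda>x. \<Sum>r\<in>R. b r * A (g r) x)"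
    by auto
  then show ?case
    using insert comb[of "g r" "\<lambda>x. \<Sum>r\<in>R. b r * g r x" "b r" 1] lin[of "g r" "\<lambda>x. \<Sum>r\<in>R. b r * g r x" "b r" 1]
    by simp
qed

lemma eigen_real:
  assumes "f \<in> V" "A f = (\<lambda>x. z * f x)" "f \<noteq> (\<lambda>x. 0)"
  shows "z \<in> \<real>"
proof -
  have "z * (\<Sum>x\<in>X. cnj (f x) * f x) = cnj z * (\<Sum>x\<in>X. cnj (f x) * f x)"
    using sym[OF assms(1) assms(1)] by (simp add: assms(2) sum_distrib_left algebra_simps)
  then have "z = cnj z" using norm_zero assms by (metis mult_cancel_right)
  then show ?thesis by (simp add: Reals_cnj_iff)
qed

lemma orthogonal:
  assumes "f \<in> V" "g \<in> V" "A f = (\<lambda>x. complex_of_real r * f x)" "A g = (\<lambda>x. complex_of_real q * g x)" "r \<noteq> q"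
  shows "(\<Sum>x\<in>X. cnj (f x) * g x) = 0"
proof -
  have "q * (\<Sum>x\<in>X. cnj (f x) * g x) = r * (\<Sum>x\<in>X. cnj (f x) * g x)"
    using sym[OF assms(1,2)] by (simp add: assms(3,4) sum_distrib_left algebra_simps)
  then show ?thesis using assms(5) by simp
qed

text \<open>Indexing by the eigenvalues themselves makes different parts belong to different
  eigenvalues. A part may vanish.\<close>

definition spectral :: "('b \<Rightarrow> complex) \<Rightarrow> bool" where
  "spectral f \<longleftrightarrow> (\<exists>R comp. finite (R::real set) \<and>
     (\<forall>r\<in>R. comp r \<in> V \<and> A (comp r) = (\<lambda>x. complex_of_real r * comp r x)) \<and>
     f = (\<lambda>x. \<Sum>r\<in>R. comp r x))"

text \<open>Away from the eigenvalue z, the equation (A - z) \<phi> = right-hand side is solved by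
  dividing each part by r - z. The remainder \<chi> is then sent by A - z into the eigenspace of z;
  symmetry rules out a Jordan block, so \<chi> is itself an eigenvector.\<close>

lemma spectral_shift:
  assumes f: "f \<in> V" and h: "spectral (\<lambda>x. A f x - z * f x)"
  shows "spectral f"
proof -
  obtain R comp where R: "finite (R::real set)"
     and comp: "\<And>r. r\<in>R \<Longrightarrow> comp r \<in> V" "\<And>r. r \<in> R \<Longrightarrow> A (comp r) = (\<lambda>x. complex_of_real r * comp r x)"
     and eq: "(\<lambda>x. A f x - z * f x) = (\<lambda>x. \<Sum>r\<in>R. comp r x)"
    using h unfolding spectral_def by blast
  define R' where "R' = {r \<in> R. complex_of_real r \<noteq> z}"
  define b where "b r = (1 / (complex_of_real r - z))" for r
  have R': "finite R'" "R' \<subseteq> R" using R by (auto simp: R'_def)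
  define \<phi> where "\<phi> = (\<lambda>x. \<Sum>r\<in>R'. b r * comp r x)"
  have \<phi>: "\<phi> \<in> V" "A \<phi> = (\<lambda>x. \<Sum>r\<in>R'. b r * A (comp r) x)"
    using sum_in[OF R'(1), of comp f b] R' comp f unfolding \<phi>_def by auto
  define \<chi> where "\<chi> = (\<lambda>x. 1 * f x + (-1) * \<phi> x)"
  have \<chi>: "\<chi> \<in> V" "A \<chi> = (\<lambda>x. 1 * A f x + (-1) * A \<phi> x)"
    using comb[OF f \<phi>(1), of 1 "-1"] lin[OF f \<phi>(1), of 1 "-1"] unfolding \<chi>_def by auto
  have A\<phi>: "A \<phi> x - z * \<phi> x = (\<Sum>r\<in>R'. comp r x)" for x
    unfolding \<phi>(2) unfolding \<phi>_def sum_distrib_left sum_subtractf[symmetric]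
  proof (rule sum.cong)
    fix r assume "r \<in> R'"
    then have r: "complex_of_real r - z \<noteq> 0" "A (comp r) = (\<lambda>x. complex_of_real r * comp r x)"
      using comp by (auto simp: R'_def)
    have "b r * A (comp r) x - z * (b r * comp r x) = b r * (complex_of_real r - z) * comp r x"
      by (simp add: r(2) algebra_simps)
    then show "b r * A (comp r) x - z * (b r * comp r x) = comp r x" using r(1) by (simp add: b_def)
  qed simp
  have part: "A \<chi> x - z * \<chi> x = (\<Sum>r\<in>R - R'. comp r x)" for x
  proof -
    have "A \<chi> x - z * \<chi> x = (A f x - z * f x) - (A \<phi> x - z * \<phi> x)"
      unfolding \<chi>(2) unfolding \<chi>_def by (simp add: algebra_simps)
    also have "\<dots> = (\<Sum>r\<in>R. comp r x) - (\<Sum>r\<in>R'. comp r x)"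
      using fun_cong[OF eq, of x] A\<phi> by simp
    also have "\<dots> = (\<Sum>r\<in>R - R'. comp r x)" by (simp add: sum_diff R R')
    finally show ?thesis .
  qed
  have eig: "A \<chi> = (\<lambda>x. z * \<chi> x)"
  proof (cases "R - R' = {}")
    case True
    have "A \<chi> x = z * \<chi> x" for x using part[of x] unfolding True by simp
    then show ?thesis by auto
  next
    case False
    then obtain r where r: "complex_of_real r = z" "r \<in> R" by (auto simp: R'_def)
    have Rr: "R - R' = {r}" using r by (auto simp: R'_def)
    define g where "g = comp r"
    have g: "g \<in> V" "A g = (\<lambda>x. z * g x)" using comp r by (auto simp: g_def)
    have gx: "A \<chi> x - z * \<chi> x = g x" for x using part Rr by (simp add: g_def)
    have zr: "cnj z = z" using r(1) by auto
    \<comment> \<open>\<open>g\<close> lies both in the kernel and in the range of A - z with z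
      real, hence is orthogonal to itself.\<close>
    have "(\<Sum>x\<in>X. cnj (g x) * g x) = (\<Sum>x\<in>X. cnj (g x) * A \<chi> x) - z * (\<Sum>x\<in>X. cnj (g x) * \<chi> x)"
      unfolding gx[symmetric] sum_distrib_left sum_subtractf[symmetric]
      by (simp add: algebra_simps)
    also have "\<dots> = 0"
      unfolding sym[OF g(1) \<chi>(1)] g(2) by (simp add: zr sum_distrib_left algebra_simps)
    finally have "g = (\<lambda>x. 0)" using norm_zero g by blast
    then show ?thesis using gx by (auto simp: fun_eq_iff)
  qed
  show ?thesis
  proof (cases "\<chi> = (\<lambda>x. 0)")
    case True
    then have "f = (\<lambda>x. \<Sum>r\<in>R'. b r * comp r x)"
      unfolding \<chi>_def \<phi>_def by (auto simp: fun_eq_iff)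
    moreover have "(\<lambda>x. b r * comp r x) \<in> V \<and> A (\<lambda>x. b r * comp r x) = (\<lambda>x. complex_of_real r * (b r * comp r x))"
      if "r \<in> R'" for r
      using comb[of "comp r" "comp r" "b r" 0] lin[of "comp r" "comp r" "b r" 0] comp[of r] that R'
      by (auto simp: fun_eq_iff)
    ultimately show ?thesis unfolding spectral_def using R' by (intro exI[of _ R'] exI[of _ "\<lambda>r x. b r * comp r x"]) auto
  next
    case False
    then obtain q where q: "z = complex_of_real q" using eigen_real[OF \<chi>(1) eig] Reals_cases by blast
    define comp' where "comp' r = (if r = q then \<chi> else (\<lambda>x. b r * comp r x))" for r
    have qn: "q \<notin> R'" using q by (auto simp: R'_def)
    have "f = (\<lambda>x. \<Sum>r\<in>insert q R'. comp' r x)"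
    proof
      fix x
      have "(\<Sum>r\<in>R'. comp' r x) = \<phi> x" unfolding \<phi>_def using qn by (intro sum.cong) (auto simp: comp'_def)
      then show "f x = (\<Sum>r\<in>insert q R'. comp' r x)"
        using qn R' by (simp add: comp'_def \<chi>_def)
    qed
    moreover have "comp' r \<in> V \<and> A (comp' r) = (\<lambda>x. complex_of_real r * comp' r x)"
      if "r \<in> insert q R'" for r
    proof (cases "r = q")
      case True
      then show ?thesis using \<chi> eig q by (auto simp: comp'_def)
    next
      case False
      then have "r \<in> R'" using that by auto
      then show ?thesis
        using comb[of "comp r" "comp r" "b r" 0] lin[of "comp r" "comp r" "b r" 0] comp[of r] R' False
        by (auto simp: fun_eq_iff comp'_def)
    qed
    ultimately show ?thesis unfolding spectral_def using R' by (intro exI[of _ "insert q R'"] exI[of _ comp']) auto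
  qed
qed

lemma pow_in: "f \<in> V \<Longrightarrow> (A ^^ k) f \<in> V"
  by (induction k) (auto intro: maps)

text \<open>Induction on the degree: p has a root z by the fundamental theorem of algebra, the
  quotient annihilates (A - z) f, and \<open>spectral_shift\<close> leads from there back to
  f.\<close>

lemma spectral_annihilated:
  assumes "p \<noteq> 0" "degree p = n" "f \<in> V" "\<And>x. (\<Sum>k\<le>n. coeff p k * (A ^^ k) f x) = 0"
  shows "spectral f"
  using assms
proof (induction n arbitrary: p f)
  case 0
  then have "coeff p 0 \<noteq> 0" by (metis leading_coeff_0_iff)
  then have "f = (\<lambda>x. 0)" using 0(4) by auto
  then show ?case unfolding spectral_def by (intro exI[of _ "{}"]) auto
next
  case (Suc n)
  have "\<not> constant (poly p)" using Suc.prems(2) by (simp add: constant_degree)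
  then obtain z where z: "poly p z = 0" using fundamental_theorem_of_algebra by blast
  then obtain q where q: "p = [:-z, 1:] * q" by (auto simp: poly_eq_0_iff_dvd elim: dvdE)
  have q0: "q \<noteq> 0" using q Suc.prems by auto
  have degq: "degree q = n" using Suc.prems(2) q0 degree_mult_eq[of "[:-z, 1:]" q] unfolding q by simp
  define g where "g = (\<lambda>x. A f x - z * f x)"
  have g: "g \<in> V" using comb[OF maps[OF Suc.prems(3)] Suc.prems(3), of 1 "-z"] unfolding g_def by simp
  have pg: "(A ^^ k) g = (\<lambda>x. (A ^^ Suc k) f x - z * (A ^^ k) f x)" for k
  proof (induction k)
    case 0
    then show ?case by (simp add: g_def)
  next
    case (Suc k)
    show ?case
      using lin[OF pow_in[OF \<open>f \<in> V\<close>, of "Suc k"] pow_in[OF \<open>f \<in> V\<close>, of k], of 1 "-z"]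
      by (simp add: Suc)
  qed
  have "(\<Sum>k\<le>n. coeff q k * (A ^^ k) g x) = 0" for x
  proof -
    have cp: "coeff p k = (if k = 0 then 0 else coeff q (k - 1)) - z * coeff q k" for k
      unfolding q by (cases k) (auto simp: coeff_pCons)
    have "(\<Sum>k\<le>Suc n. coeff p k * (A ^^ k) f x)
        = (\<Sum>k\<le>Suc n. (if k = 0 then 0 else coeff q (k - 1)) * (A ^^ k) f x)
          - z * (\<Sum>k\<le>Suc n. coeff q k * (A ^^ k) f x)"
      by (simp add: cp sum_distrib_left sum_subtractf algebra_simps del: sum.atMost_Suc)
    also have "(\<Sum>k\<le>Suc n. (if k = 0 then 0 else coeff q (k - 1)) * (A ^^ k) f x)
        = (\<Sum>k\<le>n. coeff q k * (A ^^ Suc k) f x)"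
      by (subst sum.atMost_Suc_shift) simp
    also have "(\<Sum>k\<le>Suc n. coeff q k * (A ^^ k) f x) = (\<Sum>k\<le>n. coeff q k * (A ^^ k) f x)"
      using degq by (simp add: coeff_eq_0)
    also have "(\<Sum>k\<le>n. coeff q k * (A ^^ Suc k) f x) - z * (\<Sum>k\<le>n. coeff q k * (A ^^ k) f x)
        = (\<Sum>k\<le>n. coeff q k * (A ^^ k) g x)"
      unfolding pg sum_distrib_left sum_subtractf[symmetric] by (simp add: algebra_simps)
    finally show ?thesis using Suc.prems(4) by simp
  qed
  then have "spectral g" using Suc.IH[OF q0 degq g] by blast
  then show ?case using spectral_shift[OF Suc.prems(3)] g_def by blast
qed

text \<open>Finite dimension makes the powers of \<open>A\<close> applied to \<open>f\<close>
  dependent, and a dependence is a nonzero polynomial annihilating \<open>f\<close>.\<close>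

lemma spectral_all:
  assumes "f \<in> V"
  shows "spectral f"
proof -
  have "\<And>k x. x \<notin> X \<Longrightarrow> (A ^^ k) f x = 0" using supp pow_in[OF assms] by blast
  then obtain n c where c: "\<exists>k\<le>n. c k \<noteq> 0" "\<And>x. (\<Sum>k\<le>n. c k * (A ^^ k) f x) = (0::complex)"
    using finite_dim_dependent[OF finite_X, of "\<lambda>k. (A ^^ k) f"] by blast
  define p where "p = (\<Sum>k\<le>n. monom (c k) k)"
  have cp: "coeff p k = (if k \<le> n then c k else 0)" for k
    by (simp add: p_def coeff_sum)
  have p0: "p \<noteq> 0" using c(1) cp by (metis coeff_0)
  have "degree p \<le> n" by (rule degree_le) (simp add: cp)
  then have "(\<Sum>k\<le>degree p. coeff p k * (A ^^ k) f x) = (\<Sum>k\<le>n. coeff p k * (A ^^ k) f x)" for x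
    by (intro sum.mono_neutral_left) (auto simp: coeff_eq_0)
  also have "\<dots> x = 0" for x using c(2)[of x] by (simp add: cp)
  finally show ?thesis using spectral_annihilated[OF p0 refl assms] by blast
qed

end

section \<open>Orthonormal families of functions on a finite set\<close>

definition orthonormal :: "'b set \<Rightarrow> nat \<Rightarrow> (nat \<Rightarrow> 'b \<Rightarrow> real) \<Rightarrow> bool" where
  "orthonormal X n f \<longleftrightarrow> (\<forall>i<n. \<forall>j<n. (\<Sum>x\<in>X. f i x * f j x) = (if i = j then 1 else 0))"

text \<open>\<open>g\<close> is the point mass at x minus its projection to the span. It vanishes
  exactly if that point mass lies in the span, which serves both to extend a family and to recognise
  a complete one.\<close>

lemma orthonormal_residual:
  assumes "finite X" "orthonormal X n f" "x \<in> X"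
  defines "g \<equiv> \<lambda>y. (if y = x then 1 else 0) - (\<Sum>j<n. f j x * f j y)"
  shows "(\<Sum>y\<in>X. (g y)\<^sup>2) = 1 - (\<Sum>j<n. (f j x)\<^sup>2)" and "k < n \<Longrightarrow> (\<Sum>y\<in>X. f k y * g y) = 0"
proof -
  have on: "(\<Sum>y\<in>X. f i y * f j y) = (if i = j then 1 else 0)" if "i < n" "j < n" for i j
    using assms(2) that by (auto simp: orthonormal_def)
  have ort: "(\<Sum>y\<in>X. f k y * g y) = 0" if "k < n" for k
  proof -
    have "(\<Sum>y\<in>X. f k y * g y) = (\<Sum>y\<in>X. f k y * (if y = x then 1 else 0)) - (\<Sum>y\<in>X. \<Sum>j<n. f j x * (f k y * f j y))"
      unfolding g_def right_diff_distrib sum_subtractf sum_distrib_left by (simp add: algebra_simps)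
    also have "(\<Sum>y\<in>X. f k y * (if y = x then 1 else 0)) = f k x"
      using assms(1,3) by (simp add: if_distrib[of "\<lambda>t. _ * t"] cong: if_cong)
    also have "(\<Sum>y\<in>X. \<Sum>j<n. f j x * (f k y * f j y)) = (\<Sum>j<n. f j x * (\<Sum>y\<in>X. f k y * f j y))"
      by (subst sum.swap) (simp add: sum_distrib_left)
    also have "\<dots> = (\<Sum>j<n. if k = j then f j x else 0)"
      by (intro sum.cong) (auto simp: on that)
    also have "\<dots> = f k x" using that by simp
    finally show ?thesis by simp
  qed
  then show "k < n \<Longrightarrow> (\<Sum>y\<in>X. f k y * g y) = 0" .
  have "(\<Sum>y\<in>X. (g y)\<^sup>2) = (\<Sum>y\<in>X. (if y = x then g y else 0) - (\<Sum>j<n. f j x * (f j y * g y)))"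
  proof (rule sum.cong)
    fix y
    have "(\<Sum>j<n. f j x * (f j y * g y)) = (\<Sum>j<n. f j x * f j y) * g y"
      by (simp add: sum_distrib_right mult.assoc)
    moreover have "(g y)\<^sup>2 = ((if y = x then 1 else 0) - (\<Sum>j<n. f j x * f j y)) * g y"
      by (simp add: g_def power2_eq_square)
    ultimately show "(g y)\<^sup>2 = (if y = x then g y else 0) - (\<Sum>j<n. f j x * (f j y * g y))"
      by (simp add: left_diff_distrib)
  qed simp
  also have "\<dots> = g x - (\<Sum>j<n. f j x * (\<Sum>y\<in>X. f j y * g y))"
  proof -
    have "(\<Sum>y\<in>X. \<Sum>j<n. f j x * (f j y * g y)) = (\<Sum>j<n. f j x * (\<Sum>y\<in>X. f j y * g y))"
      by (subst sum.swap) (simp add: sum_distrib_left)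
    then show ?thesis unfolding sum_subtractf using assms(1,3) by simp
  qed
  also have "\<dots> = g x" by (simp add: ort)
  also have "\<dots> = 1 - (\<Sum>j<n. (f j x)\<^sup>2)" by (simp add: g_def power2_eq_square)
  finally show "(\<Sum>y\<in>X. (g y)\<^sup>2) = 1 - (\<Sum>j<n. (f j x)\<^sup>2)" .
qed

lemma orthonormal_trace:
  assumes "finite X" "orthonormal X n f"
  shows "(\<Sum>x\<in>X. \<Sum>j<n. (f j x)\<^sup>2) = real n"
proof -
  have "(\<Sum>x\<in>X. \<Sum>j<n. (f j x)\<^sup>2) = (\<Sum>j<n. \<Sum>x\<in>X. f j x * f j x)"
    by (subst sum.swap) (simp add: power2_eq_square)
  also have "\<dots> = (\<Sum>j<n. 1)" using assms(2) by (intro sum.cong) (auto simp: orthonormal_def)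
  finally show ?thesis by simp
qed

text \<open>Gram-Schmidt on a point mass: the squared norms of the projections of all point masses
  sum to the size of the family, so while this is below \<open>card X\<close> some projection is
  shorter than 1.\<close>

lemma orthonormal_extend:
  assumes "finite X" "orthonormal X n f" "n \<le> m" "m \<le> card X"
  obtains f' where "orthonormal X m f'" "\<And>j. j < n \<Longrightarrow> f' j = f j"
proof -
  have "\<exists>f'. orthonormal X m f' \<and> (\<forall>j<n. f' j = f j)"
    using assms(3,4)
  proof (induction m rule: dec_induct)
    case base
    then show ?case using assms(2) by blast
  next
    case (step m)
    then obtain f' where f': "orthonormal X m f'" "\<forall>j<n. f' j = f j" by auto
    have "\<exists>x\<in>X. (\<Sum>j<m. (f' j x)\<^sup>2) < 1"
    proof (rule ccontr)
      assume "\<not> ?thesis"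
      then have "(\<Sum>x\<in>X. (1::real)) \<le> (\<Sum>x\<in>X. \<Sum>j<m. (f' j x)\<^sup>2)" by (intro sum_mono) (auto simp: not_less)
      then show False using orthonormal_trace[OF assms(1) f'(1)] step by simp
    qed
    then obtain x where x: "x \<in> X" "(\<Sum>j<m. (f' j x)\<^sup>2) < 1" by blast
    define g where "g y = (if y = x then 1 else 0) - (\<Sum>j<m. f' j x * f' j y)" for y
    define s where "s = sqrt (\<Sum>y\<in>X. (g y)\<^sup>2)"
    have g: "(\<Sum>y\<in>X. (g y)\<^sup>2) > 0" "k < m \<Longrightarrow> (\<Sum>y\<in>X. f' k y * g y) = 0" for k
      using orthonormal_residual[OF assms(1) f'(1) x(1)] x(2) by (auto simp: g_def)
    have s: "s > 0" "s\<^sup>2 = (\<Sum>y\<in>X. (g y)\<^sup>2)" using g(1) by (auto simp: s_def)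
    define h where "h = f'(m := (\<lambda>y. g y / s))"
    have 1: "(\<Sum>y\<in>X. g y / s * (g y / s)) = 1"
    proof -
      have "(\<Sum>y\<in>X. g y / s * (g y / s)) = (\<Sum>y\<in>X. (g y)\<^sup>2) / s\<^sup>2"
        by (simp add: power2_eq_square sum_divide_distrib)
      then show ?thesis using s g(1) by simp
    qed
    have 2: "(\<Sum>y\<in>X. f' k y * (g y / s)) = 0" if "k < m" for k
      using g(2)[OF that] by (simp flip: sum_divide_distrib)
    have 3: "(\<Sum>y\<in>X. g y / s * f' k y) = 0" if "k < m" for k
      using 2[OF that] by (simp add: mult.commute)
    have "orthonormal X (Suc m) h"
      using f'(1) 1 2 3 unfolding orthonormal_def h_def by (auto simp: less_Suc_eq)
    moreover have "\<forall>j<n. h j = f j" using f'(2) step(1) by (auto simp: h_def)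
    ultimately show ?case by blast
  qed
  then show ?thesis using that by blast
qed

text \<open>Bessel's inequality holds at every point; the trace identity forces equality everywhere,
  so each residual vanishes.\<close>

lemma orthonormal_complete:
  assumes "finite X" "orthonormal X (card X) f" "x \<in> X" "y \<in> X"
  shows "(\<Sum>j<card X. f j x * f j y) = (if y = x then 1 else 0)"
proof -
  have le: "(\<Sum>j<card X. (f j x)\<^sup>2) \<le> 1" if "x \<in> X" for x
    using orthonormal_residual(1)[OF assms(1,2) that] sum_nonneg by (smt (verit) zero_le_power2)
  have "(\<Sum>x\<in>X. 1 - (\<Sum>j<card X. (f j x)\<^sup>2)) = 0"
    using orthonormal_trace[OF assms(1,2)] by (simp add: sum_subtractf)
  then have "1 - (\<Sum>j<card X. (f j x)\<^sup>2) = 0"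
    using le assms(1,3) by (subst (asm) sum_nonneg_eq_0_iff) auto
  then have "(\<Sum>y\<in>X. ((if y = x then 1 else 0) - (\<Sum>j<card X. f j x * f j y))\<^sup>2) = 0"
    using orthonormal_residual(1)[OF assms(1,2,3)] by simp
  then show ?thesis using assms by (subst (asm) sum_nonneg_eq_0_iff) auto
qed

section \<open>Finite-energy states\<close>

text \<open>Exchanging the entry i of xs with the extra mode m is an involution on pairs. It lets
  one coordinate be averaged over all modes, at the price of the factor
  \<open>card Md\<close>.\<close>

lemma sum_update_resample:
  fixes F :: "'m list \<Rightarrow> 'm \<Rightarrow> 'c :: semiring_1"
  assumes "finite Md" "i < N"
  defines "L \<equiv> {xs. length xs = N \<and> set xs \<subseteq> Md}"
  shows "(\<Sum>xs\<in>L. \<Sum>m\<in>Md. F (xs[i := m]) m) = of_nat (card Md) * (\<Sum>xs\<in>L. F xs (xs ! i))"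
proof -
  have nth: "xs ! i \<in> Md" if "xs \<in> L" for xs using that assms(2) by (auto simp: L_def)
  have upd: "xs[i := m] \<in> L" if "xs \<in> L" "m \<in> Md" for xs m
    using that set_update_subset_insert[of xs i m] by (auto simp: L_def)
  have "(\<Sum>xs\<in>L. \<Sum>m\<in>Md. F (xs[i := m]) m) = (\<Sum>(xs,m)\<in>L\<times>Md. F (xs[i := m]) m)"
    by (simp add: sum.cartesian_product)
  also have "\<dots> = (\<Sum>(xs,m)\<in>L\<times>Md. F xs (xs ! i))"
    using nth upd assms(2)
    by (intro sum.reindex_bij_witness[of _ "\<lambda>(xs,m). (xs[i := m], xs ! i)" "\<lambda>(xs,m). (xs[i := m], xs ! i)"])
      (auto simp: L_def)
  also have "\<dots> = (\<Sum>xs\<in>L. \<Sum>m\<in>Md. F xs (xs ! i))"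
    by (rule sum.cartesian_product[symmetric])
  finally show ?thesis by (simp add: sum_distrib_left)
qed

locale bond_lattice =
  fixes M :: "'a set" and B :: "('a \<times> 'a) set" and \<zeta> :: nat and \<mu> :: real
  assumes finite_M: "finite M"
    and bond: "(x, y) \<in> B \<Longrightarrow> x \<in> M \<and> y \<in> M \<and> x \<noteq> y \<and> (y, x) \<notin> B"
    and degree: "x \<in> M \<Longrightarrow> card (nbrs B x) = \<zeta>"
begin

lemma finite_B: "finite B"
  by (rule finite_subset[of _ "M \<times> M"]) (use bond finite_M in auto)

lemma symE_D: "(x, y) \<in> symE B \<Longrightarrow> x \<in> M \<and> y \<in> M \<and> x \<noteq> y"
  using bond by (auto simp: symE_def)

lemma symE_sym: "(x, y) \<in> symE B \<longleftrightarrow> (y, x) \<in> symE B"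
  by (auto simp: symE_def)

lemma finite_symE: "finite (symE B)"
  by (rule finite_subset[of _ "M \<times> M"]) (use symE_D finite_M in auto)

lemma nbrs_subset: "nbrs B x \<subseteq> M"
  using symE_D by (auto simp: nbrs_def)

lemma finite_nbrs: "finite (nbrs B x)"
  using nbrs_subset finite_M finite_subset by blast

lemma finite_Lam: "finite (Lam M B)"
  by (simp add: Lam_def finite_M finite_B)

lemma finite_modes: "finite (modes M B)"
  by (simp add: modes_def finite_Lam)

lemma finite_configs: "finite (configs M B N)"
  using finite_lists_length_eq[OF finite_modes, of N] by (simp add: configs_def conj_commute)

lemma update_configs: "xs \<in> configs M B N \<Longrightarrow> m \<in> modes M B \<Longrightarrow> xs[i := m] \<in> configs M B N"
  using set_update_subset_insert[of xs i m] by (auto simp: configs_def)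

lemma nth_modes: "xs \<in> configs M B N \<Longrightarrow> i < N \<Longrightarrow> xs ! i \<in> modes M B"
  by (auto simp: configs_def)

lemma length_configs: "xs \<in> configs M B N \<Longrightarrow> length xs = N"
  by (auto simp: configs_def)

lemma sum_Lam:
  "(\<Sum>z\<in>Lam M B. f z) = (\<Sum>x\<in>M. f (LM x)) + (\<Sum>e\<in>B. f (LU e)) + (\<Sum>e\<in>B. (f (LUb e) :: 'c :: comm_monoid_add))"
proof -
  have "(\<Sum>z\<in>Lam M B. f z) = (\<Sum>z\<in>LM ` M. f z) + (\<Sum>z\<in>LU ` B. f z) + (\<Sum>z\<in>LUb ` B. f z)"
    unfolding Lam_def using finite_M finite_B
    by (subst sum.union_disjoint, auto simp: sum.union_disjoint)+
  then show ?thesis by (simp add: sum.reindex inj_on_def)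
qed

lemma sum_modes:
  "(\<Sum>m\<in>modes M B. f m) = (\<Sum>\<sigma>\<in>UNIV. \<Sum>z\<in>Lam M B. (f (z, \<sigma>) :: 'c :: comm_monoid_add))"
  unfolding modes_def by (subst sum.swap) (simp add: sum.cartesian_product)

lemma sum_symE: "(\<Sum>(x,y)\<in>symE B. f x y) = (\<Sum>x\<in>M. \<Sum>y\<in>nbrs B x. (f x y :: 'c :: comm_monoid_add))"
proof -
  have "symE B = Sigma M (nbrs B)" using symE_D by (auto simp: nbrs_def)
  then show ?thesis using finite_M finite_nbrs by (simp add: sum.Sigma)
qed

lemma sum_symE_B: "(\<Sum>(x,y)\<in>symE B. f x y) = (\<Sum>(x,y)\<in>B. (f x y + f y x :: 'c :: comm_monoid_add))"
proof -
  have "(\<Sum>(x,y)\<in>symE B. f x y) = (\<Sum>(x,y)\<in>B. f x y) + (\<Sum>(x,y)\<in>prod.swap ` B. f x y)"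
    unfolding symE_def
  proof (subst sum.union_disjoint)
    have "{(y, x). (x, y) \<in> B} = prod.swap ` B" by force
    then show "finite {(y, x). (x, y) \<in> B}"
      "(\<Sum>(x, y)\<in>B. f x y) + (\<Sum>(x, y)\<in>{(y, x). (x, y) \<in> B}. f x y) =
       (\<Sum>(x, y)\<in>B. f x y) + (\<Sum>(x, y)\<in>prod.swap ` B. f x y)" using finite_B by auto
  qed (use finite_B bond in auto)
  also have "(\<Sum>(x,y)\<in>prod.swap ` B. f x y) = (\<Sum>(x,y)\<in>B. f y x)"
    by (subst sum.reindex) (auto intro: sum.cong)
  finally show ?thesis by (simp add: sum.distrib case_prod_beta)
qed

lemma sum_bond_ends: "(\<Sum>(x,y)\<in>B. h x + h y) = of_nat \<zeta> * (\<Sum>x\<in>M. (h x :: 'c :: comm_semiring_1))"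
proof -
  have "(\<Sum>(x,y)\<in>B. h x + h y) = (\<Sum>x\<in>M. \<Sum>y\<in>nbrs B x. h x)"
    using sum_symE_B[of "\<lambda>x y. h x"] sum_symE[of "\<lambda>x y. h x"] by simp
  then show ?thesis by (simp add: degree sum_distrib_left)
qed

text \<open>The squared norm of the \<open>lext\<close> function that is 1 at one site of M and 0 at
  the others; its root is the normalisation in \<open>acoef\<close>.\<close>

definition cc :: real where "cc = 1 + 2 * real \<zeta> * \<mu>\<^sup>2"

lemma cc_pos: "cc > 0"
  unfolding cc_def by (simp add: add_pos_nonneg)

text \<open>One-electron functions orthogonal to every b-orbital.\<close>

definition lext :: "('a lsite \<Rightarrow> complex) \<Rightarrow> bool" where
  "lext f \<longleftrightarrow> (\<forall>(x,y)\<in>B. f (LU (x,y)) = of_real \<mu> * (f (LM x) + f (LM y)) \<and>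
                        f (LUb (x,y)) = of_real \<mu> * (f (LM y) - f (LM x)))"

lemma lextD:
  assumes "lext f" "(x, y) \<in> B"
  shows "f (LU (x,y)) = of_real \<mu> * (f (LM x) + f (LM y))" "f (LUb (x,y)) = of_real \<mu> * (f (LM y) - f (LM x))"
  using assms by (auto simp: lext_def)

lemma lext_comb: "lext f \<Longrightarrow> lext g \<Longrightarrow> lext (\<lambda>z. a * f z + b * g z)"
proof -
  assume f: "lext f" and g: "lext g"
  have "a * f (LU (x,y)) + b * g (LU (x,y)) = of_real \<mu> * ((a * f (LM x) + b * g (LM x)) + (a * f (LM y) + b * g (LM y)))"
    "a * f (LUb (x,y)) + b * g (LUb (x,y)) = of_real \<mu> * ((a * f (LM y) + b * g (LM y)) - (a * f (LM x) + b * g (LM x)))"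
    if "(x,y) \<in> B" for x y
  proof -
    have e: "f (LU (x,y)) = of_real \<mu> * (f (LM x) + f (LM y))" "f (LUb (x,y)) = of_real \<mu> * (f (LM y) - f (LM x))"
      "g (LU (x,y)) = of_real \<mu> * (g (LM x) + g (LM y))" "g (LUb (x,y)) = of_real \<mu> * (g (LM y) - g (LM x))"
      using f g that unfolding lext_def by auto
    show "a * f (LU (x,y)) + b * g (LU (x,y)) = of_real \<mu> * ((a * f (LM x) + b * g (LM x)) + (a * f (LM y) + b * g (LM y)))"
      "a * f (LUb (x,y)) + b * g (LUb (x,y)) = of_real \<mu> * ((a * f (LM y) + b * g (LM y)) - (a * f (LM x) + b * g (LM x)))"
      unfolding e by (simp_all add: algebra_simps)
  qed
  then show ?thesis unfolding lext_def by auto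
qed

lemma lext_zero: "lext (\<lambda>z. 0)"
  by (auto simp: lext_def)

lemma lext_scale: "lext f \<Longrightarrow> lext (\<lambda>z. a * f z)"
  using lext_comb[of f f a 0] by simp

lemma lext_sum: "(\<And>i. i \<in> I \<Longrightarrow> lext (f i)) \<Longrightarrow> lext (\<lambda>z. \<Sum>i\<in>I. f i z)"
proof (induction I rule: infinite_finite_induct)
  case (insert i I)
  then show ?case using lext_comb[of "f i" "\<lambda>z. \<Sum>i\<in>I. f i z" 1 1] by simp
qed (auto simp: lext_zero)

lemma lext_cnj: "lext f \<Longrightarrow> lext (\<lambda>z. cnj (f z))"
  unfolding lext_def by auto

text \<open>On a bond, u and ubar carry \<mu> times the sum and the difference of the end values.
  The mixed terms cancel, each end contributes 2 \<mu>^2 times its own product, and every site is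
  the end of \<zeta> bonds.\<close>

lemma lext_inner:
  assumes "lext f" "lext g"
  shows "(\<Sum>z\<in>Lam M B. f z * g z) = of_real cc * (\<Sum>x\<in>M. f (LM x) * g (LM x))"
proof -
  let ?h = "\<lambda>x. 2 * of_real (\<mu>\<^sup>2) * (f (LM x) * g (LM x))"
  have "(\<Sum>e\<in>B. f (LU e) * g (LU e)) + (\<Sum>e\<in>B. f (LUb e) * g (LUb e)) = (\<Sum>(x,y)\<in>B. ?h x + ?h y)"
    unfolding sum.distrib[symmetric]
    by (rule sum.cong) (auto simp: lextD[OF assms(1)] lextD[OF assms(2)] algebra_simps power2_eq_square)
  also have "\<dots> = of_nat \<zeta> * (\<Sum>x\<in>M. ?h x)" by (rule sum_bond_ends)
  finally show ?thesis
    by (simp add: sum_Lam cc_def algebra_simps sum_distrib_left)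
qed

lemma acoef_LM: "x \<in> M \<Longrightarrow> acoef B \<mu> x (LM y) = (if y = x then 1 / sqrt cc else 0)"
  by (simp add: acoef_def degree cc_def)

lemma acoef_lext: "lext (\<lambda>z. of_real (acoef B \<mu> x z))"
  unfolding lext_def acoef_def by (auto simp: algebra_simps)

text \<open>\<open>acoef B \<mu> x\<close> is a multiple of the \<open>lext\<close> function of the
  point mass at x, so pairing with it evaluates at x.\<close>

lemma acoef_inner:
  assumes "x \<in> M" "lext g"
  shows "(\<Sum>z\<in>Lam M B. of_real (acoef B \<mu> x z) * g z) = of_real (sqrt cc) * g (LM x)"
proof -
  have "(\<Sum>z\<in>Lam M B. of_real (acoef B \<mu> x z) * g z)
      = of_real cc * (\<Sum>y\<in>M. of_real (acoef B \<mu> x (LM y)) * g (LM y))"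
    by (rule lext_inner[OF acoef_lext assms(2)])
  also have "(\<Sum>y\<in>M. of_real (acoef B \<mu> x (LM y)) * g (LM y)) = (\<Sum>y\<in>M. if y = x then of_real (1 / sqrt cc) * g (LM x) else 0)"
    by (rule sum.cong) (auto simp: acoef_LM assms(1))
  also have "of_real cc * \<dots> = of_real (cc / sqrt cc) * g (LM x)"
    using assms(1) finite_M by simp
  also have "cc / sqrt cc = sqrt cc" using cc_pos by (simp add: real_div_sqrt)
  finally show ?thesis .
qed

lemma bcoef_inner:
  fixes g :: "'a lsite \<Rightarrow> complex"
  assumes "(x, y) \<in> B"
  shows "(\<Sum>z\<in>Lam M B. of_real (bcoef \<mu> (LU (x,y)) z) * g z) = g (LU (x,y)) - of_real \<mu> * (g (LM x) + g (LM y))"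
    and "(\<Sum>z\<in>Lam M B. of_real (bcoef \<mu> (LUb (x,y)) z) * g z) = g (LUb (x,y)) - of_real \<mu> * (g (LM y) - g (LM x))"
proof -
  have m: "x \<in> M" "y \<in> M" "x \<noteq> y" using bond[OF assms] by auto
  have z: "LU (x,y) \<in> Lam M B" "LUb (x,y) \<in> Lam M B" "LM x \<in> Lam M B" "LM y \<in> Lam M B"
    using m assms by (auto simp: Lam_def)
  have "of_real (bcoef \<mu> (LU (x,y)) z) * g z = (if z = LU (x,y) then g z else 0)
      - of_real \<mu> * (if z = LM x then g z else 0) - of_real \<mu> * (if z = LM y then g z else 0)" for z
    using m by (auto simp: bcoef_def)
  note lu = this
  show "(\<Sum>z\<in>Lam M B. of_real (bcoef \<mu> (LU (x,y)) z) * g z) = g (LU (x,y)) - of_real \<mu> * (g (LM x) + g (LM y))"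
    unfolding lu sum_subtractf sum_distrib_left[symmetric] using z finite_Lam by (simp add: algebra_simps)
  have "of_real (bcoef \<mu> (LUb (x,y)) z) * g z = (if z = LUb (x,y) then g z else 0)
      + of_real \<mu> * (if z = LM x then g z else 0) - of_real \<mu> * (if z = LM y then g z else 0)" for z
    using m by (auto simp: bcoef_def)
  note lub = this
  show "(\<Sum>z\<in>Lam M B. of_real (bcoef \<mu> (LUb (x,y)) z) * g z) = g (LUb (x,y)) - of_real \<mu> * (g (LM y) - g (LM x))"
    unfolding lub sum_subtractf sum.distrib sum_distrib_left[symmetric] using z finite_Lam by (simp add: algebra_simps)
qed

lemma lext_iff_bcoef:
  "lext g \<longleftrightarrow> (\<forall>v\<in>Ovs B. (\<Sum>z\<in>Lam M B. of_real (bcoef \<mu> v z) * g z) = 0)"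
proof -
  have "(\<forall>v\<in>Ovs B. P v) \<longleftrightarrow> (\<forall>(x,y)\<in>B. P (LU (x,y)) \<and> P (LUb (x,y)))" for P by (auto simp: Ovs_def)
  then show ?thesis unfolding lext_def by (auto simp: bcoef_inner)
qed

text \<open>Common shape of the hopping and the b-terms: a spin-diagonal kernel that is a sum of
  products splits into pairings with the single orbitals.\<close>

lemma rank_one_form:
  assumes "finite E"
  shows "(\<Sum>m'\<in>modes M B. \<Sum>m\<in>modes M B. cnj (F m') *
      (of_real (if snd m' = snd m then r * (\<Sum>e\<in>E. f e (fst m') * g e (fst m)) else 0) * G m))
    = of_real r * (\<Sum>e\<in>E. \<Sum>\<sigma>\<in>UNIV. cnj (\<Sum>z\<in>Lam M B. of_real (f e z) * F (z, \<sigma>))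
        * (\<Sum>z\<in>Lam M B. of_real (g e z) * G (z, \<sigma>)))"
proof -
  have 1: "(\<Sum>m\<in>modes M B. cnj (F m') *
      (of_real (if snd m' = snd m then r * (\<Sum>e\<in>E. f e (fst m') * g e (fst m)) else 0) * G m))
    = (\<Sum>z\<in>Lam M B. cnj (F m') * (of_real (r * (\<Sum>e\<in>E. f e (fst m') * g e z)) * G (z, snd m')))" for m'
    by (cases "snd m'") (simp_all add: sum_modes UNIV_bool)
  have "(\<Sum>m'\<in>modes M B. \<Sum>z\<in>Lam M B. cnj (F m') * (of_real (r * (\<Sum>e\<in>E. f e (fst m') * g e z)) * G (z, snd m')))
    = (\<Sum>\<sigma>\<in>UNIV. \<Sum>z'\<in>Lam M B. \<Sum>z\<in>Lam M B. \<Sum>e\<in>E. of_real r * (cnj (of_real (f e z') * F (z', \<sigma>)) * (of_real (g e z) * G (z, \<sigma>))))"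
    by (simp add: sum_modes sum_distrib_left sum_distrib_right algebra_simps)
  also have "\<dots> = (\<Sum>\<sigma>\<in>UNIV. \<Sum>z'\<in>Lam M B. \<Sum>e\<in>E. \<Sum>z\<in>Lam M B. of_real r * (cnj (of_real (f e z') * F (z', \<sigma>)) * (of_real (g e z) * G (z, \<sigma>))))"
    by (subst sum.swap) (rule refl)
  also have "\<dots> = (\<Sum>\<sigma>\<in>UNIV. \<Sum>e\<in>E. \<Sum>z'\<in>Lam M B. \<Sum>z\<in>Lam M B. of_real r * (cnj (of_real (f e z') * F (z', \<sigma>)) * (of_real (g e z) * G (z, \<sigma>))))"
    by (intro sum.cong refl) (subst sum.swap, rule refl)
  also have "\<dots> = (\<Sum>\<sigma>\<in>UNIV. \<Sum>e\<in>E. of_real r * (cnj (\<Sum>z\<in>Lam M B. of_real (f e z) * F (z, \<sigma>))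
        * (\<Sum>z\<in>Lam M B. of_real (g e z) * G (z, \<sigma>))))"
    by (simp only: cnj_sum sum_product) (simp only: sum_distrib_left)
  also have "\<dots> = (\<Sum>e\<in>E. \<Sum>\<sigma>\<in>UNIV. of_real r * (cnj (\<Sum>z\<in>Lam M B. of_real (f e z) * F (z, \<sigma>))
        * (\<Sum>z\<in>Lam M B. of_real (g e z) * G (z, \<sigma>))))"
    by (rule sum.swap)
  finally show ?thesis unfolding 1 by (simp add: sum_distrib_left)
qed

lemma hop_form:
  "(\<Sum>m'\<in>modes M B. \<Sum>m\<in>modes M B. cnj (F m') * (of_real (hop_mat B t \<mu> m' m) * G m))
    = of_real t * (\<Sum>(x,y)\<in>symE B. \<Sum>\<sigma>\<in>UNIV. cnj (\<Sum>z\<in>Lam M B. of_real (acoef B \<mu> x z) * F (z, \<sigma>))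
        * (\<Sum>z\<in>Lam M B. of_real (acoef B \<mu> y z) * G (z, \<sigma>)))"
  unfolding hop_mat_def case_prod_beta by (rule rank_one_form[OF finite_symE])

lemma b_form:
  "(\<Sum>m'\<in>modes M B. \<Sum>m\<in>modes M B. cnj (F m') * (of_real (b_mat B s \<mu> m' m) * G m))
    = of_real s * (\<Sum>v\<in>Ovs B. \<Sum>\<sigma>\<in>UNIV. cnj (\<Sum>z\<in>Lam M B. of_real (bcoef \<mu> v z) * F (z, \<sigma>))
        * (\<Sum>z\<in>Lam M B. of_real (bcoef \<mu> v z) * G (z, \<sigma>)))"
  unfolding b_mat_def by (rule rank_one_form) (simp add: Ovs_def finite_B)

section \<open>The three energy terms and the limits in \<open>U\<close> and
  \<open>s\<close>\<close>

definition hopping :: "real \<Rightarrow> 'a wavefn \<Rightarrow> 'a wavefn" where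
  "hopping t = one_body (modes M B) (\<lambda>m m'. of_real (hop_mat B t \<mu> m m'))"

definition b_energy :: "nat \<Rightarrow> 'a wavefn \<Rightarrow> real" where
  "b_energy N \<Phi> = Re (braket M B N \<Phi> (one_body (modes M B) (\<lambda>m m'. of_real (b_mat B 1 \<mu> m m')) \<Phi>))"

definition d_energy :: "nat \<Rightarrow> 'a wavefn \<Rightarrow> real" where
  "d_energy N \<Phi> = (\<Sum>xs\<in>configs M B N. real (double_occ xs) * (cmod (\<Phi> xs))\<^sup>2)"

definition t_energy :: "nat \<Rightarrow> real \<Rightarrow> 'a wavefn \<Rightarrow> real" where
  "t_energy N t \<Phi> = Re (braket M B N \<Phi> (hopping t \<Phi>))"

lemma energy_split: "energy M B N t \<mu> s U \<Phi> = t_energy N t \<Phi> + s * b_energy N \<Phi> + U * d_energy N \<Phi>"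
proof -
  have bs: "b_mat B s \<mu> m m' = s * b_mat B 1 \<mu> m m'" for m m' by (simp add: b_mat_def)
  have "hamiltonian M B t \<mu> s U \<Phi> xs = hopping t \<Phi> xs
     + of_real s * one_body (modes M B) (\<lambda>m m'. of_real (b_mat B 1 \<mu> m m')) \<Phi> xs
     + of_real (U * real (double_occ xs)) * \<Phi> xs" for xs
    unfolding hamiltonian_def hopping_def one_body_def bs[of _ _]
    by (simp add: sum.distrib algebra_simps sum_distrib_left)
  then have "braket M B N \<Phi> (hamiltonian M B t \<mu> s U \<Phi>) = braket M B N \<Phi> (hopping t \<Phi>)
     + of_real s * braket M B N \<Phi> (one_body (modes M B) (\<lambda>m m'. of_real (b_mat B 1 \<mu> m m')) \<Phi>)
     + (\<Sum>xs\<in>configs M B N. of_real (U * (real (double_occ xs) * (cmod (\<Phi> xs))\<^sup>2)))"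
    unfolding braket_def sum_distrib_left sum.distrib[symmetric]
    by (intro sum.cong refl) (simp add: algebra_simps complex_norm_square[symmetric] flip: of_real_power)
  then show ?thesis
    unfolding energy_def t_energy_def b_energy_def d_energy_def
    by (simp add: sum_distrib_left)
qed

text \<open>Averaging coordinate i over all modes turns the expectation into full quadratic forms in
  that coordinate, to which \<open>b_form\<close> applies.\<close>

lemma braket_one_body_resample:
  assumes "i < N"
  shows "of_nat (card (modes M B)) * (\<Sum>xs\<in>configs M B N. cnj (\<Phi> xs) * (\<Sum>m\<in>modes M B. h (xs ! i) m * \<Psi> (xs[i := m])))
    = (\<Sum>xs\<in>configs M B N. \<Sum>m'\<in>modes M B. \<Sum>m\<in>modes M B. cnj (\<Phi> (xs[i := m'])) * (h m' m * \<Psi> (xs[i := m])))"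
proof -
  have "(\<Sum>xs\<in>configs M B N. \<Sum>m'\<in>modes M B. \<Sum>m\<in>modes M B. cnj (\<Phi> (xs[i := m'])) * (h m' m * \<Psi> (xs[i := m])))
    = (\<Sum>xs\<in>configs M B N. \<Sum>m'\<in>modes M B. cnj (\<Phi> (xs[i := m'])) * (\<Sum>m\<in>modes M B. h m' m * \<Psi> (xs[i := m', i := m])))"
    by (simp add: sum_distrib_left)
  then show ?thesis
    using sum_update_resample[OF finite_modes assms,
        of "\<lambda>xs m'. cnj (\<Phi> xs) * (\<Sum>m\<in>modes M B. h m' m * \<Psi> (xs[i := m]))"]
    unfolding configs_def by simp
qed

text \<open>Annihilation by every b-orbital, expressed one coordinate at a time.\<close>

definition bext :: "nat \<Rightarrow> 'a wavefn \<Rightarrow> bool" where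
  "bext N \<Phi> \<longleftrightarrow> (\<forall>xs\<in>configs M B N. \<forall>i<N. \<forall>\<sigma>. lext (\<lambda>z. \<Phi> (xs[i := (z, \<sigma>)])))"

lemma braket_one_body:
  "braket M B N \<Phi> (one_body (modes M B) h \<Psi>)
   = (\<Sum>i<N. \<Sum>xs\<in>configs M B N. cnj (\<Phi> xs) * (\<Sum>m\<in>modes M B. h (xs ! i) m * \<Psi> (xs[i := m])))"
  unfolding braket_def one_body_def
  by (subst sum.swap) (auto simp: sum_distrib_left length_configs intro!: sum.cong)

text \<open>The contribution of each electron, times the number of modes, is a sum of squared moduli
  of pairings with the b-orbitals, so it vanishes only if all of them do.\<close>

lemma b_energy_nonneg: "b_energy N \<Phi> \<ge> 0" (is ?A)
  and b_energy_zero_iff: "b_energy N \<Phi> = 0 \<longleftrightarrow> bext N \<Phi>" (is ?B)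
proof -
  define D where "D i xs v \<sigma> = (\<Sum>z\<in>Lam M B. of_real (bcoef \<mu> v z) * \<Phi> (xs[i := (z, \<sigma>)]))" for i xs v \<sigma>
  define e where "e i = Re (\<Sum>xs\<in>configs M B N. cnj (\<Phi> xs) * (\<Sum>m\<in>modes M B. of_real (b_mat B 1 \<mu> (xs ! i) m) * \<Phi> (xs[i := m])))" for i
  define q where "q i = (\<Sum>xs\<in>configs M B N. \<Sum>v\<in>Ovs B. \<Sum>\<sigma>\<in>UNIV. (cmod (D i xs v \<sigma>))\<^sup>2)" for i
  have eq: "real (card (modes M B)) * e i = q i" if "i < N" for i
  proof -
    have "of_nat (card (modes M B)) * (\<Sum>xs\<in>configs M B N. cnj (\<Phi> xs) * (\<Sum>m\<in>modes M B. of_real (b_mat B 1 \<mu> (xs ! i) m) * \<Phi> (xs[i := m])))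
      = (\<Sum>xs\<in>configs M B N. \<Sum>v\<in>Ovs B. \<Sum>\<sigma>\<in>UNIV. cnj (D i xs v \<sigma>) * D i xs v \<sigma>)"
      using braket_one_body_resample[OF that, where h = "\<lambda>m m'. of_real (b_mat B 1 \<mu> m m')" and \<Phi> = \<Phi> and \<Psi> = \<Phi>]
      unfolding b_form D_def by simp
    also have "\<dots> = of_real (q i)"
      unfolding q_def by (simp only: of_real_sum complex_norm_square mult.commute)
    finally show ?thesis unfolding e_def by (simp add: complex_eq_iff)
  qed
  have qn: "q i \<ge> 0" for i unfolding q_def by (intro sum_nonneg) auto
  have be: "b_energy N \<Phi> = (\<Sum>i<N. e i)"
    unfolding b_energy_def braket_one_body e_def by simp
  \<comment> \<open>Without modes there are no configurations of a positive number of electrons;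
    this covers the case where the factor \<open>card (modes M B)\<close> cannot be
    cancelled.\<close>
  have card0: "configs M B N = {}" if "card (modes M B) = 0" "i < N" for i
    using that finite_modes nth_modes by fastforce
  have en: "e i \<ge> 0" if "i < N" for i
  proof (cases "card (modes M B) = 0")
    case True
    then show ?thesis using card0[OF True that] by (simp add: e_def)
  next
    case False
    then show ?thesis using eq[OF that] qn[of i] by (metis gr0I of_nat_0_less_iff zero_le_mult_iff not_less)
  qed
  then show ?A unfolding be by (intro sum_nonneg) auto
  have e0: "e i = 0 \<longleftrightarrow> (\<forall>xs\<in>configs M B N. \<forall>\<sigma>. lext (\<lambda>z. \<Phi> (xs[i := (z, \<sigma>)])))" if "i < N" for i
  proof -
    have "q i = 0 \<longleftrightarrow> (\<forall>xs\<in>configs M B N. \<forall>v\<in>Ovs B. \<forall>\<sigma>. D i xs v \<sigma> = 0)"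
      unfolding q_def
      by (subst sum_nonneg_eq_0_iff; (simp add: sum_nonneg finite_configs)?)+
        (auto simp: sum_nonneg_eq_0_iff sum_nonneg Ovs_def finite_B)
    also have "\<dots> \<longleftrightarrow> (\<forall>xs\<in>configs M B N. \<forall>\<sigma>. lext (\<lambda>z. \<Phi> (xs[i := (z, \<sigma>)])))"
      unfolding lext_iff_bcoef D_def by blast
    moreover have "e i = 0 \<longleftrightarrow> q i = 0"
      using eq[OF that] card0[OF _ that] by (cases "card (modes M B) = 0") (auto simp: e_def q_def)
    ultimately show ?thesis by simp
  qed
  have "b_energy N \<Phi> = 0 \<longleftrightarrow> (\<forall>i<N. e i = 0)"
    unfolding be using en by (subst sum_nonneg_eq_0_iff) auto
  then show ?B unfolding bext_def using e0 by auto
qed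

lemma in_space_antisym:
  "in_space M B N \<Phi> \<Longrightarrow> i < length xs \<Longrightarrow> j < length xs \<Longrightarrow> i \<noteq> j \<Longrightarrow> \<Phi> (xs[i := xs ! j, j := xs ! i]) = - \<Phi> xs"
  by (auto simp: in_space_def)

lemma in_space_zero: "in_space M B N \<Phi> \<Longrightarrow> xs \<notin> configs M B N \<Longrightarrow> \<Phi> xs = 0"
  by (auto simp: in_space_def)

lemma in_space_exclusion:
  assumes "in_space M B N \<Phi>" "\<not> distinct xs"
  shows "\<Phi> xs = 0"
proof -
  obtain i j where "i < length xs" "j < length xs" "i \<noteq> j" "xs ! i = xs ! j"
    using assms(2) by (auto simp: distinct_conv_nth)
  then have "\<Phi> xs = - \<Phi> xs" using in_space_antisym[OF assms(1), of i xs j] by (metis list_update_id)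
  then show ?thesis by simp
qed

lemma double_occ_zero:
  "double_occ xs = 0 \<longleftrightarrow> (\<forall>i<length xs. \<forall>j<length xs. fst (xs ! i) = fst (xs ! j) \<longrightarrow> snd (xs ! i) \<longrightarrow> snd (xs ! j))"
proof -
  have "finite {(i, j). i < length xs \<and> j < length xs \<and>
      fst (xs ! i) = fst (xs ! j) \<and> snd (xs ! i) \<and> \<not> snd (xs ! j)}"
    by (rule finite_subset[of _ "{..<length xs} \<times> {..<length xs}"]) auto
  then show ?thesis unfolding double_occ_def by auto
qed

definition nodouble :: "'a wavefn \<Rightarrow> bool" where
  "nodouble \<Phi> \<longleftrightarrow> (\<forall>xs. \<not> distinct (map fst xs) \<longrightarrow> \<Phi> xs = 0)"

lemma d_energy_nonneg: "d_energy N \<Phi> \<ge> 0"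
  unfolding d_energy_def by (intro sum_nonneg) auto

text \<open>\<open>double_occ\<close> counts only pairs of opposite spin; equal spins on one site
  are excluded by antisymmetry.\<close>

lemma d_energy_zero_iff:
  assumes "in_space M B N \<Phi>"
  shows "d_energy N \<Phi> = 0 \<longleftrightarrow> nodouble \<Phi>"
proof
  assume "d_energy N \<Phi> = 0"
  then have *: "\<And>xs. xs \<in> configs M B N \<Longrightarrow> double_occ xs = 0 \<or> \<Phi> xs = 0"
    unfolding d_energy_def by (subst (asm) sum_nonneg_eq_0_iff) (auto simp: finite_configs)
  show "nodouble \<Phi>" unfolding nodouble_def
  proof safe
    fix xs :: "'a mode list" assume nd: "\<not> distinct (map fst xs)"
    then obtain i j where ij: "i < length xs" "j < length xs" "i \<noteq> j" "fst (xs ! i) = fst (xs ! j)"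
      by (auto simp: distinct_conv_nth)
    show "\<Phi> xs = 0"
    proof (cases "xs \<in> configs M B N \<and> distinct xs")
      case True
      then have "xs ! i \<noteq> xs ! j" using ij by (simp add: nth_eq_iff_index_eq)
      then have "snd (xs ! i) \<noteq> snd (xs ! j)" using ij(4) prod_eqI by blast
      then consider "snd (xs ! i)" "\<not> snd (xs ! j)" | "snd (xs ! j)" "\<not> snd (xs ! i)" by blast
      then have "double_occ xs \<noteq> 0"
      proof cases
        case 1
        then show ?thesis using ij(1,2,4) unfolding double_occ_zero by blast
      next
        case 2
        then show ?thesis using ij(1,2) ij(4)[symmetric] unfolding double_occ_zero by blast
      qed
      then show ?thesis using *[of xs] True by simp
    next
      case False
      then show ?thesis using in_space_zero[OF assms, of xs] in_space_exclusion[OF assms, of xs] by auto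
    qed
  qed
next
  assume nd: "nodouble \<Phi>"
  have "double_occ xs = 0 \<or> \<Phi> xs = 0" for xs :: "'a mode list"
  proof (cases "distinct (map fst xs)")
    case True
    then have "i = j" if "i < length xs" "j < length xs" "fst (xs ! i) = fst (xs ! j)" for i j
      using that by (auto simp: distinct_conv_nth)
    then show ?thesis unfolding double_occ_zero by blast
  next
    case False
    then show ?thesis using nd by (auto simp: nodouble_def)
  qed
  then have "real (double_occ xs) * (cmod (\<Phi> xs))\<^sup>2 = 0" for xs
    by (metis mult_eq_0_iff norm_zero of_nat_0 zero_power2)
  then show "d_energy N \<Phi> = 0" unfolding d_energy_def by (intro sum.neutral ballI)
qed

text \<open>The energy is affine in \<open>U\<close> and in \<open>s\<close> with nonnegative
  slopes, so the limits are finite exactly if both slopes vanish. A positive slope in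
  \<open>U\<close> makes the inner limit infinite for every \<open>s\<close>.\<close>

lemma lim_energy_eq:
  "lim_energy M B N t \<mu> \<Phi> = (if d_energy N \<Phi> = 0 \<and> b_energy N \<Phi> = 0 then ereal (t_energy N t \<Phi>) else \<infinity>)"
proof -
  have lin: "((\<lambda>u. ereal (a + u * b)) \<longlongrightarrow> (if b = 0 then ereal a else \<infinity>)) at_top" if "b \<ge> 0" for a b :: real
  proof (cases "b = 0")
    case False
    then have "b > 0" using that by simp
    then have "filterlim (\<lambda>u. a + u * b) at_top at_top"
      by (intro filterlim_tendsto_add_at_top[OF tendsto_const] filterlim_at_top_mult_tendsto_pos[OF tendsto_const]) (auto simp: filterlim_ident)
    then show ?thesis using False by (simp add: tendsto_PInfty_eq_at_top)
  qed simp
  have inner: "Lim at_top (\<lambda>U. ereal (energy M B N t \<mu> s U \<Phi>)) = (if d_energy N \<Phi> = 0 then ereal (t_energy N t \<Phi> + s * b_energy N \<Phi>) else \<infinity>)" for s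
    unfolding energy_split by (intro tendsto_Lim lin d_energy_nonneg) simp
  have outer: "Lim at_top (\<lambda>s. ereal (t_energy N t \<Phi> + s * b_energy N \<Phi>)) = (if b_energy N \<Phi> = 0 then ereal (t_energy N t \<Phi>) else \<infinity>)"
    by (intro tendsto_Lim lin b_energy_nonneg) simp
  show ?thesis unfolding lim_energy_def inner
    using outer by (cases "d_energy N \<Phi> = 0") (auto intro!: tendsto_Lim)
qed

definition finite_energy :: "nat \<Rightarrow> 'a wavefn set" where
  "finite_energy N = {\<Phi>. in_space M B N \<Phi> \<and> nodouble \<Phi> \<and> bext N \<Phi>}"

lemma lim_energy_finite_iff:
  assumes "in_space M B N \<Phi>"
  shows "lim_energy M B N t \<mu> \<Phi> < \<infinity> \<longleftrightarrow> \<Phi> \<in> finite_energy N"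
  using assms unfolding lim_energy_eq finite_energy_def b_energy_zero_iff by (simp add: d_energy_zero_iff)

lemma lim_energy_finite:
  assumes "\<Phi> \<in> finite_energy N"
  shows "lim_energy M B N t \<mu> \<Phi> = ereal (t_energy N t \<Phi>)"
  using assms unfolding lim_energy_eq finite_energy_def b_energy_zero_iff by (simp add: d_energy_zero_iff)

end

section \<open>Total spin as a sum of spin exchanges\<close>

definition swap_spin :: "nat \<Rightarrow> nat \<Rightarrow> 'a mode list \<Rightarrow> 'a mode list" where
  "swap_spin i j xs = xs[i := (fst (xs ! i), snd (xs ! j)), j := (fst (xs ! j), snd (xs ! i))]"

definition flip_spin :: "nat \<Rightarrow> 'a mode list \<Rightarrow> 'a mode list" where
  "flip_spin i xs = xs[i := (fst (xs ! i), \<not> snd (xs ! i))]"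

lemma length_swap_spin [simp]: "length (swap_spin i j xs) = length xs"
  by (simp add: swap_spin_def)

lemma length_flip_spin [simp]: "length (flip_spin i xs) = length xs"
  by (simp add: flip_spin_def)

lemma nth_swap_spin:
  assumes "i < length xs" "j < length xs" "k < length xs"
  shows "swap_spin i j xs ! k = (fst (xs ! k), snd (xs ! transpose i j k))"
  using assms by (auto simp: swap_spin_def nth_list_update transpose_def)

lemma nth_flip_spin:
  "k < length xs \<Longrightarrow> flip_spin i xs ! k = (fst (xs ! k), if k = i then \<not> snd (xs ! k) else snd (xs ! k))"
  by (auto simp: flip_spin_def nth_list_update)

lemma map_fst_swap_spin: "i < length xs \<Longrightarrow> j < length xs \<Longrightarrow> map fst (swap_spin i j xs) = map fst xs"
  by (rule nth_equalityI) (auto simp: nth_swap_spin)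

lemma transpose_less: "i < (n::nat) \<Longrightarrow> j < n \<Longrightarrow> k < n \<Longrightarrow> transpose i j k < n"
  by (auto simp: transpose_def)

lemma swap_spin_involutory: "i < length xs \<Longrightarrow> j < length xs \<Longrightarrow> swap_spin i j (swap_spin i j xs) = xs"
  by (rule nth_equalityI) (auto simp: nth_swap_spin transpose_less)

text \<open>Spin exchange fixes positions, so moving electron k commutes with it once the spin that
  k carries afterwards is used. Variation of one position thus remains variation of one
  position.\<close>

lemma swap_spin_update:
  fixes \<sigma> :: bool
  assumes "i < length xs" "j < length xs" "k < length xs"
  defines "ys \<equiv> swap_spin i j (xs[k := (fst (xs ! k), \<sigma>)])"
  shows "swap_spin i j (xs[k := (z, \<sigma>)]) = ys[k := (z, snd (ys ! k))]"
  by (rule nth_equalityI) (use assms(1-3) in \<open>auto simp: ys_def nth_swap_spin nth_list_update transpose_less\<close>)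

context bond_lattice
begin

lemma modes_snd: "m \<in> modes M B \<Longrightarrow> (fst m, \<sigma>) \<in> modes M B"
  by (auto simp: modes_def)

lemma swap_spin_configs:
  assumes "xs \<in> configs M B N" "i < N" "j < N"
  shows "swap_spin i j xs \<in> configs M B N"
  unfolding swap_spin_def using assms by (intro update_configs modes_snd) (auto intro: nth_modes)

lemma flip_spin_configs:
  assumes "xs \<in> configs M B N" "i < N"
  shows "flip_spin i xs \<in> configs M B N"
  unfolding flip_spin_def using assms by (intro update_configs modes_snd) (auto intro: nth_modes)

text \<open>The single nonzero entries of \<open>s2_mat\<close> and \<open>s3_mat\<close> in the row
  of spin \<sigma>.\<close>

definition \<kappa> :: "bool \<Rightarrow> complex" where "\<kappa> \<sigma> = (if \<sigma> then 1 / (2 * \<i>) else - 1 / (2 * \<i>))"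
definition \<epsilon> :: "bool \<Rightarrow> complex" where "\<epsilon> \<sigma> = (if \<sigma> then 1 / 2 else - 1 / 2)"

lemma sum_single_mode:
  assumes "m0 \<in> modes M B" "\<And>m. m \<noteq> m0 \<Longrightarrow> h m = 0"
  shows "(\<Sum>m\<in>modes M B. h m * (F m :: complex)) = h m0 * F m0"
proof -
  have "(\<Sum>m\<in>modes M B. h m * F m) = (\<Sum>m\<in>{m0}. h m * F m)"
    using assms finite_modes by (intro sum.mono_neutral_right) auto
  then show ?thesis by simp
qed

lemma one_body_spin:
  assumes "xs \<in> configs M B N"
  shows "one_body (modes M B) s1_mat \<phi> xs = (\<Sum>i<N. 1 / 2 * \<phi> (flip_spin i xs))"
    and "one_body (modes M B) s2_mat \<phi> xs = (\<Sum>i<N. \<kappa> (snd (xs ! i)) * \<phi> (flip_spin i xs))"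
    and "one_body (modes M B) s3_mat \<phi> xs = (\<Sum>i<N. \<epsilon> (snd (xs ! i)) * \<phi> xs)"
proof -
  have len: "length xs = N" using assms by (rule length_configs)
  have m: "xs ! i \<in> modes M B" "(fst (xs ! i), \<not> snd (xs ! i)) \<in> modes M B" if "i < N" for i
    using nth_modes[OF assms that] modes_snd by auto
  show "one_body (modes M B) s1_mat \<phi> xs = (\<Sum>i<N. 1 / 2 * \<phi> (flip_spin i xs))"
    unfolding one_body_def len
  proof (intro sum.cong refl)
    fix i assume "i \<in> {..<N}"
    then show "(\<Sum>m\<in>modes M B. s1_mat (xs ! i) m * \<phi> (xs[i := m])) = 1 / 2 * \<phi> (flip_spin i xs)"
      using m(2)[of i] by (subst sum_single_mode[of "(fst (xs ! i), \<not> snd (xs ! i))"])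
        (auto simp: s1_mat_def splus_mat_def sminus_mat_def flip_spin_def prod_eq_iff)
  qed
  show "one_body (modes M B) s2_mat \<phi> xs = (\<Sum>i<N. \<kappa> (snd (xs ! i)) * \<phi> (flip_spin i xs))"
    unfolding one_body_def len
  proof (intro sum.cong refl)
    fix i assume "i \<in> {..<N}"
    then show "(\<Sum>m\<in>modes M B. s2_mat (xs ! i) m * \<phi> (xs[i := m])) = \<kappa> (snd (xs ! i)) * \<phi> (flip_spin i xs)"
      using m(2)[of i] by (subst sum_single_mode[of "(fst (xs ! i), \<not> snd (xs ! i))"])
        (auto simp: s2_mat_def splus_mat_def sminus_mat_def flip_spin_def prod_eq_iff \<kappa>_def)
  qed
  show "one_body (modes M B) s3_mat \<phi> xs = (\<Sum>i<N. \<epsilon> (snd (xs ! i)) * \<phi> xs)"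
    unfolding one_body_def len
  proof (intro sum.cong refl)
    fix i assume "i \<in> {..<N}"
    then show "(\<Sum>m\<in>modes M B. s3_mat (xs ! i) m * \<phi> (xs[i := m])) = \<epsilon> (snd (xs ! i)) * \<phi> xs"
      using m(1)[of i] by (subst sum_single_mode[of "xs ! i"]) (auto simp: s3_mat_def \<epsilon>_def)
  qed
qed

text \<open>Dirac's form of the squared total spin: an ordered pair of distinct electrons
  contributes half its exchange minus 1/4, an electron with itself 3/4, and 3N/4 - N(N-1)/4 = N -
  N^2/4.\<close>

definition exchange :: "nat \<Rightarrow> 'a wavefn \<Rightarrow> 'a wavefn" where
  "exchange N \<phi> xs = of_real (real N - (real N)\<^sup>2 / 4) * \<phi> xs
     + 1 / 2 * (\<Sum>i<N. \<Sum>j\<in>{..<N} - {i}. \<phi> (swap_spin i j xs))"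

lemma flip_flip:
  assumes "i < length xs" "j < length xs" "i \<noteq> j" "snd (xs ! i) \<noteq> snd (xs ! j)"
  shows "flip_spin j (flip_spin i xs) = swap_spin i j xs"
  by (rule nth_equalityI) (use assms in \<open>auto simp: nth_flip_spin nth_swap_spin transpose_def\<close>)

lemma swap_same:
  assumes "i < length xs" "j < length xs" "snd (xs ! i) = snd (xs ! j)"
  shows "swap_spin i j xs = xs"
  by (rule nth_equalityI) (use assms in \<open>auto simp: nth_swap_spin transpose_def prod_eq_iff\<close>)

lemma flip_flip_same: "flip_spin i (flip_spin i xs) = xs"
  by (cases "i < length xs") (auto simp: flip_spin_def list_update_beyond)

lemma Stot_sq_exchange:
  assumes xs: "xs \<in> configs M B N"
  shows "Stot_sq M B \<phi> xs = exchange N \<phi> xs"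
proof -
  have len: "length xs = N" using xs by (rule length_configs)
  let ?p = "\<lambda>i j. 1 / 2 * (1 / 2 * \<phi> (flip_spin j (flip_spin i xs)))
      + \<kappa> (snd (xs ! i)) * (\<kappa> (snd (flip_spin i xs ! j)) * \<phi> (flip_spin j (flip_spin i xs)))
      + \<epsilon> (snd (xs ! i)) * (\<epsilon> (snd (xs ! j)) * \<phi> xs)"
  have "Stot_sq M B \<phi> xs = (\<Sum>i<N. \<Sum>j<N. ?p i j)"
    unfolding Stot_sq_def one_body_spin[OF xs]
    by (simp add: one_body_spin[OF flip_spin_configs[OF xs]] one_body_spin[OF xs] sum_distrib_left sum.distrib)
  also have "\<dots> = (\<Sum>i<N. 3 / 4 * \<phi> xs + (\<Sum>j\<in>{..<N} - {i}. 1 / 2 * \<phi> (swap_spin i j xs) - 1 / 4 * \<phi> xs))"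
  proof (rule sum.cong)
    fix i assume i: "i \<in> {..<N}"
    have d: "?p i i = 3 / 4 * \<phi> xs"
      using i len by (auto simp: flip_flip_same nth_flip_spin \<kappa>_def \<epsilon>_def field_simps)
    \<comment> \<open>For equal spins the first two terms cancel; for opposite spins they add up to
      half the exchange.\<close>
    have o: "?p i j = 1 / 2 * \<phi> (swap_spin i j xs) - 1 / 4 * \<phi> xs" if j: "j \<in> {..<N} - {i}" for j
    proof (cases "snd (xs ! i) = snd (xs ! j)")
      case True
      then show ?thesis using i j len by (auto simp: swap_same nth_flip_spin \<kappa>_def \<epsilon>_def field_simps)
    next
      case False
      then show ?thesis using i j len by (auto simp: flip_flip nth_flip_spin \<kappa>_def \<epsilon>_def field_simps)
    qed
    have "(\<Sum>j<N. ?p i j) = ?p i i + (\<Sum>j\<in>{..<N} - {i}. ?p i j)"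
      using i by (intro sum.remove) auto
    then show "(\<Sum>j<N. ?p i j) = 3 / 4 * \<phi> xs + (\<Sum>j\<in>{..<N} - {i}. 1 / 2 * \<phi> (swap_spin i j xs) - 1 / 4 * \<phi> xs)"
      unfolding d using o by simp
  qed simp
  also have "\<dots> = (\<Sum>i<N. (3 / 4 - 1 / 4 * of_real (real N - 1)) * \<phi> xs + 1 / 2 * (\<Sum>j\<in>{..<N} - {i}. \<phi> (swap_spin i j xs)))"
    by (intro sum.cong refl) (auto simp: sum_subtractf sum_distrib_left algebra_simps of_nat_diff)
  also have "\<dots> = exchange N \<phi> xs"
  proof -
    have "(3 / 4 - 1 / 4 * of_real (real N - 1)) * of_nat N = complex_of_real (real N - (real N)\<^sup>2 / 4)"
      by (simp add: power2_eq_square field_simps)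
    then show ?thesis
      unfolding exchange_def by (simp only: sum.distrib sum_distrib_left[symmetric] sum_constant card_lessThan mult.assoc[symmetric])
  qed
  finally show ?thesis .
qed

section \<open>Compatibility of the total spin with finite energy and with hopping\<close>

lemma exchange_sym:
  "(\<Sum>xs\<in>configs M B N. cnj (f xs) * exchange N g xs) = (\<Sum>xs\<in>configs M B N. cnj (exchange N f xs) * g xs)"
proof -
  define c where "c = complex_of_real (real N - (real N)\<^sup>2 / 4)"
  have ex: "exchange N \<phi> xs = c * \<phi> xs + 1 / 2 * (\<Sum>i<N. \<Sum>j\<in>{..<N} - {i}. \<phi> (swap_spin i j xs))" for \<phi> xs
    by (simp add: exchange_def c_def)
  have cr: "cnj c = c" by (simp add: c_def)
  have sw: "(\<Sum>xs\<in>configs M B N. cnj (f xs) * g (swap_spin i j xs)) = (\<Sum>xs\<in>configs M B N. cnj (f (swap_spin i j xs)) * g xs)"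
    if "i < N" "j < N" for i j
    by (rule sum.reindex_bij_witness[of _ "swap_spin i j" "swap_spin i j"])
      (use that in \<open>auto simp: swap_spin_configs swap_spin_involutory length_configs\<close>)
  have "(\<Sum>xs\<in>configs M B N. cnj (f xs) * exchange N g xs)
    = c * (\<Sum>xs\<in>configs M B N. cnj (f xs) * g xs)
     + 1 / 2 * (\<Sum>xs\<in>configs M B N. \<Sum>i<N. \<Sum>j\<in>{..<N} - {i}. cnj (f xs) * g (swap_spin i j xs))"
    unfolding ex by (simp add: sum_distrib_left sum.distrib algebra_simps)
  also have "(\<Sum>xs\<in>configs M B N. \<Sum>i<N. \<Sum>j\<in>{..<N} - {i}. cnj (f xs) * g (swap_spin i j xs))
    = (\<Sum>i<N. \<Sum>j\<in>{..<N} - {i}. \<Sum>xs\<in>configs M B N. cnj (f xs) * g (swap_spin i j xs))"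
    by (subst sum.swap) (intro sum.cong refl, subst sum.swap, rule refl)
  also have "\<dots> = (\<Sum>i<N. \<Sum>j\<in>{..<N} - {i}. \<Sum>xs\<in>configs M B N. cnj (f (swap_spin i j xs)) * g xs)"
    by (rule sum.cong[OF refl], rule sum.cong[OF refl]) (use sw in auto)
  also have "\<dots> = (\<Sum>xs\<in>configs M B N. \<Sum>i<N. \<Sum>j\<in>{..<N} - {i}. cnj (f (swap_spin i j xs)) * g xs)"
    by (subst (2) sum.swap) (intro sum.cong refl, subst sum.swap, rule refl)
  also have "c * (\<Sum>xs\<in>configs M B N. cnj (f xs) * g xs) + 1 / 2 * \<dots>
    = (\<Sum>xs\<in>configs M B N. cnj (exchange N f xs) * g xs)"
    unfolding ex by (simp add: cr sum_distrib_left sum_distrib_right sum.distrib algebra_simps)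
  finally show ?thesis .
qed

lemma one_body_antisym:
  assumes a: "\<And>xs i j. i < length xs \<Longrightarrow> j < length xs \<Longrightarrow> i \<noteq> j \<Longrightarrow> \<Phi> (xs[i := xs ! j, j := xs ! i]) = - \<Phi> xs"
    and ij: "i < length xs" "j < length xs" "i \<noteq> j"
  shows "one_body Md h \<Phi> (xs[i := xs ! j, j := xs ! i]) = - one_body Md h \<Phi> xs"
proof -
  let ?t = "transpose i j"
  let ?s = "\<lambda>xs. xs[i := xs ! j, j := xs ! i]"
  have nth: "?s xs ! k = xs ! ?t k" if "k < length xs" for k
    using that ij by (auto simp: transpose_def nth_list_update)
  have upd: "(?s xs)[k := m] = ?s (xs[?t k := m])" for k m
    by (rule nth_equalityI) (use ij in \<open>auto simp: nth_list_update transpose_def\<close>)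
  have "one_body Md h \<Phi> (?s xs) = (\<Sum>k<length xs. \<Sum>m\<in>Md. h (xs ! ?t k) m * \<Phi> (?s (xs[?t k := m])))"
    unfolding one_body_def length_list_update
    by (intro sum.cong refl) (simp only: nth upd lessThan_iff)
  also have "\<dots> = (\<Sum>k<length xs. \<Sum>m\<in>Md. h (xs ! ?t k) m * - \<Phi> (xs[?t k := m]))"
  proof -
    have "\<Phi> (?s (xs[l := m])) = - \<Phi> (xs[l := m])" for l m using a[of i "xs[l := m]" j] ij by simp
    then show ?thesis by (simp only:)
  qed
  also have "\<dots> = (\<Sum>k<length xs. \<Sum>m\<in>Md. h (xs ! k) m * - \<Phi> (xs[k := m]))"
    by (rule sum.reindex_bij_witness[of _ ?t ?t]) (use ij in \<open>auto simp: transpose_less\<close>)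
  finally show ?thesis by (simp add: one_body_def sum_negf)
qed

text \<open>Spin matrices do not move electrons, so nothing leaks from configurations to lists with
  an entry outside \<open>modes M B\<close>.\<close>

lemma one_body_spin_support:
  assumes "\<And>xs. xs \<notin> configs M B N \<Longrightarrow> \<phi> xs = 0" "xs \<notin> configs M B N"
    and h: "\<And>m m'. h m m' \<noteq> 0 \<Longrightarrow> fst m = fst m'"
  shows "one_body (modes M B) h \<phi> xs = 0"
  unfolding one_body_def
proof (intro sum.neutral ballI)
  fix i m assume i: "i \<in> {..<length xs}" and m: "m \<in> modes M B"
  show "h (xs ! i) m * \<phi> (xs[i := m]) = 0"
  proof (rule ccontr)
    assume "h (xs ! i) m * \<phi> (xs[i := m]) \<noteq> 0"
    then have "fst (xs ! i) = fst m" "xs[i := m] \<in> configs M B N" using h[of "xs ! i" m] assms(1)[of "xs[i := m]"] by auto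
    then have "xs ! i \<in> modes M B" using m by (auto simp: modes_def mem_Times_iff)
    then have "xs[i := m, i := xs ! i] \<in> configs M B N" using update_configs \<open>xs[i := m] \<in> _\<close> by blast
    then show False using assms(2) by simp
  qed
qed

lemma Stot_in_space:
  assumes "in_space M B N \<Phi>"
  shows "in_space M B N (Stot_sq M B \<Phi>)"
proof -
  have z: "one_body (modes M B) h (one_body (modes M B) h \<Phi>) xs = 0"
    if "xs \<notin> configs M B N" "\<And>m m'. h m m' \<noteq> 0 \<Longrightarrow> fst m = fst m'" for xs h
    using that assms by (intro one_body_spin_support) (auto intro: one_body_spin_support in_space_zero)
  have s: "s1_mat m m' \<noteq> 0 \<Longrightarrow> fst m = fst m'" "s2_mat m m' \<noteq> 0 \<Longrightarrow> fst m = fst m'" "s3_mat m m' \<noteq> 0 \<Longrightarrow> fst m = fst m'"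
    for m m' :: "'a mode"
    by (auto simp: s1_mat_def s2_mat_def s3_mat_def splus_mat_def sminus_mat_def split: if_splits)
  have "Stot_sq M B \<Phi> xs = 0" if "xs \<notin> configs M B N" for xs
    unfolding Stot_sq_def using z[OF that s(1)] z[OF that s(2)] z[OF that s(3)] by simp
  moreover have "Stot_sq M B \<Phi> (xs[i := xs ! j, j := xs ! i]) = - Stot_sq M B \<Phi> xs"
    if "i < length xs" "j < length xs" "i \<noteq> j" for xs i j
  proof -
    have "one_body (modes M B) h (one_body (modes M B) h \<Phi>) (xs[i := xs ! j, j := xs ! i])
      = - one_body (modes M B) h (one_body (modes M B) h \<Phi>) xs" for h
      by (intro one_body_antisym in_space_antisym[OF assms] that)
    then show ?thesis unfolding Stot_sq_def by simp
  qed
  ultimately show ?thesis unfolding in_space_def by blast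
qed

lemma one_body_linear:
  "one_body Md h (\<lambda>x. a * f x + b * g x) = (\<lambda>x. a * one_body Md h f x + b * one_body Md h g x)"
  unfolding one_body_def by (simp add: fun_eq_iff sum_distrib_left sum.distrib algebra_simps)

lemma Stot_linear:
  "Stot_sq M B (\<lambda>x. a * f x + b * g x) = (\<lambda>x. a * Stot_sq M B f x + b * Stot_sq M B g x)"
  unfolding Stot_sq_def by (simp add: one_body_linear fun_eq_iff algebra_simps)

text \<open>Exchanging spins changes neither the list of sites nor the way the state depends on one
  position, so both constraints survive. The exchange form holds only on configurations, which
  suffices since \<open>lext\<close> evaluates at sites of \<open>Lam M B\<close> alone.\<close>

lemma Stot_finite_energy:
  assumes "\<Phi> \<in> finite_energy N"
  shows "Stot_sq M B \<Phi> \<in> finite_energy N"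
proof -
  have sp: "in_space M B N \<Phi>" and nd: "nodouble \<Phi>" and be: "bext N \<Phi>"
    using assms by (auto simp: finite_energy_def)
  have sp': "in_space M B N (Stot_sq M B \<Phi>)" using Stot_in_space[OF sp] .
  have "Stot_sq M B \<Phi> xs = 0" if d: "\<not> distinct (map fst xs)" for xs
  proof (cases "xs \<in> configs M B N")
    case True
    have "\<Phi> xs = 0" "\<And>i j. i < N \<Longrightarrow> j < N \<Longrightarrow> \<Phi> (swap_spin i j xs) = 0"
      using nd d True unfolding nodouble_def by (auto simp: map_fst_swap_spin length_configs)
    then show ?thesis by (simp add: Stot_sq_exchange[OF True] exchange_def)
  next
    case False
    then show ?thesis using in_space_zero[OF sp'] by blast
  qed
  moreover have "lext (\<lambda>z. Stot_sq M B \<Phi> (xs[k := (z, \<sigma>)]))"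
    if xs: "xs \<in> configs M B N" and k: "k < N" for xs k \<sigma>
  proof -
    have len: "length xs = N" using xs by (rule length_configs)
    have 0: "lext (\<lambda>z. \<Phi> (xs[k := (z, \<sigma>)]))" using be xs k by (auto simp: bext_def)
    have sw: "lext (\<lambda>z. \<Phi> (swap_spin i j (xs[k := (z, \<sigma>)])))" if ij: "i < N" "j < N" for i j
    proof -
      define ys where "ys = swap_spin i j (xs[k := (fst (xs ! k), \<sigma>)])"
      have "ys \<in> configs M B N" unfolding ys_def
        using xs k ij by (intro swap_spin_configs update_configs modes_snd nth_modes)
      then have "lext (\<lambda>z. \<Phi> (ys[k := (z, snd (ys ! k))]))" using be k unfolding bext_def by blast
      moreover have "swap_spin i j (xs[k := (z, \<sigma>)]) = ys[k := (z, snd (ys ! k))]" for z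
        unfolding ys_def by (rule swap_spin_update) (use k ij len in auto)
      ultimately show ?thesis by simp
    qed
    have "lext (\<lambda>z. exchange N \<Phi> (xs[k := (z, \<sigma>)]))"
      unfolding exchange_def by (intro lext_comb 0 lext_sum sw) auto
    moreover have "exchange N \<Phi> (xs[k := (z, \<sigma>)]) = Stot_sq M B \<Phi> (xs[k := (z, \<sigma>)])" if "z \<in> Lam M B" for z
      using that xs by (intro Stot_sq_exchange[symmetric] update_configs) (auto simp: modes_def)
    ultimately show ?thesis unfolding lext_def using bond by (auto simp: Lam_def)
  qed
  ultimately show ?thesis using sp' unfolding finite_energy_def nodouble_def bext_def by blast
qed

lemma finite_energy_comb:
  assumes "f \<in> finite_energy N" "g \<in> finite_energy N"
  shows "(\<lambda>x. a * f x + b * g x) \<in> finite_energy N"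
  using assms unfolding finite_energy_def in_space_def nodouble_def bext_def
  by (auto simp: lext_comb algebra_simps)

sublocale spin: symmetric_operator "configs M B N" "finite_energy N" "Stot_sq M B" for N
proof
  fix f g assume f: "f \<in> finite_energy N" and g: "g \<in> finite_energy N"
  show "(\<Sum>x\<in>configs M B N. cnj (f x) * Stot_sq M B g x) = (\<Sum>x\<in>configs M B N. cnj (Stot_sq M B f x) * g x)"
    using exchange_sym[where N = N and f = f and g = g] by (simp add: Stot_sq_exchange)
qed (auto simp: finite_configs Stot_finite_energy finite_energy_comb Stot_linear, auto simp: finite_energy_def in_space_def)

text \<open>Hopping keeps the spin and has amplitudes independent of it, while exchanges leave
  positions alone, so the two commute.\<close>

lemma hopping_exchange:
  assumes "xs \<in> configs M B N"
  shows "hopping t (exchange N g) xs = exchange N (hopping t g) xs"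
proof -
  let ?h = "\<lambda>m m'. complex_of_real (hop_mat B t \<mu> m m')"
  have len: "length xs = N" using assms by (rule length_configs)
  have sw: "(\<Sum>k<N. \<Sum>m\<in>modes M B. ?h (xs ! k) m * g (swap_spin i j (xs[k := m]))) = hopping t g (swap_spin i j xs)"
    if ij: "i < N" "j < N" for i j
    unfolding hopping_def one_body_def length_swap_spin len
  proof (rule sum.cong)
    fix k assume k: "k \<in> {..<N}"
    let ?\<sigma> = "snd (xs ! k)" let ?\<tau> = "snd (swap_spin i j xs ! k)"
    have f: "fst (swap_spin i j xs ! k) = fst (xs ! k)" using k ij len by (simp add: nth_swap_spin)
    have L: "(\<Sum>m\<in>modes M B. ?h (xs ! k) m * F m) = (\<Sum>z\<in>Lam M B. ?h (xs ! k) (z, ?\<sigma>) * F (z, ?\<sigma>))" for F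
      by (cases ?\<sigma>) (simp_all add: sum_modes UNIV_bool hop_mat_def)
    have R: "(\<Sum>m\<in>modes M B. ?h (swap_spin i j xs ! k) m * F m) = (\<Sum>z\<in>Lam M B. ?h (xs ! k) (z, ?\<sigma>) * F (z, ?\<tau>))" for F
      by (cases ?\<tau>) (simp_all add: sum_modes UNIV_bool hop_mat_def f)
    have u: "swap_spin i j (xs[k := (z, ?\<sigma>)]) = (swap_spin i j xs)[k := (z, ?\<tau>)]" for z
      using swap_spin_update[where i = i and j = j and k = k and xs = xs and z = z and \<sigma> = ?\<sigma>] k ij len by simp
    show "(\<Sum>m\<in>modes M B. ?h (xs ! k) m * g (swap_spin i j (xs[k := m])))
      = (\<Sum>m\<in>modes M B. ?h (swap_spin i j xs ! k) m * g ((swap_spin i j xs)[k := m]))"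
      unfolding L R u ..
  qed simp
  define c where "c = complex_of_real (real N - (real N)\<^sup>2 / 4)"
  have ex: "exchange N \<phi> xs = c * \<phi> xs + 1 / 2 * (\<Sum>i<N. \<Sum>j\<in>{..<N} - {i}. \<phi> (swap_spin i j xs))" for \<phi> xs
    by (simp add: exchange_def c_def)
  have "hopping t (exchange N g) xs = c * hopping t g xs
     + 1 / 2 * (\<Sum>k<N. \<Sum>m\<in>modes M B. \<Sum>i<N. \<Sum>j\<in>{..<N} - {i}. ?h (xs ! k) m * g (swap_spin i j (xs[k := m])))"
    unfolding hopping_def one_body_def len ex
    by (simp add: sum_distrib_left sum.distrib algebra_simps)
  also have "(\<Sum>k<N. \<Sum>m\<in>modes M B. \<Sum>i<N. \<Sum>j\<in>{..<N} - {i}. ?h (xs ! k) m * g (swap_spin i j (xs[k := m])))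
    = (\<Sum>k<N. \<Sum>i<N. \<Sum>j\<in>{..<N} - {i}. \<Sum>m\<in>modes M B. ?h (xs ! k) m * g (swap_spin i j (xs[k := m])))"
    by (intro sum.cong refl, subst sum.swap, intro sum.cong refl, subst sum.swap, rule refl)
  also have "\<dots> = (\<Sum>i<N. \<Sum>k<N. \<Sum>j\<in>{..<N} - {i}. \<Sum>m\<in>modes M B. ?h (xs ! k) m * g (swap_spin i j (xs[k := m])))"
    by (rule sum.swap)
  also have "\<dots> = (\<Sum>i<N. \<Sum>j\<in>{..<N} - {i}. \<Sum>k<N. \<Sum>m\<in>modes M B. ?h (xs ! k) m * g (swap_spin i j (xs[k := m])))"
    by (rule sum.cong[OF refl], rule sum.swap)
  also have "\<dots> = (\<Sum>i<N. \<Sum>j\<in>{..<N} - {i}. hopping t g (swap_spin i j xs))"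
    by (intro sum.cong refl) (use sw in auto)
  finally show ?thesis unfolding ex .
qed

text \<open>\<open>hopping t g\<close> may put two electrons on one site and so leave
  \<open>finite_energy\<close>; the orthogonality argument therefore runs through
  \<open>exchange_sym\<close>, which holds for arbitrary functions.\<close>

lemma hopping_orthogonal:
  assumes "f \<in> finite_energy N" "g \<in> finite_energy N" "r \<noteq> q"
    and fr: "Stot_sq M B f = (\<lambda>x. complex_of_real r * f x)"
    and gq: "Stot_sq M B g = (\<lambda>x. complex_of_real q * g x)"
  shows "braket M B N f (hopping t g) = 0"
proof -
  have "exchange N g ys = complex_of_real q * g ys" if "ys \<in> configs M B N" for ys
    using Stot_sq_exchange[OF that, of g] gq by simp
  then have h: "hopping t (exchange N g) xs = complex_of_real q * hopping t g xs" if "xs \<in> configs M B N" for xs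
    unfolding hopping_def one_body_def using that
    by (simp add: update_configs sum_distrib_left algebra_simps)
  have g: "exchange N (hopping t g) xs = complex_of_real q * hopping t g xs" if "xs \<in> configs M B N" for xs
    using hopping_exchange[OF that, where t = t and g = g] h[OF that] by simp
  have f: "exchange N f xs = complex_of_real r * f xs" if "xs \<in> configs M B N" for xs
    using Stot_sq_exchange[OF that, of f] fr by simp
  have "complex_of_real q * braket M B N f (hopping t g) = complex_of_real r * braket M B N f (hopping t g)"
    using exchange_sym[where N = N and f = f and g = "hopping t g"] f g unfolding braket_def
    by (simp add: sum_distrib_left algebra_simps)
  then show ?thesis using assms(3) by simp
qed

text \<open>Parts of different total spin are orthogonal and not connected by hopping, so all cross
  terms vanish.\<close>

lemma t_energy_spectral:
  assumes "finite R" "\<And>r. r \<in> R \<Longrightarrow> part r \<in> finite_energy N"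
    "\<And>r. r \<in> R \<Longrightarrow> Stot_sq M B (part r) = (\<lambda>x. complex_of_real r * part r x)"
  shows "t_energy N t (\<lambda>x. \<Sum>r\<in>R. part r x) = (\<Sum>r\<in>R. t_energy N t (part r))" (is ?A)
    and "(\<Sum>xs\<in>configs M B N. (cmod (\<Sum>r\<in>R. part r xs))\<^sup>2) = (\<Sum>r\<in>R. \<Sum>xs\<in>configs M B N. (cmod (part r xs))\<^sup>2)" (is ?B)
proof -
  have "hopping t (\<lambda>x. \<Sum>r\<in>R. part r x) xs = (\<Sum>r\<in>R. hopping t (part r) xs)" for xs
  proof -
    have "hopping t (\<lambda>x. \<Sum>r\<in>R. part r x) xs = (\<Sum>i<length xs. \<Sum>m\<in>modes M B. \<Sum>r\<in>R. of_real (hop_mat B t \<mu> (xs ! i) m) * part r (xs[i := m]))"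
      unfolding hopping_def one_body_def by (simp add: sum_distrib_left)
    also have "\<dots> = (\<Sum>i<length xs. \<Sum>r\<in>R. \<Sum>m\<in>modes M B. of_real (hop_mat B t \<mu> (xs ! i) m) * part r (xs[i := m]))"
      by (intro sum.cong refl) (rule sum.swap)
    also have "\<dots> = (\<Sum>r\<in>R. hopping t (part r) xs)"
      unfolding hopping_def one_body_def by (rule sum.swap)
    finally show ?thesis .
  qed
  moreover have z: "braket M B N (part r) (hopping t (part q)) = 0" "(\<Sum>xs\<in>configs M B N. cnj (part r xs) * part q xs) = 0"
    if "r \<in> R" "q \<in> R" "q \<noteq> r" for r q
    using hopping_orthogonal[OF assms(2)[OF that(1)] assms(2)[OF that(2)] _ assms(3)[OF that(1)] assms(3)[OF that(2)]]
      spin.orthogonal[OF assms(2)[OF that(1)] assms(2)[OF that(2)] assms(3)[OF that(1)] assms(3)[OF that(2)]] that(3) by auto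
  ultimately have "braket M B N (\<lambda>x. \<Sum>r\<in>R. part r x) (hopping t (\<lambda>x. \<Sum>r\<in>R. part r x))
    = (\<Sum>xs\<in>configs M B N. \<Sum>r\<in>R. \<Sum>q\<in>R. cnj (part r xs) * hopping t (part q) xs)"
    unfolding braket_def by (simp add: sum_product)
  also have "\<dots> = (\<Sum>r\<in>R. \<Sum>q\<in>R. braket M B N (part r) (hopping t (part q)))"
    unfolding braket_def by (subst sum.swap, intro sum.cong refl, rule sum.swap)
  also have "\<dots> = (\<Sum>r\<in>R. \<Sum>q\<in>R. if q = r then braket M B N (part r) (hopping t (part r)) else 0)"
    by (intro sum.cong refl) (auto simp: z)
  also have "\<dots> = (\<Sum>r\<in>R. braket M B N (part r) (hopping t (part r)))" using assms(1) by simp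
  finally show ?A unfolding t_energy_def by simp
  have "(\<Sum>xs\<in>configs M B N. cnj (\<Sum>r\<in>R. part r xs) * (\<Sum>r\<in>R. part r xs))
    = (\<Sum>xs\<in>configs M B N. \<Sum>r\<in>R. \<Sum>q\<in>R. cnj (part r xs) * part q xs)"
    by (simp add: sum_product)
  also have "\<dots> = (\<Sum>r\<in>R. \<Sum>q\<in>R. \<Sum>xs\<in>configs M B N. cnj (part r xs) * part q xs)"
    by (subst sum.swap, intro sum.cong refl, rule sum.swap)
  also have "\<dots> = (\<Sum>r\<in>R. \<Sum>q\<in>R. if q = r then \<Sum>xs\<in>configs M B N. cnj (part r xs) * part r xs else 0)"
    by (intro sum.cong refl) (auto simp: z)
  also have "\<dots> = (\<Sum>r\<in>R. \<Sum>xs\<in>configs M B N. cnj (part r xs) * part r xs)" using assms(1) by simp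
  finally have "complex_of_real (\<Sum>xs\<in>configs M B N. (cmod (\<Sum>r\<in>R. part r xs))\<^sup>2)
     = complex_of_real (\<Sum>r\<in>R. \<Sum>xs\<in>configs M B N. (cmod (part r xs))\<^sup>2)"
    by (simp only: of_real_sum complex_norm_square mult.commute)
  then show ?B using of_real_eq_iff by blast
qed

end

section \<open>Reduction to configurations on the lattice sites\<close>

text \<open>Only used for modes on M; the other values are junk.\<close>

definition site :: "'a mode \<Rightarrow> 'a" where
  "site m = (case fst m of LM x \<Rightarrow> x | LU e \<Rightarrow> fst e | LUb e \<Rightarrow> fst e)"

lemma site_LM [simp]: "site (LM x, \<sigma>) = x"
  by (simp add: site_def)

definition occ :: "'a mode list \<Rightarrow> 'a set" where
  "occ xs = site ` set xs"

lemma occ_nth: "occ xs = (\<lambda>i. site (xs ! i)) ` {..<length xs}"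
  by (auto simp: occ_def set_conv_nth)

context bond_lattice
begin

definition Mconfigs :: "nat \<Rightarrow> 'a mode list set" where
  "Mconfigs N = {xs. length xs = N \<and> set xs \<subseteq> LM ` M \<times> UNIV}"

lemma Mconfigs_configs: "Mconfigs N \<subseteq> configs M B N"
  by (auto simp: Mconfigs_def configs_def modes_def Lam_def)

lemma finite_Mconfigs: "finite (Mconfigs N)"
  using Mconfigs_configs finite_configs finite_subset by blast

lemma Mconfigs_length: "xs \<in> Mconfigs N \<Longrightarrow> length xs = N"
  by (simp add: Mconfigs_def)

lemma Mconfigs_nth:
  assumes "xs \<in> Mconfigs N" "i < N"
  shows "xs ! i = (LM (site (xs ! i)), snd (xs ! i))" "site (xs ! i) \<in> M"
proof -
  have "xs ! i \<in> LM ` M \<times> UNIV" using assms by (auto simp: Mconfigs_def)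
  then show "xs ! i = (LM (site (xs ! i)), snd (xs ! i))" "site (xs ! i) \<in> M"
    by (auto simp: site_def)
qed

lemma Mconfigs_update: "xs \<in> Mconfigs N \<Longrightarrow> x \<in> M \<Longrightarrow> xs[i := (LM x, \<sigma>)] \<in> Mconfigs N"
  using set_update_subset_insert[of xs i "(LM x, \<sigma>)"] by (auto simp: Mconfigs_def)

lemma Mconfigs_swap_spin:
  assumes "xs \<in> Mconfigs N" "i < N" "j < N"
  shows "swap_spin i j xs \<in> Mconfigs N"
proof -
  have "fst (xs ! i) = LM (site (xs ! i))" "fst (xs ! j) = LM (site (xs ! j))"
    using Mconfigs_nth(1)[OF assms(1)] assms(2,3) by (metis fst_conv)+
  then show ?thesis
    unfolding swap_spin_def using Mconfigs_nth(2)[OF assms(1)] assms by (auto intro!: Mconfigs_update)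
qed

lemma occ_subset: "xs \<in> Mconfigs N \<Longrightarrow> occ xs \<subseteq> M"
  by (auto simp: occ_def Mconfigs_def site_def)

lemma Mconfigs_distinct:
  assumes "xs \<in> Mconfigs N"
  shows "distinct (map fst xs) \<longleftrightarrow> distinct (map site xs)"
proof -
  have "map fst xs = map LM (map site xs)"
    using Mconfigs_nth[OF assms] Mconfigs_length[OF assms] by (intro nth_equalityI) (auto simp: prod_eq_iff)
  then show ?thesis by (simp only: distinct_map) (simp add: inj_on_def)
qed

lemma bext_cons:
  assumes "bext (Suc N) f" "m \<in> modes M B"
  shows "bext N (\<lambda>ys. f (m # ys))"
  unfolding bext_def
proof (intro ballI allI impI)
  fix xs i \<sigma> assume "xs \<in> configs M B N" "i < N"
  then have "m # xs \<in> configs M B (Suc N)" "Suc i < Suc N" using assms(2) by (auto simp: configs_def)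
  then have "lext (\<lambda>z. f ((m # xs)[Suc i := (z, \<sigma>)]))" using assms(1) unfolding bext_def by blast
  then show "lext (\<lambda>z. f (m # xs[i := (z, \<sigma>)]))" by simp
qed

lemma bext_head:
  assumes "bext (Suc N) f" "ys \<in> configs M B N"
  shows "lext (\<lambda>z. f ((z, \<sigma>) # ys))"
\<comment> \<open>\<open>bext\<close> speaks only of complete configurations, so an end of some bond
  supplies a mode for the head; without bonds \<open>lext\<close> is vacuous.\<close>
proof (cases "B = {}")
  case True
  then show ?thesis unfolding lext_def by auto
next
  case False
  then obtain x y where "(x, y) \<in> B" by auto
  then have "(LM x, True) # ys \<in> configs M B (Suc N)"
    using assms(2) bond by (auto simp: configs_def modes_def Lam_def)
  then have "lext (\<lambda>z. f (((LM x, True) # ys)[0 := (z, \<sigma>)]))" using assms(1) unfolding bext_def by blast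
  then show ?thesis by simp
qed

text \<open>One coordinate at a time, \<open>lext_inner\<close> replaces the sum over
  \<open>Lam M B\<close> by the sum over M and yields a factor \<open>cc\<close>.\<close>

lemma bext_inner:
  assumes "bext N f" "bext N g"
  shows "(\<Sum>xs\<in>configs M B N. cnj (f xs) * g xs) = of_real (cc ^ N) * (\<Sum>xs\<in>Mconfigs N. cnj (f xs) * g xs)"
  using assms
proof (induction N arbitrary: f g)
  case 0
  have "configs M B 0 = {[]}" "Mconfigs 0 = {[]}" by (auto simp: configs_def Mconfigs_def)
  then show ?case by simp
next
  case (Suc N)
  have C: "(\<Sum>xs\<in>configs M B (Suc N). h xs) = (\<Sum>m\<in>modes M B. \<Sum>ys\<in>configs M B N. h (m # ys))" for h :: "'a mode list \<Rightarrow> complex"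
  proof -
    have "(\<Sum>xs\<in>configs M B (Suc N). h xs) = (\<Sum>(m,ys)\<in>modes M B \<times> configs M B N. h (m # ys))"
      by (rule sum.reindex_bij_witness[of _ "\<lambda>(m,ys). m # ys" "\<lambda>xs. (hd xs, tl xs)"])
        (auto simp: configs_def length_Suc_conv)
    then show ?thesis by (simp add: sum.cartesian_product)
  qed
  have D: "(\<Sum>xs\<in>Mconfigs (Suc N). h xs) = (\<Sum>\<sigma>\<in>UNIV. \<Sum>x\<in>M. \<Sum>ys\<in>Mconfigs N. h ((LM x, \<sigma>) # ys))" for h :: "'a mode list \<Rightarrow> complex"
  proof -
    have "(\<Sum>xs\<in>Mconfigs (Suc N). h xs) = (\<Sum>(m,ys)\<in>(LM ` M \<times> UNIV) \<times> Mconfigs N. h (m # ys))"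
      by (rule sum.reindex_bij_witness[of _ "\<lambda>(m,ys). m # ys" "\<lambda>xs. (hd xs, tl xs)"])
        (auto simp: Mconfigs_def length_Suc_conv)
    also have "\<dots> = (\<Sum>m\<in>LM ` M \<times> UNIV. \<Sum>ys\<in>Mconfigs N. h (m # ys))" by (rule sum.cartesian_product[symmetric])
    also have "\<dots> = (\<Sum>z\<in>LM ` M. \<Sum>\<sigma>\<in>UNIV. \<Sum>ys\<in>Mconfigs N. h ((z, \<sigma>) # ys))"
      using sum.cartesian_product[of "\<lambda>z \<sigma>. \<Sum>ys\<in>Mconfigs N. h ((z, \<sigma>) # ys)" UNIV "LM ` M"] by (simp add: case_prod_beta)
    also have "\<dots> = (\<Sum>\<sigma>\<in>UNIV. \<Sum>z\<in>LM ` M. \<Sum>ys\<in>Mconfigs N. h ((z, \<sigma>) # ys))" by (rule sum.swap)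
    finally show ?thesis by (simp add: sum.reindex inj_on_def)
  qed
  have "(\<Sum>xs\<in>configs M B (Suc N). cnj (f xs) * g xs) = (\<Sum>m\<in>modes M B. of_real (cc ^ N) * (\<Sum>ys\<in>Mconfigs N. cnj (f (m # ys)) * g (m # ys)))"
    unfolding C by (intro sum.cong refl Suc.IH bext_cons Suc.prems)
  also have "\<dots> = of_real (cc ^ N) * (\<Sum>\<sigma>\<in>UNIV. \<Sum>z\<in>Lam M B. \<Sum>ys\<in>Mconfigs N. cnj (f ((z, \<sigma>) # ys)) * g ((z, \<sigma>) # ys))"
    by (simp add: sum_distrib_left[symmetric] sum_modes)
  also have "\<dots> = of_real (cc ^ N) * (\<Sum>\<sigma>\<in>UNIV. \<Sum>ys\<in>Mconfigs N. \<Sum>z\<in>Lam M B. cnj (f ((z, \<sigma>) # ys)) * g ((z, \<sigma>) # ys))"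
    by (subst sum.swap) (rule refl)
  also have "\<dots> = of_real (cc ^ N) * (\<Sum>\<sigma>\<in>UNIV. \<Sum>ys\<in>Mconfigs N. of_real cc * (\<Sum>x\<in>M. cnj (f ((LM x, \<sigma>) # ys)) * g ((LM x, \<sigma>) # ys)))"
  proof -
    have "(\<Sum>z\<in>Lam M B. cnj (f ((z, \<sigma>) # ys)) * g ((z, \<sigma>) # ys)) = of_real cc * (\<Sum>x\<in>M. cnj (f ((LM x, \<sigma>) # ys)) * g ((LM x, \<sigma>) # ys))"
      if "ys \<in> Mconfigs N" for ys \<sigma>
      using that Mconfigs_configs Suc.prems by (intro lext_inner lext_cnj bext_head) auto
    then show ?thesis by (intro arg_cong[of _ _ "\<lambda>x. of_real (cc ^ N) * x"] sum.cong refl)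
  qed
  also have "\<dots> = of_real (cc ^ Suc N) * (\<Sum>\<sigma>\<in>UNIV. \<Sum>ys\<in>Mconfigs N. \<Sum>x\<in>M. cnj (f ((LM x, \<sigma>) # ys)) * g ((LM x, \<sigma>) # ys))"
    by (simp add: sum_distrib_left mult_ac)
  also have "\<dots> = of_real (cc ^ Suc N) * (\<Sum>\<sigma>\<in>UNIV. \<Sum>x\<in>M. \<Sum>ys\<in>Mconfigs N. cnj (f ((LM x, \<sigma>) # ys)) * g ((LM x, \<sigma>) # ys))"
    by (subst (2) sum.swap) (rule refl)
  finally show ?case unfolding D .
qed

lemma hop_row:
  assumes "lext (\<lambda>z. F (z, snd m'))"
  shows "(\<Sum>m\<in>modes M B. of_real (hop_mat B t \<mu> m' m) * F m)
    = of_real t * (\<Sum>(x,y)\<in>symE B. of_real (acoef B \<mu> x (fst m')) * (of_real (sqrt cc) * F (LM y, snd m')))"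
proof -
  have "(\<Sum>m\<in>modes M B. of_real (hop_mat B t \<mu> m' m) * F m) = (\<Sum>z\<in>Lam M B. of_real (hop_mat B t \<mu> m' (z, snd m')) * F (z, snd m'))"
    by (cases "snd m'") (simp_all add: sum_modes UNIV_bool hop_mat_def)
  also have "\<dots> = (\<Sum>z\<in>Lam M B. \<Sum>e\<in>symE B. of_real t * (of_real (acoef B \<mu> (fst e) (fst m')) * (of_real (acoef B \<mu> (snd e) z) * F (z, snd m'))))"
    by (simp add: hop_mat_def case_prod_beta sum_distrib_left sum_distrib_right mult_ac)
  also have "\<dots> = (\<Sum>e\<in>symE B. of_real t * (of_real (acoef B \<mu> (fst e) (fst m')) * (\<Sum>z\<in>Lam M B. of_real (acoef B \<mu> (snd e) z) * F (z, snd m'))))"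
    by (subst sum.swap) (simp add: sum_distrib_left)
  also have "\<dots> = (\<Sum>e\<in>symE B. of_real t * (of_real (acoef B \<mu> (fst e) (fst m')) * (of_real (sqrt cc) * F (LM (snd e), snd m'))))"
  proof (intro sum.cong refl)
    fix e assume "e \<in> symE B"
    then have "snd e \<in> M" using symE_D by (cases e) auto
    then have "(\<Sum>z\<in>Lam M B. of_real (acoef B \<mu> (snd e) z) * F (z, snd m')) = of_real (sqrt cc) * F (LM (snd e), snd m')"
      using acoef_inner[OF _ assms] by simp
    then show "of_real t * (of_real (acoef B \<mu> (fst e) (fst m')) * (\<Sum>z\<in>Lam M B. of_real (acoef B \<mu> (snd e) z) * F (z, snd m')))
      = of_real t * (of_real (acoef B \<mu> (fst e) (fst m')) * (of_real (sqrt cc) * F (LM (snd e), snd m')))" by simp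
  qed
  finally show ?thesis by (simp add: sum_distrib_left case_prod_beta)
qed

text \<open>The factor \<open>sqrt cc\<close> from pairing with one orbital cancels the
  normalisation of the other: on the sites of M the hopping is t times the adjacency matrix.\<close>

lemma hop_row_LM:
  assumes "lext (\<lambda>z. F (z, \<sigma>))" "x \<in> M"
  shows "(\<Sum>m\<in>modes M B. of_real (hop_mat B t \<mu> (LM x, \<sigma>) m) * F m) = of_real t * (\<Sum>y\<in>nbrs B x. F (LM y, \<sigma>))"
proof -
  have "(\<Sum>(x',y)\<in>symE B. of_real (acoef B \<mu> x' (LM x)) * (of_real (sqrt cc) * F (LM y, \<sigma>)))
    = (\<Sum>x'\<in>M. \<Sum>y\<in>nbrs B x'. of_real (acoef B \<mu> x' (LM x)) * (of_real (sqrt cc) * F (LM y, \<sigma>)))"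
    by (rule sum_symE)
  also have "\<dots> = (\<Sum>x'\<in>M. if x' = x then (\<Sum>y\<in>nbrs B x. F (LM y, \<sigma>)) else 0)"
    using cc_pos by (intro sum.cong refl) (auto simp: acoef_LM simp flip: of_real_mult)
  also have "\<dots> = (\<Sum>y\<in>nbrs B x. F (LM y, \<sigma>))" using finite_M assms(2) by simp
  finally show ?thesis using hop_row[of F "(LM x, \<sigma>)" t] assms(1) by simp
qed

text \<open>In the coordinate that moves, the result is a combination of the orbitals
  \<open>acoef\<close>, which are \<open>lext\<close>; the dependence on the other coordinates is
  inherited from \<Phi>.\<close>

lemma hopping_bext:
  assumes "bext N \<Phi>"
  shows "bext N (hopping t \<Phi>)"
  unfolding bext_def
proof (intro ballI allI impI)
  fix xs k \<sigma> assume xs: "xs \<in> configs M B N" and k: "k < N"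
  have len: "length xs = N" using xs by (rule length_configs)
  have *: "lext (\<lambda>z. \<Sum>m\<in>modes M B. of_real (hop_mat B t \<mu> (xs[k := (z, \<sigma>)] ! i) m) * \<Phi> (xs[k := (z, \<sigma>), i := m]))"
    if i: "i < N" for i
  proof (cases "i = k")
    case True
    have "lext (\<lambda>z. \<Phi> (xs[k := (z, \<sigma>)]))" using assms xs k by (auto simp: bext_def)
    then have "(\<Sum>m\<in>modes M B. of_real (hop_mat B t \<mu> (z, \<sigma>) m) * \<Phi> (xs[k := m]))
      = of_real t * (\<Sum>(x,y)\<in>symE B. (of_real (sqrt cc) * \<Phi> (xs[k := (LM y, \<sigma>)])) * of_real (acoef B \<mu> x z))" for z
      using hop_row[of "\<lambda>m. \<Phi> (xs[k := m])" "(z, \<sigma>)" t] by (simp add: mult_ac)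
    moreover have "lext (\<lambda>z. of_real t * (\<Sum>(x,y)\<in>symE B. (of_real (sqrt cc) * \<Phi> (xs[k := (LM y, \<sigma>)])) * of_real (acoef B \<mu> x z)))"
      unfolding case_prod_beta by (intro lext_scale lext_sum acoef_lext)
    ultimately show ?thesis using True k len by simp
  next
    case False
    have "lext (\<lambda>z. of_real (hop_mat B t \<mu> (xs ! i) m) * \<Phi> (xs[i := m, k := (z, \<sigma>)]))" if "m \<in> modes M B" for m
      using assms update_configs[OF xs that] k unfolding bext_def by (intro lext_scale) blast
    then have "lext (\<lambda>z. \<Sum>m\<in>modes M B. of_real (hop_mat B t \<mu> (xs ! i) m) * \<Phi> (xs[i := m, k := (z, \<sigma>)]))"
      by (rule lext_sum)
    then show ?thesis using False by (simp add: list_update_swap)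
  qed
  have "lext (\<lambda>z. \<Sum>i<N. \<Sum>m\<in>modes M B. of_real (hop_mat B t \<mu> (xs[k := (z, \<sigma>)] ! i) m) * \<Phi> (xs[k := (z, \<sigma>), i := m]))"
    by (rule lext_sum) (use * in auto)
  then show "lext (\<lambda>z. hopping t \<Phi> (xs[k := (z, \<sigma>)]))"
    unfolding hopping_def one_body_def by (simp add: len)
qed

lemma hopping_Mconfigs:
  assumes "bext N \<Phi>" "xs \<in> Mconfigs N"
  shows "hopping t \<Phi> xs = of_real t * (\<Sum>i<N. \<Sum>y\<in>nbrs B (site (xs ! i)). \<Phi> (xs[i := (LM y, snd (xs ! i))]))"
  unfolding hopping_def one_body_def Mconfigs_length[OF assms(2)] sum_distrib_left[of "of_real t" _ "{..<N}"]
proof (intro sum.cong refl)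
  fix i assume i: "i \<in> {..<N}"
  have "lext (\<lambda>z. \<Phi> (xs[i := (z, snd (xs ! i))]))"
    using assms Mconfigs_configs i unfolding bext_def by blast
  then have "(\<Sum>m\<in>modes M B. of_real (hop_mat B t \<mu> (LM (site (xs ! i)), snd (xs ! i)) m) * \<Phi> (xs[i := m]))
    = of_real t * (\<Sum>y\<in>nbrs B (site (xs ! i)). \<Phi> (xs[i := (LM y, snd (xs ! i))]))"
    using Mconfigs_nth(2)[OF assms(2)] i by (intro hop_row_LM) auto
  then show "(\<Sum>m\<in>modes M B. of_real (hop_mat B t \<mu> (xs ! i) m) * \<Phi> (xs[i := m]))
    = of_real t * (\<Sum>y\<in>nbrs B (site (xs ! i)). \<Phi> (xs[i := (LM y, snd (xs ! i))]))"
    using Mconfigs_nth(1)[OF assms(2), of i] i by simp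
qed

section \<open>The kinetic energy is raised by adjacent holes\<close>

text \<open>Ordered pairs of adjacent holes, so each bond between two holes counts twice.\<close>

definition hole_pairs :: "'a set \<Rightarrow> nat" where
  "hole_pairs A = card (symE B \<inter> (M - A) \<times> (M - A))"

definition moves :: "'a mode list \<Rightarrow> (nat \<times> 'a) set" where
  "moves xs = {(i, y). i < length xs \<and> y \<in> nbrs B (site (xs ! i)) \<and> y \<notin> occ xs}"

lemma finite_moves: "finite (moves xs)"
  by (rule finite_subset[of _ "{..<length xs} \<times> M"]) (use nbrs_subset finite_M in \<open>auto simp: moves_def\<close>)

lemma card_occ: "distinct (map site xs) \<Longrightarrow> card (occ xs) = length xs"
  unfolding occ_def using distinct_card[of "map site xs"] by simp

text \<open>A possible hop is a bond seen from the hole. Each hole has \<zeta> neighbours, and those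
  that are holes themselves offer no electron.\<close>

lemma card_moves:
  assumes "xs \<in> Mconfigs N" "distinct (map site xs)"
  shows "real (card (moves xs)) = real \<zeta> * (real (card M) - real N) - real (hole_pairs (occ xs))"
proof -
  let ?A = "occ xs"
  have len: "length xs = N" using assms(1) by (rule Mconfigs_length)
  have AM: "?A \<subseteq> M" using occ_subset assms(1) by blast
  have fA: "finite ?A" "finite (M - ?A)" using AM finite_M finite_subset by auto
  have inj: "inj_on (\<lambda>(i, y). (y, site (xs ! i))) (moves xs)"
    using assms(2) unfolding inj_on_def moves_def by (auto simp: distinct_conv_nth)
  have im: "(\<lambda>(i, y). (y, site (xs ! i))) ` moves xs = symE B \<inter> (M - ?A) \<times> ?A"
  proof (intro equalityI subsetI)
    fix p assume "p \<in> (\<lambda>(i, y). (y, site (xs ! i))) ` moves xs"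
    then show "p \<in> symE B \<inter> (M - ?A) \<times> ?A"
      using symE_sym symE_D by (auto simp: moves_def nbrs_def occ_def)
  next
    fix p assume p: "p \<in> symE B \<inter> (M - ?A) \<times> ?A"
    then obtain y i where "p = (y, site (xs ! i))" "i < length xs" by (auto simp: occ_nth)
    then show "p \<in> (\<lambda>(i, y). (y, site (xs ! i))) ` moves xs"
      using p symE_sym by (auto simp: moves_def nbrs_def intro!: image_eqI[of _ _ "(i, y)"])
  qed
  have 1: "card (moves xs) = card (symE B \<inter> (M - ?A) \<times> ?A)"
    using card_image[OF inj] im by simp
  have "symE B \<inter> (M - ?A) \<times> M = (symE B \<inter> (M - ?A) \<times> ?A) \<union> (symE B \<inter> (M - ?A) \<times> (M - ?A))"
    using AM by auto
  then have "card (symE B \<inter> (M - ?A) \<times> M) = card (moves xs) + hole_pairs ?A"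
    unfolding 1 hole_pairs_def by (subst card_Un_disjoint[symmetric]) (auto simp: finite_symE)
  moreover have "symE B \<inter> (M - ?A) \<times> M = Sigma (M - ?A) (nbrs B)"
    using symE_D by (auto simp: nbrs_def)
  moreover have "card (Sigma (M - ?A) (nbrs B)) = \<zeta> * card (M - ?A)"
    using fA finite_nbrs by (subst card_SigmaI) (auto simp: degree)
  moreover have "real (card (M - ?A)) = real (card M) - real N"
    using card_Diff_subset[OF fA(1) AM] card_mono[OF finite_M AM] card_occ[OF assms(2)] len by simp
  ultimately show ?thesis by (metis add_diff_cancel_left' add_diff_cancel_right' of_nat_add of_nat_mult)
qed

text \<open>Hops onto occupied sites drop out since \<Phi> excludes double occupancy. Undoing a hop
  is an involution on pairs of a configuration and a move, so both squares in the AM-GM estimate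
  have the same sum, and each configuration is charged once per move.\<close>

lemma t_energy_lower:
  assumes \<Phi>: "\<Phi> \<in> finite_energy N" and t: "t > 0"
  shows "t_energy N t \<Phi> \<ge> t * cc ^ N * (\<Sum>xs\<in>Mconfigs N. (cmod (\<Phi> xs))\<^sup>2 *
     (real (hole_pairs (occ xs)) - real \<zeta> * (real (card M) - real N)))"
proof -
  have nd: "nodouble \<Phi>" and be: "bext N \<Phi>" using \<Phi> by (auto simp: finite_energy_def)
  define D where "D = {xs \<in> Mconfigs N. distinct (map site xs)}"
  have finD: "finite D" using finite_Mconfigs by (simp add: D_def)
  have zero: "\<Phi> xs = 0" if "xs \<in> Mconfigs N - D" for xs
    using that nd Mconfigs_distinct unfolding D_def nodouble_def by auto
  define tgt where "tgt xs p = xs[fst p := (LM (snd p), snd (xs ! fst p))]" for xs :: "'a mode list" and p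
  have row: "(\<Sum>i<N. \<Sum>y\<in>nbrs B (site (xs ! i)). \<Phi> (xs[i := (LM y, snd (xs ! i))])) = (\<Sum>p\<in>moves xs. \<Phi> (tgt xs p))"
    if "xs \<in> D" for xs
  proof -
    have len: "length xs = N" using that by (auto simp: D_def Mconfigs_def)
    have xs: "xs \<in> Mconfigs N" using that by (auto simp: D_def)
    have "(\<Sum>i<N. \<Sum>y\<in>nbrs B (site (xs ! i)). \<Phi> (xs[i := (LM y, snd (xs ! i))])) = (\<Sum>p\<in>Sigma {..<N} (\<lambda>i. nbrs B (site (xs ! i))). \<Phi> (tgt xs p))"
      unfolding tgt_def by (simp add: sum.Sigma finite_nbrs case_prod_beta)
    also have "\<dots> = (\<Sum>p\<in>moves xs. \<Phi> (tgt xs p))"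
    proof (rule sum.mono_neutral_right)
      show "\<forall>p\<in>Sigma {..<N} (\<lambda>i. nbrs B (site (xs ! i))) - moves xs. \<Phi> (tgt xs p) = 0"
      proof
        fix p assume p: "p \<in> Sigma {..<N} (\<lambda>i. nbrs B (site (xs ! i))) - moves xs"
        obtain i y where iy: "p = (i, y)" "i < N" "y \<in> nbrs B (site (xs ! i))" "y \<in> occ xs"
          using p len by (auto simp: moves_def)
        then obtain j where j: "j < N" "y = site (xs ! j)" using len by (auto simp: occ_def in_set_conv_nth)
        have "y \<noteq> site (xs ! i)" using iy(3) symE_D by (auto simp: nbrs_def)
        then have "i \<noteq> j" using j by auto
        have "fst (xs ! j) = LM y" using Mconfigs_nth(1)[OF xs j(1)] j(2) by (metis fst_conv)
        then have "map fst (tgt xs p) ! i = map fst (tgt xs p) ! j"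
          using iy j \<open>i \<noteq> j\<close> len by (simp add: tgt_def)
        moreover have "length (map fst (tgt xs p)) = N" by (simp add: tgt_def len)
        ultimately have "\<not> distinct (map fst (tgt xs p))"
          using iy(2) j(1) \<open>i \<noteq> j\<close> by (metis nth_eq_iff_index_eq)
        then show "\<Phi> (tgt xs p) = 0" using nd by (simp add: nodouble_def)
      qed
    qed (use len finite_nbrs in \<open>auto simp: moves_def\<close>)
    finally show ?thesis .
  qed
  have "braket M B N \<Phi> (hopping t \<Phi>) = of_real (cc ^ N) * (\<Sum>xs\<in>Mconfigs N. cnj (\<Phi> xs) * hopping t \<Phi> xs)"
    unfolding braket_def by (rule bext_inner[OF be hopping_bext[OF be]])
  also have "(\<Sum>xs\<in>Mconfigs N. cnj (\<Phi> xs) * hopping t \<Phi> xs) = (\<Sum>xs\<in>D. cnj (\<Phi> xs) * hopping t \<Phi> xs)"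
    by (rule sum.mono_neutral_right) (use zero finite_Mconfigs in \<open>auto simp: D_def\<close>)
  also have "\<dots> = of_real t * (\<Sum>xs\<in>D. \<Sum>p\<in>moves xs. cnj (\<Phi> xs) * \<Phi> (tgt xs p))"
    unfolding sum_distrib_left
    by (intro sum.cong refl) (auto simp: D_def hopping_Mconfigs[OF be] row sum_distrib_left mult_ac)
  also have "(\<Sum>xs\<in>D. \<Sum>p\<in>moves xs. cnj (\<Phi> xs) * \<Phi> (tgt xs p)) = (\<Sum>(xs,p)\<in>Sigma D moves. cnj (\<Phi> xs) * \<Phi> (tgt xs p))"
    using finD finite_moves by (simp add: sum.Sigma)
  finally have E: "t_energy N t \<Phi> = t * cc ^ N * (\<Sum>(xs,p)\<in>Sigma D moves. Re (cnj (\<Phi> xs) * \<Phi> (tgt xs p)))"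
    unfolding t_energy_def by (simp add: case_prod_beta)
  have sym: "(\<Sum>(xs,p)\<in>Sigma D moves. (cmod (\<Phi> (tgt xs p)))\<^sup>2) = (\<Sum>(xs,p)\<in>Sigma D moves. (cmod (\<Phi> xs))\<^sup>2)"
  proof -
    \<comment> \<open>The reversed hop: the same electron returns to the site it left.\<close>
    define w where "w = (\<lambda>(xs, p). (tgt xs p, (fst p, site (xs ! fst p))))"
    have w: "w q \<in> Sigma D moves \<and> w (w q) = q" if "q \<in> Sigma D moves" for q
    proof -
      obtain xs i y where q: "q = (xs, (i, y))" by (metis prod.collapse)
      have xs: "xs \<in> Mconfigs N" "distinct (map site xs)" and i: "i < length xs" and y: "y \<in> nbrs B (site (xs ! i))" "y \<notin> occ xs"
        using that q by (auto simp: D_def moves_def)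
      have len: "length xs = N" using xs Mconfigs_length by blast
      have yM: "y \<in> M" using y nbrs_subset by blast
      define ys where "ys = xs[i := (LM y, snd (xs ! i))]"
      have ys: "ys \<in> Mconfigs N" unfolding ys_def by (rule Mconfigs_update[OF xs(1) yM])
      have ms: "map site ys = (map site xs)[i := y]" by (simp add: ys_def map_update)
      have so: "occ xs = set (map site xs)" "occ ys = set (map site ys)" by (auto simp: occ_def)
      have d: "distinct (map site ys)" unfolding ms
        using xs(2) y(2) so by (intro distinct_list_update) auto
      have ny: "site (xs ! i) \<notin> occ ys"
      proof
        assume "site (xs ! i) \<in> occ ys"
        then obtain j where j: "j < length xs" "(map site xs)[i := y] ! j = site (xs ! i)"
          unfolding so ms by (auto simp: in_set_conv_nth)
        show False
        proof (cases "j = i")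
          case True
          then show False using j y symE_D[of "site (xs ! i)" y] by (auto simp: nbrs_def)
        next
          case False
          then show False using j xs(2) i by (auto simp: distinct_conv_nth)
        qed
      qed
      have "(i, site (xs ! i)) \<in> moves ys"
        using i ny y symE_sym by (auto simp: moves_def ys_def nbrs_def)
      moreover have "ys[i := (LM (site (xs ! i)), snd (xs ! i))] = xs"
        using Mconfigs_nth(1)[OF xs(1), of i] i len by (simp add: ys_def)
      ultimately show ?thesis
        using ys d i by (auto simp: w_def q tgt_def ys_def[symmetric] D_def) (auto simp: ys_def)
    qed
    show ?thesis
      by (rule sum.reindex_bij_witness[of _ w w]) (use w in \<open>auto simp: w_def case_prod_beta\<close>)
  qed
  have "(\<Sum>(xs,p)\<in>Sigma D moves. Re (cnj (\<Phi> xs) * \<Phi> (tgt xs p)))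
     \<ge> (\<Sum>(xs,p)\<in>Sigma D moves. - ((cmod (\<Phi> xs))\<^sup>2 + (cmod (\<Phi> (tgt xs p)))\<^sup>2) / 2)"
  proof (rule sum_mono, safe)
    have aux: "\<bar>r\<bar> \<le> p \<Longrightarrow> 2 * p \<le> q \<Longrightarrow> - q / 2 \<le> r" for r p q :: real by linarith
    fix xs i y
    have "\<bar>Re (cnj (\<Phi> xs) * \<Phi> (tgt xs (i,y)))\<bar> \<le> cmod (\<Phi> xs) * cmod (\<Phi> (tgt xs (i,y)))"
      using abs_Re_le_cmod[of "cnj (\<Phi> xs) * \<Phi> (tgt xs (i,y))"] by (simp add: norm_mult)
    moreover have "2 * (cmod (\<Phi> xs) * cmod (\<Phi> (tgt xs (i,y)))) \<le> (cmod (\<Phi> xs))\<^sup>2 + (cmod (\<Phi> (tgt xs (i,y))))\<^sup>2"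
      using sum_squares_bound[of "cmod (\<Phi> xs)" "cmod (\<Phi> (tgt xs (i,y)))"] by simp
    ultimately show "- ((cmod (\<Phi> xs))\<^sup>2 + (cmod (\<Phi> (tgt xs (i,y))))\<^sup>2) / 2 \<le> Re (cnj (\<Phi> xs) * \<Phi> (tgt xs (i,y)))"
      by (rule aux)
  qed
  also have "(\<Sum>(xs,p)\<in>Sigma D moves. - ((cmod (\<Phi> xs))\<^sup>2 + (cmod (\<Phi> (tgt xs p)))\<^sup>2) / 2)
     = - (\<Sum>(xs,p)\<in>Sigma D moves. (cmod (\<Phi> xs))\<^sup>2)"
    using sym by (simp add: case_prod_beta sum.distrib sum_negf sum_subtractf flip: sum_divide_distrib)
  also have "(\<Sum>(xs,p)\<in>Sigma D moves. (cmod (\<Phi> xs))\<^sup>2) = (\<Sum>xs\<in>D. (cmod (\<Phi> xs))\<^sup>2 * real (card (moves xs)))"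
    using finD finite_moves by (simp add: sum.Sigma[symmetric] mult.commute)
  also have "- \<dots> = (\<Sum>xs\<in>D. (cmod (\<Phi> xs))\<^sup>2 * (real (hole_pairs (occ xs)) - real \<zeta> * (real (card M) - real N)))"
    unfolding sum_negf[symmetric] by (intro sum.cong refl) (auto simp: D_def card_moves algebra_simps)
  also have "\<dots> = (\<Sum>xs\<in>Mconfigs N. (cmod (\<Phi> xs))\<^sup>2 * (real (hole_pairs (occ xs)) - real \<zeta> * (real (card M) - real N)))"
    by (rule sum.mono_neutral_left) (use zero finite_Mconfigs in \<open>auto simp: D_def\<close>)
  finally show ?thesis unfolding E using t cc_pos by (intro mult_left_mono) auto
qed

text \<open>The norm over all configurations is \<open>cc ^ N\<close> times the norm over those on
  M, and a single configuration on M of nonzero amplitude makes the estimate strict.\<close>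

lemma t_energy_strict_lower:
  assumes \<Phi>: "\<Phi> \<in> finite_energy N" and t: "t > 0" and nz: "(\<Sum>xs\<in>configs M B N. (cmod (\<Phi> xs))\<^sup>2) > 0"
    and Q: "\<And>xs. xs \<in> Mconfigs N \<Longrightarrow> distinct (map site xs) \<Longrightarrow> \<Phi> xs \<noteq> 0 \<Longrightarrow> real (hole_pairs (occ xs)) > e"
  shows "t_energy N t \<Phi> > t * (e - real \<zeta> * (real (card M) - real N)) * (\<Sum>xs\<in>configs M B N. (cmod (\<Phi> xs))\<^sup>2)"
proof -
  have nd: "nodouble \<Phi>" and be: "bext N \<Phi>" using \<Phi> by (auto simp: finite_energy_def)
  have "complex_of_real (\<Sum>xs\<in>configs M B N. (cmod (\<Phi> xs))\<^sup>2) = complex_of_real (cc ^ N * (\<Sum>xs\<in>Mconfigs N. (cmod (\<Phi> xs))\<^sup>2))"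
    using bext_inner[OF be be] by (simp only: of_real_mult of_real_sum complex_norm_square mult.commute[of "\<Phi> _"])
  then have norm: "(\<Sum>xs\<in>configs M B N. (cmod (\<Phi> xs))\<^sup>2) = cc ^ N * (\<Sum>xs\<in>Mconfigs N. (cmod (\<Phi> xs))\<^sup>2)"
    using of_real_eq_iff by blast
  let ?c = "real \<zeta> * (real (card M) - real N)"
  have Q': "real (hole_pairs (occ xs)) > e" if "xs \<in> Mconfigs N" "\<Phi> xs \<noteq> 0" for xs
    using Q[OF that(1) _ that(2)] that nd Mconfigs_distinct[OF that(1)] unfolding nodouble_def by auto
  obtain xs0 where xs0: "xs0 \<in> Mconfigs N" "\<Phi> xs0 \<noteq> 0"
    using nz unfolding norm by (metis (no_types, lifting) less_irrefl mult_zero_right norm_zero sum.neutral zero_power2)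
  have "(\<Sum>xs\<in>Mconfigs N. (cmod (\<Phi> xs))\<^sup>2 * (e - ?c)) < (\<Sum>xs\<in>Mconfigs N. (cmod (\<Phi> xs))\<^sup>2 * (real (hole_pairs (occ xs)) - ?c))"
  proof (rule sum_strict_mono_ex1[OF finite_Mconfigs])
    show "\<forall>xs\<in>Mconfigs N. (cmod (\<Phi> xs))\<^sup>2 * (e - ?c) \<le> (cmod (\<Phi> xs))\<^sup>2 * (real (hole_pairs (occ xs)) - ?c)"
    proof
      fix xs assume "xs \<in> Mconfigs N"
      then show "(cmod (\<Phi> xs))\<^sup>2 * (e - ?c) \<le> (cmod (\<Phi> xs))\<^sup>2 * (real (hole_pairs (occ xs)) - ?c)"
        using Q'[of xs] by (cases "\<Phi> xs = 0") (auto intro!: mult_left_mono)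
    qed
    show "\<exists>xs\<in>Mconfigs N. (cmod (\<Phi> xs))\<^sup>2 * (e - ?c) < (cmod (\<Phi> xs))\<^sup>2 * (real (hole_pairs (occ xs)) - ?c)"
      using xs0 Q'[OF xs0] by (intro bexI[of _ xs0] mult_strict_left_mono) auto
  qed
  then have "t * cc ^ N * (\<Sum>xs\<in>Mconfigs N. (cmod (\<Phi> xs))\<^sup>2 * (e - ?c))
     < t * cc ^ N * (\<Sum>xs\<in>Mconfigs N. (cmod (\<Phi> xs))\<^sup>2 * (real (hole_pairs (occ xs)) - ?c))"
    using t cc_pos by (intro mult_strict_left_mono) auto
  also have "\<dots> \<le> t_energy N t \<Phi>" by (rule t_energy_lower[OF \<Phi> t])
  finally show ?thesis unfolding norm by (simp add: sum_distrib_right[symmetric] mult_ac)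
qed

end

section \<open>Connected clusters of electrons carry maximal spin\<close>

lemma finite_arg_max:
  fixes f :: "'b \<Rightarrow> 'c :: linorder"
  assumes "finite S" "x \<in> S"
  obtains y where "y \<in> S" "\<And>z. z \<in> S \<Longrightarrow> f z \<le> f y"
proof -
  have "Max (f ` S) \<in> f ` S" using assms by (intro Max_in) auto
  then obtain y where "y \<in> S" "Max (f ` S) = f y" by auto
  moreover have "f z \<le> Max (f ` S)" if "z \<in> S" for z using that assms(1) by simp
  ultimately show ?thesis using that by auto
qed

lemma swap_spin_commute: "i < length xs \<Longrightarrow> j < length xs \<Longrightarrow> swap_spin i j xs = swap_spin j i xs"
  by (rule nth_equalityI) (auto simp: nth_swap_spin transpose_def)

text \<open>Conjugation of transpositions, by which exchange symmetry passes along a path from k to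
  its neighbour j.\<close>

lemma swap_spin_chain:
  assumes "i < length xs" "j < length xs" "k < length xs" "i \<noteq> j" "k \<noteq> j" "i \<noteq> k"
  shows "swap_spin i k (swap_spin k j (swap_spin i k xs)) = swap_spin i j xs"
proof -
  have "transpose i k (transpose k j (transpose i k l)) = transpose i j l" for l
    using assms(4-6) by (auto simp: transpose_def)
  then show ?thesis by (intro nth_equalityI) (use assms(1-3) in \<open>auto simp: nth_swap_spin transpose_less\<close>)
qed

context bond_lattice
begin

text \<open>Excluding double occupancy of the site u(x,y) forbids a singlet on the bond (x,y).\<close>

lemma exchange_bond:
  assumes \<Phi>: "\<Phi> \<in> finite_energy N" and \<mu>: "\<mu> \<noteq> 0" and ys: "ys \<in> Mconfigs N"
    and ij: "i < N" "j < N" and b: "(site (ys ! i), site (ys ! j)) \<in> B"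
  shows "\<Phi> (swap_spin i j ys) = \<Phi> ys"
proof -
  have nd: "nodouble \<Phi>" and be: "bext N \<Phi>" and sp: "in_space M B N \<Phi>" using \<Phi> by (auto simp: finite_energy_def)
  define x y where "x = site (ys ! i)" and "y = site (ys ! j)"
  have xy: "(x, y) \<in> B" "x \<in> M" "y \<in> M" "x \<noteq> y" using b bond unfolding x_def y_def by auto
  have "i \<noteq> j" using xy by (auto simp: x_def y_def)
  have len: "length ys = N" using ys by (rule Mconfigs_length)
  have yc: "ys \<in> configs M B N" using ys Mconfigs_configs by blast
  define \<sigma> \<tau> where "\<sigma> = snd (ys ! i)" and "\<tau> = snd (ys ! j)"
  have yi: "ys ! i = (LM x, \<sigma>)" "ys ! j = (LM y, \<tau>)"
    using Mconfigs_nth(1)[OF ys] ij by (auto simp: x_def y_def \<sigma>_def \<tau>_def)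
  define G where "G a b \<sigma> \<tau> = \<Phi> (ys[i := (a, \<sigma>), j := (b, \<tau>)])" for a b \<sigma> \<tau>
  have lm: "LM x \<in> Lam M B" "LM y \<in> Lam M B" "LU (x,y) \<in> Lam M B" using xy by (auto simp: Lam_def)
  have dd: "G a a \<sigma> \<tau> = 0" for a \<sigma> \<tau>
  proof -
    let ?zs = "ys[i := (a, \<sigma>), j := (a, \<tau>)]"
    have "map fst ?zs ! i = map fst ?zs ! j" using ij len \<open>i \<noteq> j\<close> by simp
    moreover have "length (map fst ?zs) = N" using len by simp
    ultimately have "\<not> distinct (map fst ?zs)" using ij \<open>i \<noteq> j\<close> by (metis nth_eq_iff_index_eq)
    then show ?thesis using nd unfolding G_def nodouble_def by blast
  qed
  have b2: "G a (LU (x,y)) \<sigma> \<tau> = of_real \<mu> * (G a (LM x) \<sigma> \<tau> + G a (LM y) \<sigma> \<tau>)" if "a \<in> Lam M B" for a \<sigma> \<tau>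
  proof -
    have "ys[i := (a, \<sigma>)] \<in> configs M B N" using that yc by (intro update_configs) (auto simp: modes_def)
    then have "lext (\<lambda>z. G a z \<sigma> \<tau>)" using be ij unfolding bext_def G_def by blast
    then show ?thesis using lextD(1)[OF _ xy(1)] by blast
  qed
  have b1: "G (LU (x,y)) b \<sigma> \<tau> = of_real \<mu> * (G (LM x) b \<sigma> \<tau> + G (LM y) b \<sigma> \<tau>)" if "b \<in> Lam M B" for b \<sigma> \<tau>
  proof -
    have G: "G z b \<sigma> \<tau> = \<Phi> (ys[j := (b, \<tau>), i := (z, \<sigma>)])" for z
      unfolding G_def using \<open>i \<noteq> j\<close> by (simp add: list_update_swap)
    have "ys[j := (b, \<tau>)] \<in> configs M B N" using that yc by (intro update_configs) (auto simp: modes_def)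
    then have "lext (\<lambda>z. G z b \<sigma> \<tau>)" using be ij unfolding bext_def G by blast
    then show ?thesis using lextD(1)[OF _ xy(1)] by blast
  qed
  \<comment> \<open>Both electrons are moved off u(x,y) by linearity; the amplitudes with both on x
    or both on y vanish as well. The amplitude thus changes sign under exchange of the positions
    and, being antisymmetric in the electrons, is symmetric in the spins.\<close>
  have "0 = G (LU (x,y)) (LU (x,y)) \<sigma> \<tau>" by (simp add: dd)
  also have "\<dots> = of_real \<mu> * (of_real \<mu> * (G (LM x) (LM y) \<sigma> \<tau> + G (LM y) (LM x) \<sigma> \<tau>))"
    by (simp add: b1 b2 lm dd[of "LM x"] dd[of "LM y"] algebra_simps)
  finally have g: "G (LM x) (LM y) \<sigma> \<tau> = - G (LM y) (LM x) \<sigma> \<tau>" using \<mu> by (simp add: add_eq_0_iff2)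
  have "G (LM y) (LM x) \<sigma> \<tau> = - G (LM x) (LM y) \<tau> \<sigma>"
    using in_space_antisym[OF sp, of i "ys[i := (LM x, \<tau>), j := (LM y, \<sigma>)]" j] ij len \<open>i \<noteq> j\<close>
    by (simp add: G_def list_update_swap[of i j])
  then have "G (LM x) (LM y) \<sigma> \<tau> = G (LM x) (LM y) \<tau> \<sigma>" using g by simp
  moreover have "G (LM x) (LM y) \<sigma> \<tau> = \<Phi> ys" by (simp add: G_def yi[symmetric])
  moreover have "G (LM x) (LM y) \<tau> \<sigma> = \<Phi> (swap_spin i j ys)" by (simp add: G_def swap_spin_def yi)
  ultimately show ?thesis by simp
qed

lemma exchange_neighbour:
  assumes "\<Phi> \<in> finite_energy N" "\<mu> \<noteq> 0" "ys \<in> Mconfigs N"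
    and "i < N" "j < N" "(site (ys ! i), site (ys ! j)) \<in> symE B"
  shows "\<Phi> (swap_spin i j ys) = \<Phi> ys"
  using assms exchange_bond[of \<Phi> N ys i j] exchange_bond[of \<Phi> N ys j i] swap_spin_commute[of i ys j] Mconfigs_length
  by (auto simp: symE_def)

text \<open>The closure is reflexive on the whole type, so this is an equivalence relation; a site
  outside \<open>A\<close> is a class by itself.\<close>

definition clusters :: "'a set \<Rightarrow> ('a \<times> 'a) set" where
  "clusters A = (symE B \<inter> A \<times> A)\<^sup>*"

text \<open>The claim covers every spin configuration \<open>ys\<close> over the same sites, because
  conjugating a transposition along the path passes through other spin configurations.\<close>

lemma exchange_cluster:
  assumes \<Phi>: "\<Phi> \<in> finite_energy N" and \<mu>: "\<mu> \<noteq> 0" and xs: "xs \<in> Mconfigs N" "distinct (map site xs)"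
    and i: "i < N" and uv: "(site (xs ! i), v) \<in> clusters (occ xs)"
  shows "\<forall>j<N. site (xs ! j) = v \<longrightarrow> (\<forall>ys\<in>Mconfigs N. map fst ys = map fst xs \<longrightarrow> \<Phi> (swap_spin i j ys) = \<Phi> ys)"
  using uv unfolding clusters_def
proof (induction rule: rtrancl_induct)
  case base
  have "j = i" if "j < N" "site (xs ! j) = site (xs ! i)" for j
    using that i xs Mconfigs_length[OF xs(1)] by (auto simp: distinct_conv_nth)
  then show ?case using i Mconfigs_length by (metis swap_same)
next
  case (step u v)
  have len: "length xs = N" using xs Mconfigs_length by blast
  obtain k where k: "k < N" "u = site (xs ! k)" using step(2) len by (auto simp: occ_nth)
  have uE: "(u, v) \<in> symE B" using step(2) by blast
  show ?case
  proof (intro allI impI ballI)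
    fix j ys assume j: "j < N" "site (xs ! j) = v" and ys: "ys \<in> Mconfigs N" "map fst ys = map fst xs"
    have same: "site (zs ! l) = site (xs ! l)" if "map fst zs = map fst xs" "l < N" for zs l
      using that len unfolding site_def by (metis length_map nth_map)
    have kj: "k \<noteq> j" using k j uE symE_D by blast
    have nb: "\<Phi> (swap_spin k j zs) = \<Phi> zs" if "zs \<in> Mconfigs N" "map fst zs = map fst xs" for zs
      using exchange_neighbour[OF \<Phi> \<mu> that(1) k(1) j(1)] same[OF that(2)] k j uE by simp
    have lys: "length ys = N" using ys Mconfigs_length by blast
    consider "i = j" | "i = k" | "i \<noteq> j" "i \<noteq> k" by blast
    then show "\<Phi> (swap_spin i j ys) = \<Phi> ys"
    proof cases
      case 1
      then show ?thesis using swap_same[of i ys j] i lys by simp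
    next
      case 2
      then show ?thesis using nb[OF ys] by simp
    next
      case 3
      define zs where "zs = swap_spin i k ys"
      define ws where "ws = swap_spin k j zs"
      have zs: "zs \<in> Mconfigs N" "map fst zs = map fst xs"
        unfolding zs_def using Mconfigs_swap_spin[OF ys(1) i k(1)] map_fst_swap_spin[of i ys k] i k lys ys by auto
      have ws: "ws \<in> Mconfigs N" "map fst ws = map fst xs"
        unfolding ws_def using Mconfigs_swap_spin[OF zs(1) k(1) j(1)] map_fst_swap_spin[of k zs j] k j Mconfigs_length[OF zs(1)] zs by auto
      have "swap_spin i j ys = swap_spin i k ws"
        unfolding ws_def zs_def using swap_spin_chain[of i ys j k] i j k lys kj 3 by auto
      then have "\<Phi> (swap_spin i j ys) = \<Phi> ws" using step.IH k ws by metis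
      also have "\<dots> = \<Phi> zs" unfolding ws_def by (rule nb[OF zs])
      also have "\<dots> = \<Phi> ys" unfolding zs_def using step.IH k ys by metis
      finally show ?thesis .
    qed
  qed
qed

text \<open>The bound is read off the spin configuration of largest amplitude.\<close>

lemma spin_eigenvalue_lower:
  assumes \<Phi>: "\<Phi> \<in> finite_energy N" and \<mu>: "\<mu> \<noteq> 0" and xs: "xs \<in> Mconfigs N" "distinct (map site xs)"
    and nz: "\<Phi> xs \<noteq> 0" and eig: "Stot_sq M B \<Phi> = (\<lambda>x. complex_of_real ev * \<Phi> x)"
  shows "ev \<ge> real N / 2 + (real N)\<^sup>2 / 4 - real (card {p \<in> occ xs \<times> occ xs. p \<notin> clusters (occ xs)})"
proof -
  have len: "length xs = N" using xs Mconfigs_length by blast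
  define S where "S = {ys \<in> Mconfigs N. map fst ys = map fst xs}"
  have "finite S" "xs \<in> S" using finite_Mconfigs xs by (auto simp: S_def)
  obtain ys where ys: "ys \<in> S" "\<And>zs. zs \<in> S \<Longrightarrow> cmod (\<Phi> zs) \<le> cmod (\<Phi> ys)"
    using finite_arg_max[OF \<open>finite S\<close> \<open>xs \<in> S\<close>, of "\<lambda>ys. cmod (\<Phi> ys)"] by blast
  have yM: "ys \<in> Mconfigs N" "map fst ys = map fst xs" using ys by (auto simp: S_def)
  have lys: "length ys = N" using yM Mconfigs_length by blast
  have pos: "cmod (\<Phi> ys) > 0" using ys(2)[OF \<open>xs \<in> S\<close>] nz by (metis less_le_trans zero_less_norm_iff)
  define same where "same i j \<longleftrightarrow> (site (xs ! i), site (xs ! j)) \<in> clusters (occ xs)" for i j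
  define r where "r i j = Re (\<Phi> (swap_spin i j ys) / \<Phi> ys)" for i j
  \<comment> \<open>Within a cluster the amplitudes agree and the ratio is 1; across clusters the
    maximality at \<open>ys\<close> still gives at least -1.\<close>
  have r: "r i j \<ge> 1 - 2 * (if same i j then 0 else 1)" if "i < N" "j < N" for i j
  proof (cases "same i j")
    case True
    then have "\<Phi> (swap_spin i j ys) = \<Phi> ys"
      using exchange_cluster[OF \<Phi> \<mu> xs that(1)] that yM unfolding same_def by blast
    then show ?thesis using pos True by (simp add: r_def)
  next
    case False
    have "swap_spin i j ys \<in> S"
      using Mconfigs_swap_spin[OF yM(1) that] map_fst_swap_spin[of i ys j] that lys yM by (auto simp: S_def)
    then have "cmod (\<Phi> (swap_spin i j ys) / \<Phi> ys) \<le> 1" using ys(2) pos by (simp add: norm_divide)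
    then have "r i j \<ge> -1" unfolding r_def using abs_Re_le_cmod[of "\<Phi> (swap_spin i j ys) / \<Phi> ys"] by linarith
    then show ?thesis using False by simp
  qed
  have "complex_of_real ev * \<Phi> ys = exchange N \<Phi> ys"
    using Stot_sq_exchange[of ys N \<Phi>] eig yM Mconfigs_configs by (metis subsetD)
  then have "complex_of_real ev = exchange N \<Phi> ys / \<Phi> ys" using pos by (simp add: field_simps)
  also have "\<dots> = of_real (real N - (real N)\<^sup>2 / 4) + 1 / 2 * (\<Sum>i<N. \<Sum>j\<in>{..<N} - {i}. \<Phi> (swap_spin i j ys) / \<Phi> ys)"
    unfolding exchange_def using pos by (simp add: add_divide_distrib sum_divide_distrib mult.commute)
  finally have "Re (complex_of_real ev) = Re (of_real (real N - (real N)\<^sup>2 / 4) + 1 / 2 * (\<Sum>i<N. \<Sum>j\<in>{..<N} - {i}. \<Phi> (swap_spin i j ys) / \<Phi> ys))"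
    by (rule arg_cong)
  then have lam: "ev = real N - (real N)\<^sup>2 / 4 + 1 / 2 * (\<Sum>i<N. \<Sum>j\<in>{..<N} - {i}. r i j)"
    by (simp add: r_def Re_divide_numeral)
  have "(\<Sum>i<N. \<Sum>j\<in>{..<N} - {i}. r i j) \<ge> (\<Sum>i<N. \<Sum>j\<in>{..<N} - {i}. 1 - 2 * (if same i j then 0 else 1))"
    by (intro sum_mono r) auto
  also have "(\<Sum>i<N. \<Sum>j\<in>{..<N} - {i}. 1 - 2 * (if same i j then 0 else (1::real)))
    = real N * (real N - 1) - 2 * (\<Sum>i<N. \<Sum>j\<in>{..<N} - {i}. if same i j then 0 else 1)"
    by (cases "N = 0") (auto simp: sum_subtractf sum_distrib_left of_nat_diff)
  also have "(\<Sum>i<N. \<Sum>j\<in>{..<N} - {i}. if same i j then 0 else (1::real)) = (\<Sum>i<N. \<Sum>j<N. if same i j then 0 else 1)"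
    by (intro sum.cong refl sum.mono_neutral_left) (auto simp: same_def clusters_def)
  also have "\<dots> = (\<Sum>p\<in>{..<N} \<times> {..<N}. if same (fst p) (snd p) then 0 else 1)"
    by (simp add: sum.cartesian_product case_prod_beta)
  also have "\<dots> = (\<Sum>p\<in>{p\<in>{..<N} \<times> {..<N}. \<not> same (fst p) (snd p)}. 1)"
    by (rule sum.mono_neutral_cong_right) auto
  also have "\<dots> = real (card {p\<in>{..<N} \<times> {..<N}. \<not> same (fst p) (snd p)})" by simp
  also have "card {p\<in>{..<N} \<times> {..<N}. \<not> same (fst p) (snd p)} = card {p \<in> occ xs \<times> occ xs. p \<notin> clusters (occ xs)}"
  proof (rule bij_betw_same_card[of "map_prod (\<lambda>i. site (xs ! i)) (\<lambda>i. site (xs ! i))"])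
    have "inj_on (\<lambda>i. site (xs ! i)) {..<N}" using xs(2) len by (auto simp: inj_on_def distinct_conv_nth)
    then have "inj_on (map_prod (\<lambda>i. site (xs ! i)) (\<lambda>i. site (xs ! i))) ({..<N} \<times> {..<N})"
      by (rule map_prod_inj_on) (use \<open>inj_on (\<lambda>i. site (xs ! i)) {..<N}\<close> in auto)
    then show "bij_betw (map_prod (\<lambda>i. site (xs ! i)) (\<lambda>i. site (xs ! i))) {p\<in>{..<N} \<times> {..<N}. \<not> same (fst p) (snd p)}
       {p \<in> occ xs \<times> occ xs. p \<notin> clusters (occ xs)}"
      unfolding bij_betw_def occ_nth len
      by (auto simp: same_def inj_on_def image_iff occ_nth len)
  qed
  finally show ?thesis unfolding lam by (simp add: power2_eq_square field_simps)
qed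

end

section \<open>Splitting off a large part\<close>

text \<open>A largest closed set \<open>W\<close> with at most half the elements is taken. If it has
  less than a quarter of them, no further class fits, so every class outside it exceeds a quarter.
  Such a class \<open>C\<close> then serves: pairs in different classes number at most |A|^2 -
  |C|^2, which keeps its complement large.\<close>

lemma cluster_partition:
  fixes R :: "('a \<times> 'a) set" and a :: real
  assumes fin: "finite A" and R: "refl R" "sym R" "trans R"
    and a: "0 \<le> a" "a \<le> 1"
    and diff: "real (card {p \<in> A \<times> A. p \<notin> R}) \<ge> a * (real (card A))\<^sup>2"
  shows "\<exists>W\<subseteq>A. (\<forall>x\<in>W. \<forall>y\<in>A. (x, y) \<in> R \<longrightarrow> y \<in> W) \<and>
    real (card W) \<ge> a / 4 * real (card A) \<and> real (card (A - W)) \<ge> a / 4 * real (card A)"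
proof -
  let ?n = "real (card A)"
  define closed where "closed W \<longleftrightarrow> W \<subseteq> A \<and> (\<forall>x\<in>W. \<forall>y\<in>A. (x, y) \<in> R \<longrightarrow> y \<in> W)" for W
  have cdiff: "real (card (A - W)) = ?n - real (card W)" if "W \<subseteq> A" for W
    using that fin card_mono[OF fin that] by (simp add: card_Diff_subset finite_subset of_nat_diff)
  have cl: "closed {y \<in> A. (x, y) \<in> R}" for x
    using R unfolding closed_def by (auto dest: transD)
  define F where "F = {W. closed W \<and> 2 * real (card W) \<le> ?n}"
  have finF: "finite F" by (rule finite_subset[of _ "Pow A"]) (auto simp: F_def closed_def fin)
  have "{} \<in> F" by (simp add: F_def closed_def)
  then obtain W where W: "W \<in> F" "\<And>W'. W' \<in> F \<Longrightarrow> card W' \<le> card W"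
    using finite_arg_max[OF finF, of "{}" card] by blast
  have Wc: "closed W" "W \<subseteq> A" "2 * real (card W) \<le> ?n" using W by (auto simp: F_def closed_def)
  show ?thesis
  proof (cases "4 * real (card W) \<ge> ?n")
    case True
    have "a / 4 * ?n \<le> 1 / 4 * ?n" by (rule mult_right_mono) (use a in auto)
    then show ?thesis using True Wc cdiff[OF Wc(2)] unfolding closed_def by (intro exI[of _ W]) auto
  next
    case False
    have "W \<noteq> A" using False by auto
    then obtain x where x: "x \<in> A" "x \<notin> W" using Wc by auto
    have big: "4 * real (card {y \<in> A. (x, y) \<in> R}) > ?n" if x: "x \<in> A" "x \<notin> W" for x
    proof (rule ccontr)
      let ?C = "{y \<in> A. (x, y) \<in> R}"
      assume c: "\<not> ?thesis"
      have "finite W" "finite ?C" using Wc(2) fin finite_subset by auto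
      have "x \<in> ?C" using x R by (auto simp: refl_on_def)
      have cu: "card (W \<union> ?C) \<le> card W + card ?C" by (rule card_Un_le)
      have "closed (W \<union> ?C)" using Wc(1) cl[of x] unfolding closed_def by blast
      moreover have "2 * real (card (W \<union> ?C)) \<le> ?n" using c cu False by linarith
      ultimately have "card (W \<union> ?C) \<le> card W" using W(2) by (auto simp: F_def)
      moreover have "card W < card (W \<union> ?C)"
        using \<open>x \<in> ?C\<close> x \<open>finite W\<close> \<open>finite ?C\<close> by (intro psubset_card_mono) auto
      ultimately show False by simp
    qed
    define C where "C = {y \<in> A. (x, y) \<in> R}"
    have C: "C \<subseteq> A" "closed C" "4 * real (card C) > ?n" using cl big[OF x] by (auto simp: C_def)
    have "finite C" using C fin finite_subset by blast
    have "{p \<in> A \<times> A. p \<notin> R} \<subseteq> A \<times> A - C \<times> C"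
      using R unfolding C_def by (auto dest: transD symD)
    then have "card {p \<in> A \<times> A. p \<notin> R} \<le> card (A \<times> A - C \<times> C)" using fin by (intro card_mono) auto
    also have "\<dots> = card A * card A - card C * card C"
      using C fin \<open>finite C\<close> by (subst card_Diff_subset) (auto simp: card_cartesian_product)
    finally have "card {p \<in> A \<times> A. p \<notin> R} \<le> card A * card A - card C * card C" .
    then have "real (card {p \<in> A \<times> A. p \<notin> R}) \<le> ?n * ?n - real (card C) * real (card C)"
    proof -
      assume "card {p \<in> A \<times> A. p \<notin> R} \<le> card A * card A - card C * card C"
      moreover have "card C * card C \<le> card A * card A" using card_mono[OF fin C(1)] by (intro mult_mono) auto
      ultimately have "card {p \<in> A \<times> A. p \<notin> R} + card C * card C \<le> card A * card A" by linarith
      then have "real (card {p \<in> A \<times> A. p \<notin> R} + card C * card C) \<le> real (card A * card A)" by (simp only: of_nat_le_iff)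
      then show ?thesis by simp
    qed
    then have "a * ?n\<^sup>2 \<le> (?n - real (card C)) * (?n + real (card C))" using diff by (simp add: algebra_simps power2_eq_square)
    also have "\<dots> \<le> (?n - real (card C)) * (2 * ?n)"
      using card_mono[OF fin C(1)] by (intro mult_left_mono) auto
    finally have "(a / 2 * ?n) * ?n \<le> (?n - real (card C)) * ?n" by (simp add: power2_eq_square algebra_simps)
    moreover have "?n > 0" using x fin by (auto simp: card_gt_0_iff)
    ultimately have "a / 2 * ?n \<le> ?n - real (card C)" by (rule mult_right_le_imp_le)
    moreover have "a / 4 * ?n \<le> a / 2 * ?n" by (rule mult_right_mono) (use a in auto)
    ultimately have l1: "a / 4 * ?n \<le> real (card (A - C))" using cdiff[OF C(1)] by linarith
    have "a / 4 * ?n \<le> 1 / 4 * ?n" by (rule mult_right_mono) (use a in auto)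
    then have l2: "a / 4 * ?n \<le> real (card C)" using C(3) by linarith
    show ?thesis using C(1,2) l1 l2 unfolding closed_def by (intro exI[of _ C]) auto
  qed
qed

context bond_lattice
begin

lemma clusters_equiv: "refl (clusters A)" "sym (clusters A)" "trans (clusters A)"
  unfolding clusters_def
  by (auto simp: refl_rtrancl trans_rtrancl intro!: sym_rtrancl) (auto simp: sym_def symE_sym)

text \<open>A hole all of whose neighbours are occupied sees only one part, because its neighbourhood is
  connected.\<close>

lemma separator:
  assumes nb: "\<And>x0 y z. x0 \<in> M \<Longrightarrow> y \<in> nbrs B x0 \<Longrightarrow> z \<in> nbrs B x0 \<Longrightarrow> (y, z) \<in> (symE B \<inter> (nbrs B x0 \<times> nbrs B x0))\<^sup>*"
    and A: "A \<subseteq> M" "W \<subseteq> A"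
    and W: "\<And>x y. x \<in> W \<Longrightarrow> y \<in> A \<Longrightarrow> (x, y) \<in> clusters A \<Longrightarrow> y \<in> W"
  obtains W' V' H where "W \<subseteq> W'" "A - W \<subseteq> V'" "W' \<union> V' \<union> H = M" "W' \<inter> V' = {}" "W' \<inter> H = {}" "V' \<inter> H = {}"
    "\<forall>x\<in>W'. \<forall>y\<in>V'. (x, y) \<notin> symE B" "card H \<le> hole_pairs A"
proof -
  \<comment> \<open>The wall \<open>H\<close> consists of the holes with a neighbouring hole. Any
    other hole joins \<open>W\<close> if it sees \<open>W\<close>, and the rest otherwise.\<close>
  define H where "H = {h \<in> M - A. nbrs B h \<inter> (M - A) \<noteq> {}}"
  define I where "I = {h \<in> M - A. nbrs B h \<inter> (M - A) = {}}"
  define W' where "W' = W \<union> {h \<in> I. nbrs B h \<inter> W \<noteq> {}}"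
  define V' where "V' = (A - W) \<union> {h \<in> I. nbrs B h \<inter> W = {}}"
  have WW: "y \<in> W" if "x \<in> W" "y \<in> A" "(x, y) \<in> symE B" for x y
    using that A W[of x y] unfolding clusters_def by blast
  have noE: "(x, y) \<notin> symE B" if xy: "x \<in> W'" "y \<in> V'" for x y
  proof
    assume e: "(x, y) \<in> symE B"
    then have m: "x \<in> M" "y \<in> M" "(y, x) \<in> symE B" using symE_D symE_sym by blast+
    consider "x \<in> W" "y \<in> A - W" | "x \<in> W" "y \<in> I" "nbrs B y \<inter> W = {}" | "x \<in> I" "nbrs B x \<inter> W \<noteq> {}"
      using xy unfolding W'_def V'_def by blast
    then show False
    proof cases
      case 1
      then show False using WW e by blast
    next
      case 2
      then show False using m by (auto simp: nbrs_def)
    next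
      case 3
      then obtain w where w: "w \<in> nbrs B x" "w \<in> W" by blast
      have nA: "nbrs B x \<subseteq> A" using 3 nbrs_subset[of x] by (auto simp: I_def)
      have yn: "y \<in> nbrs B x" using e by (simp add: nbrs_def)
      have "(w, y) \<in> (symE B \<inter> (nbrs B x \<times> nbrs B x))\<^sup>*" using nb[OF m(1) w(1) yn] .
      moreover have "symE B \<inter> (nbrs B x \<times> nbrs B x) \<subseteq> symE B \<inter> A \<times> A" using nA by auto
      ultimately have "(w, y) \<in> clusters A" unfolding clusters_def using rtrancl_mono by blast
      then have "y \<in> W" using W w(2) nA yn by blast
      then show False using xy(2) A(2) by (auto simp: V'_def I_def)
    qed
  qed
  have "H \<subseteq> fst ` (symE B \<inter> (M - A) \<times> (M - A))"
  proof
    fix h assume "h \<in> H"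
    then obtain y where "y \<in> nbrs B h" "y \<in> M - A" "h \<in> M - A" by (auto simp: H_def)
    then have "(h, y) \<in> symE B \<inter> (M - A) \<times> (M - A)" by (simp add: nbrs_def)
    then show "h \<in> fst ` (symE B \<inter> (M - A) \<times> (M - A))" by force
  qed
  then have "card H \<le> card (fst ` (symE B \<inter> (M - A) \<times> (M - A)))"
    by (intro card_mono) (auto simp: finite_symE)
  also have "\<dots> \<le> hole_pairs A" unfolding hole_pairs_def by (intro card_image_le) (simp add: finite_symE)
  finally have 8: "card H \<le> hole_pairs A" .
  have 7: "\<forall>x\<in>W'. \<forall>y\<in>V'. (x, y) \<notin> symE B" using noE by blast
  have 1: "W \<subseteq> W'" "A - W \<subseteq> V'" by (auto simp: W'_def V'_def)
  have 3: "W' \<union> V' \<union> H = M" "W' \<inter> V' = {}" "W' \<inter> H = {}" "V' \<inter> H = {}"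
    using A by (auto simp: W'_def V'_def H_def I_def)
  show ?thesis by (rule that[OF 1 3 7 8])
qed

end

section \<open>Slater determinants\<close>

lemma sum_lists_prod:
  fixes F :: "nat \<Rightarrow> 'm \<Rightarrow> real"
  assumes "finite Md"
  shows "(\<Sum>xs\<in>{xs. length xs = N \<and> set xs \<subseteq> Md}. \<Prod>i<N. F i (xs ! i)) = (\<Prod>i<N. \<Sum>m\<in>Md. F i m)"
proof (induction N arbitrary: F)
  case 0
  have "{xs. xs = [] \<and> set xs \<subseteq> Md} = {[]}" by auto
  then show ?case by simp
next
  case (Suc N)
  let ?L = "\<lambda>N. {xs. length xs = N \<and> set xs \<subseteq> Md}"
  have "(\<Sum>xs\<in>?L (Suc N). \<Prod>i<Suc N. F i (xs ! i)) = (\<Sum>(m,ys)\<in>Md \<times> ?L N. F 0 m * (\<Prod>i<N. F (Suc i) (ys ! i)))"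
    by (rule sum.reindex_bij_witness[of _ "\<lambda>(m,ys). m # ys" "\<lambda>xs. (hd xs, tl xs)"])
      (auto simp: length_Suc_conv prod.lessThan_Suc_shift simp del: prod.lessThan_Suc)
  also have "\<dots> = (\<Sum>m\<in>Md. \<Sum>ys\<in>?L N. F 0 m * (\<Prod>i<N. F (Suc i) (ys ! i)))"
    by (rule sum.cartesian_product[symmetric])
  also have "\<dots> = (\<Sum>m\<in>Md. F 0 m) * (\<Prod>i<N. \<Sum>m\<in>Md. F (Suc i) m)"
    using Suc.IH[of "\<lambda>i. F (Suc i)"] by (simp add: sum_distrib_left[symmetric] sum_distrib_right)
  finally show ?case by (simp add: prod.lessThan_Suc_shift del: prod.lessThan_Suc)
qed

text \<open>Leibniz expansion of the determinant with entries \<open>\<phi> j (xs ! i)\<close>,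
  without the factor 1 / sqrt (N!).\<close>

definition slater :: "nat \<Rightarrow> (nat \<Rightarrow> 'm \<Rightarrow> real) \<Rightarrow> 'm list \<Rightarrow> real" where
  "slater N \<phi> xs = (\<Sum>\<pi>\<in>{\<pi>. \<pi> permutes {..<N}}. of_int (sign \<pi>) * (\<Prod>i<N. \<phi> (\<pi> i) (xs ! i)))"

lemma slater_antisym:
  assumes "i < N" "j < N" "i \<noteq> j" "length xs = N"
  shows "slater N \<phi> (xs[i := xs ! j, j := xs ! i]) = - slater N \<phi> xs"
proof -
  let ?t = "transpose i j"
  have tp: "?t permutes {..<N}" using assms by (intro permutes_swap_id) auto
  have nth: "xs[i := xs ! j, j := xs ! i] ! k = xs ! ?t k" if "k < N" for k
    using that assms by (auto simp: transpose_def nth_list_update)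
  have "slater N \<phi> (xs[i := xs ! j, j := xs ! i])
     = (\<Sum>\<pi>\<in>{\<pi>. \<pi> permutes {..<N}}. of_int (sign \<pi>) * (\<Prod>k<N. \<phi> (\<pi> k) (xs ! ?t k)))"
    unfolding slater_def using nth by simp
  also have "\<dots> = (\<Sum>\<pi>\<in>{\<pi>. \<pi> permutes {..<N}}. of_int (sign \<pi>) * (\<Prod>k<N. \<phi> ((\<pi> \<circ> ?t) k) (xs ! k)))"
  proof (intro sum.cong refl arg_cong2[of _ _ _ _ "(*)"])
    fix \<pi>
    show "(\<Prod>k<N. \<phi> (\<pi> k) (xs ! ?t k)) = (\<Prod>k<N. \<phi> ((\<pi> \<circ> ?t) k) (xs ! k))"
      by (rule prod.reindex_bij_witness[of _ ?t ?t]) (use assms in \<open>auto simp: transpose_less\<close>)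
  qed
  also have "\<dots> = (\<Sum>\<pi>\<in>{\<pi>. \<pi> permutes {..<N}}. of_int (sign (\<pi> \<circ> ?t)) * (\<Prod>k<N. \<phi> (\<pi> k) (xs ! k)))"
  proof (rule sum.reindex_bij_witness[of _ "\<lambda>\<pi>. \<pi> \<circ> ?t" "\<lambda>\<pi>. \<pi> \<circ> ?t"])
    fix \<pi> assume "\<pi> \<in> {\<pi>. \<pi> permutes {..<N}}"
    then show "\<pi> \<circ> ?t \<in> {\<pi>. \<pi> permutes {..<N}}" using permutes_compose[OF tp] by blast
    then show "\<pi> \<circ> ?t \<in> {\<pi>. \<pi> permutes {..<N}}" .
  qed (auto simp: o_assoc[symmetric])
  also have "\<dots> = (\<Sum>\<pi>\<in>{\<pi>. \<pi> permutes {..<N}}. - (of_int (sign \<pi>) * (\<Prod>k<N. \<phi> (\<pi> k) (xs ! k))))"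
  proof (intro sum.cong refl)
    fix \<pi> assume "\<pi> \<in> {\<pi>. \<pi> permutes {..<N}}"
    then have "permutation \<pi>" using permutes_imp_permutation[of "{..<N}" \<pi>] by simp
    then have "sign (\<pi> \<circ> ?t) = - sign \<pi>"
      using assms(3) by (simp add: sign_compose permutation_swap_id sign_swap_id)
    then show "of_int (sign (\<pi> \<circ> ?t)) * (\<Prod>k<N. \<phi> (\<pi> k) (xs ! k)) = - (of_int (sign \<pi>) * (\<Prod>k<N. \<phi> (\<pi> k) (xs ! k)))"
      by simp
  qed
  finally show ?thesis by (simp add: slater_def sum_negf)
qed

text \<open>The double sum over permutations factors into pairings of single orbitals. Every
  coordinate except k forces the two permutations to agree there, hence they also agree at k, and
  only diagonal terms remain.\<close>

lemma slater_one_body: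
  fixes h :: "'m \<Rightarrow> 'm \<Rightarrow> real"
  assumes fin: "finite Md" and on: "orthonormal Md N \<phi>"
  shows "(\<Sum>xs\<in>{xs. length xs = N \<and> set xs \<subseteq> Md}. slater N \<phi> xs * (\<Sum>k<N. \<Sum>m\<in>Md. h (xs ! k) m * slater N \<phi> (xs[k := m])))
    = fact N * (\<Sum>k<N. \<Sum>m'\<in>Md. \<Sum>m\<in>Md. \<phi> k m' * (h m' m * \<phi> k m))"
proof -
  let ?L = "{xs. length xs = N \<and> set xs \<subseteq> Md}"
  let ?P = "{\<pi>. \<pi> permutes {..<N}}"
  have finP: "finite ?P" by (rule finite_permutations) simp
  define Q where "Q a b = (\<Sum>m'\<in>Md. \<phi> a m' * (\<Sum>m\<in>Md. h m' m * \<phi> b m))" for a b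
  define s where "s \<pi> = (of_int (sign \<pi>) :: real)" for \<pi> :: "nat \<Rightarrow> nat"
  define G where "G \<pi> \<pi>' k i x = \<phi> (\<pi> i) x * (if i = k then \<Sum>m\<in>Md. h x m * \<phi> (\<pi>' k) m else \<phi> (\<pi>' i) x)"
    for \<pi> \<pi>' :: "nat \<Rightarrow> nat" and k i x
  have upd: "(\<Sum>m\<in>Md. h (xs ! k) m * (\<Prod>i<N. \<phi> (\<pi>' i) (xs[k := m] ! i)))
      = (\<Prod>i<N. if i = k then \<Sum>m\<in>Md. h (xs ! i) m * \<phi> (\<pi>' k) m else \<phi> (\<pi>' i) (xs ! i))"
    if "k < N" "length xs = N" for k xs \<pi>'
  proof -
    have 1: "(\<Prod>i<N. \<phi> (\<pi>' i) (xs[k := m] ! i)) = \<phi> (\<pi>' k) m * (\<Prod>i\<in>{..<N} - {k}. \<phi> (\<pi>' i) (xs ! i))" for m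
      using that by (subst prod.remove[of _ k]) (auto intro!: prod.cong)
    have 2: "(\<Prod>i<N. if i = k then \<Sum>m\<in>Md. h (xs ! i) m * \<phi> (\<pi>' k) m else \<phi> (\<pi>' i) (xs ! i))
       = (\<Sum>m\<in>Md. h (xs ! k) m * \<phi> (\<pi>' k) m) * (\<Prod>i\<in>{..<N} - {k}. \<phi> (\<pi>' i) (xs ! i))"
      using that by (subst prod.remove[of _ k]) (auto intro!: prod.cong)
    show ?thesis unfolding 1 2 by (simp add: sum_distrib_right mult.assoc)
  qed
  have "(\<Sum>xs\<in>?L. slater N \<phi> xs * (\<Sum>k<N. \<Sum>m\<in>Md. h (xs ! k) m * slater N \<phi> (xs[k := m])))
    = (\<Sum>xs\<in>?L. \<Sum>k<N. \<Sum>\<pi>\<in>?P. \<Sum>\<pi>'\<in>?P. s \<pi> * s \<pi>' * (\<Prod>i<N. G \<pi> \<pi>' k i (xs ! i)))"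
  proof (intro sum.cong refl)
    fix xs assume xs: "xs \<in> ?L"
    have "slater N \<phi> xs * (\<Sum>m\<in>Md. h (xs ! k) m * slater N \<phi> (xs[k := m]))
      = (\<Sum>\<pi>\<in>?P. \<Sum>\<pi>'\<in>?P. s \<pi> * s \<pi>' * (\<Prod>i<N. G \<pi> \<pi>' k i (xs ! i)))" if k: "k < N" for k
    proof -
      have "(\<Sum>m\<in>Md. h (xs ! k) m * slater N \<phi> (xs[k := m])) = (\<Sum>m\<in>Md. \<Sum>\<pi>'\<in>?P. s \<pi>' * (h (xs ! k) m * (\<Prod>i<N. \<phi> (\<pi>' i) (xs[k := m] ! i))))"
        unfolding slater_def s_def by (simp add: sum_distrib_left mult_ac)
      also have "\<dots> = (\<Sum>\<pi>'\<in>?P. s \<pi>' * (\<Sum>m\<in>Md. h (xs ! k) m * (\<Prod>i<N. \<phi> (\<pi>' i) (xs[k := m] ! i))))"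
        by (subst sum.swap) (simp add: sum_distrib_left)
      also have "\<dots> = (\<Sum>\<pi>'\<in>?P. s \<pi>' * (\<Prod>i<N. if i = k then \<Sum>m\<in>Md. h (xs ! i) m * \<phi> (\<pi>' k) m else \<phi> (\<pi>' i) (xs ! i)))"
        using upd k xs by simp
      finally have r: "(\<Sum>m\<in>Md. h (xs ! k) m * slater N \<phi> (xs[k := m])) = \<dots>" .
      show ?thesis unfolding r
        unfolding slater_def s_def[symmetric] sum_product G_def prod.distrib
        by (simp add: mult_ac)
    qed
    then show "slater N \<phi> xs * (\<Sum>k<N. \<Sum>m\<in>Md. h (xs ! k) m * slater N \<phi> (xs[k := m]))
      = (\<Sum>k<N. \<Sum>\<pi>\<in>?P. \<Sum>\<pi>'\<in>?P. s \<pi> * s \<pi>' * (\<Prod>i<N. G \<pi> \<pi>' k i (xs ! i)))"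
      unfolding sum_distrib_left[of "slater N \<phi> xs"] by (intro sum.cong refl) auto
  qed
  also have "\<dots> = (\<Sum>k<N. \<Sum>\<pi>\<in>?P. \<Sum>\<pi>'\<in>?P. \<Sum>xs\<in>?L. s \<pi> * s \<pi>' * (\<Prod>i<N. G \<pi> \<pi>' k i (xs ! i)))"
    by (subst sum.swap, rule sum.cong[OF refl], subst sum.swap, rule sum.cong[OF refl], rule sum.swap)
  also have "\<dots> = (\<Sum>k<N. \<Sum>\<pi>\<in>?P. \<Sum>\<pi>'\<in>?P. if \<pi>' = \<pi> then Q (\<pi> k) (\<pi> k) else 0)"
  proof (intro sum.cong refl)
    fix k \<pi> \<pi>' assume k: "k \<in> {..<N}" and p: "\<pi> \<in> ?P" "\<pi>' \<in> ?P"
    have pl: "\<pi> i < N" "\<pi>' i < N" if "i < N" for i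
      using p that permutes_in_image[of \<pi> "{..<N}" i] permutes_in_image[of \<pi>' "{..<N}" i] by auto
    have g: "(\<Sum>x\<in>Md. G \<pi> \<pi>' k i x) = (if i = k then Q (\<pi> k) (\<pi>' k) else if \<pi> i = \<pi>' i then 1 else 0)" if "i < N" for i
      using on pl[OF that] unfolding orthonormal_def G_def Q_def by auto
    have "(\<Sum>xs\<in>?L. s \<pi> * s \<pi>' * (\<Prod>i<N. G \<pi> \<pi>' k i (xs ! i))) = s \<pi> * s \<pi>' * (\<Prod>i<N. \<Sum>x\<in>Md. G \<pi> \<pi>' k i x)"
      unfolding sum_distrib_left[symmetric] sum_lists_prod[OF fin, where N = N and F = "G \<pi> \<pi>' k"] ..
    also have "\<dots> = s \<pi> * s \<pi>' * (\<Prod>i<N. if i = k then Q (\<pi> k) (\<pi>' k) else if \<pi> i = \<pi>' i then 1 else 0)"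
      using g by simp
    also have "\<dots> = (if \<pi>' = \<pi> then Q (\<pi> k) (\<pi> k) else 0)"
    proof (cases "\<pi>' = \<pi>")
      case True
      have "s \<pi> * s \<pi> = 1" unfolding s_def by (metis of_int_1 of_int_mult sign_idempotent)
      then show ?thesis using True k by (simp add: prod.If_cases)
    next
      case False
      have "\<exists>i<N. i \<noteq> k \<and> \<pi> i \<noteq> \<pi>' i"
      proof (rule ccontr)
        assume "\<not> ?thesis"
        then have ag: "\<pi> i = \<pi>' i" if "i \<noteq> k" for i
          using that p permutes_not_in[of \<pi> "{..<N}" i] permutes_not_in[of \<pi>' "{..<N}" i] by (cases "i < N") auto
        have inj: "inj \<pi>" "inj \<pi>'" using p permutes_inj by auto
        have "\<pi> k = \<pi>' k"
        proof -
          obtain l where l: "\<pi> l = \<pi>' k" using p permutes_surj[of \<pi>] by (metis mem_Collect_eq surjD)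
          then have "l = k" using ag[of l] inj(2) by (metis injD)
          then show ?thesis using l by simp
        qed
        then show False using ag False by (metis ext)
      qed
      then show ?thesis using False by (auto intro!: prod_zero)
    qed
    finally show "(\<Sum>xs\<in>?L. s \<pi> * s \<pi>' * (\<Prod>i<N. G \<pi> \<pi>' k i (xs ! i))) = (if \<pi>' = \<pi> then Q (\<pi> k) (\<pi> k) else 0)" .
  qed
  also have "\<dots> = (\<Sum>k<N. \<Sum>\<pi>\<in>?P. Q (\<pi> k) (\<pi> k))" using finP by simp
  also have "\<dots> = (\<Sum>\<pi>\<in>?P. \<Sum>k<N. Q (\<pi> k) (\<pi> k))" by (rule sum.swap)
  also have "\<dots> = (\<Sum>\<pi>\<in>?P. \<Sum>k<N. Q k k)"
  proof (rule sum.cong[OF refl])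
    fix \<pi> assume "\<pi> \<in> ?P"
    then have "bij_betw \<pi> {..<N} {..<N}" using permutes_imp_bij by blast
    then show "(\<Sum>k<N. Q (\<pi> k) (\<pi> k)) = (\<Sum>k<N. Q k k)" by (rule sum.reindex_bij_betw)
  qed
  also have "\<dots> = fact N * (\<Sum>k<N. Q k k)" using card_permutations[of "{..<N}" N] by simp
  finally show ?thesis unfolding Q_def by (simp add: sum_distrib_left)
qed

text \<open>The identity as a one-body operator multiplies by N, so its expectation yields the norm;
  N = 0 has to be computed directly.\<close>

lemma slater_norm:
  assumes fin: "finite Md" and on: "orthonormal Md N \<phi>"
  shows "(\<Sum>xs\<in>{xs. length xs = N \<and> set xs \<subseteq> Md}. (slater N \<phi> xs)\<^sup>2) = fact N"
proof (cases "N = 0")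
  case True
  have "{xs. xs = [] \<and> set xs \<subseteq> Md} = {[]}" by auto
  then show ?thesis using True by (simp add: slater_def)
next
  case False
  let ?L = "{xs. length xs = N \<and> set xs \<subseteq> Md}"
  let ?h = "\<lambda>x m. if m = x then 1 else 0 :: real"
  have "(\<Sum>m\<in>Md. ?h (xs ! k) m * slater N \<phi> (xs[k := m])) = slater N \<phi> xs" if "xs \<in> ?L" "k < N" for xs k
  proof -
    have "xs ! k \<in> Md" using that by auto
    then show ?thesis using fin by (simp add: if_distrib[of "\<lambda>t. t * _"] cong: if_cong)
  qed
  then have "(\<Sum>xs\<in>?L. slater N \<phi> xs * (\<Sum>k<N. \<Sum>m\<in>Md. ?h (xs ! k) m * slater N \<phi> (xs[k := m])))
    = (\<Sum>xs\<in>?L. slater N \<phi> xs * (\<Sum>k<N. slater N \<phi> xs))"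
    by (intro sum.cong refl arg_cong2[of _ _ _ _ "(*)"]) auto
  also have "\<dots> = real N * (\<Sum>xs\<in>?L. (slater N \<phi> xs)\<^sup>2)"
    by (simp add: sum_distrib_left power2_eq_square mult_ac)
  also have "(\<Sum>xs\<in>?L. slater N \<phi> xs * (\<Sum>k<N. \<Sum>m\<in>Md. ?h (xs ! k) m * slater N \<phi> (xs[k := m]))) = fact N * (\<Sum>k<N. \<Sum>m'\<in>Md. \<Sum>m\<in>Md. \<phi> k m' * (?h m' m * \<phi> k m))"
    by (rule slater_one_body[OF fin on, where h = ?h])
  also have "\<dots> = fact N * (\<Sum>k<N. \<Sum>m'\<in>Md. \<phi> k m' * \<phi> k m')"
    using fin by (simp add: if_distrib[of "\<lambda>t. t * _"] if_distrib[of "\<lambda>t. _ * t"] cong: if_cong)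
  also have "\<dots> = fact N * real N" using on by (simp add: orthonormal_def)
  finally show ?thesis using False by simp
qed

section \<open>Polarised trial states: filling the complement of the hole orbitals\<close>

context bond_lattice
begin

lemma orbital_lift:
  fixes f :: "'a \<Rightarrow> real"
  defines "F \<equiv> \<lambda>z. complex_of_real (\<Sum>x\<in>M. f x * acoef B \<mu> x z)"
  shows "lext F" and "y \<in> M \<Longrightarrow> F (LM y) = of_real (f y / sqrt cc)"
proof -
  show "lext F" unfolding F_def of_real_sum of_real_mult by (intro lext_sum lext_scale acoef_lext)
  assume y: "y \<in> M"
  have "(\<Sum>x\<in>M. f x * acoef B \<mu> x (LM y)) = (\<Sum>x\<in>M. if x = y then f y / sqrt cc else 0)"
    by (intro sum.cong refl) (auto simp: acoef_LM)
  then show "F (LM y) = of_real (f y / sqrt cc)" unfolding F_def using y finite_M by simp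
qed

text \<open>With all spins up no site is doubly occupied, and orbitals built from
  \<open>acoef\<close> are orthogonal to the b-orbitals, so only the hopping energy remains. The
  lift multiplies values on M by 1 / \<open>sqrt cc\<close>, which keeps the family
  orthonormal.\<close>

lemma slater_state:
  assumes on: "orthonormal M N \<phi>"
  shows "\<exists>\<Psi>. in_space M B N \<Psi> \<and> normalized M B N \<Psi> \<and>
    lim_energy M B N t \<mu> \<Psi> = ereal (t * (\<Sum>k<N. \<Sum>(x,y)\<in>symE B. \<phi> k x * \<phi> k y))"
proof -
  define g where "g k z = (\<Sum>x\<in>M. \<phi> k x * acoef B \<mu> x z)" for k z
  define \<psi> where "\<psi> k m = (if snd m then g k (fst m) else 0)" for k and m :: "'a mode"
  have gl: "lext (\<lambda>z. of_real (g k z))" and gv: "y \<in> M \<Longrightarrow> complex_of_real (g k (LM y)) = of_real (\<phi> k y / sqrt cc)" for k y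
    unfolding g_def using orbital_lift by auto
  have ga: "(\<Sum>z\<in>Lam M B. of_real (acoef B \<mu> x z) * complex_of_real (g k z)) = of_real (\<phi> k x)" if "x \<in> M" for x k
  proof -
    have "(\<Sum>z\<in>Lam M B. of_real (acoef B \<mu> x z) * complex_of_real (g k z)) = of_real (sqrt cc) * of_real (g k (LM x))"
      by (rule acoef_inner[OF that gl])
    also have "\<dots> = of_real (sqrt cc * (\<phi> k x / sqrt cc))" by (simp only: gv[OF that] of_real_mult)
    also have "sqrt cc * (\<phi> k x / sqrt cc) = \<phi> k x" using cc_pos by simp
    finally show ?thesis .
  qed
  have on': "orthonormal (modes M B) N \<psi>"
    unfolding orthonormal_def
  proof (intro allI impI)
    fix i j assume ij: "i < N" "j < N"
    have "complex_of_real (\<Sum>m\<in>modes M B. \<psi> i m * \<psi> j m) = (\<Sum>z\<in>Lam M B. complex_of_real (g i z) * complex_of_real (g j z))"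
      by (simp add: sum_modes UNIV_bool \<psi>_def)
    also have "\<dots> = of_real cc * (\<Sum>x\<in>M. complex_of_real (g i (LM x)) * complex_of_real (g j (LM x)))"
      by (rule lext_inner[OF gl gl])
    also have "\<dots> = of_real cc * (\<Sum>x\<in>M. complex_of_real (\<phi> i x * \<phi> j x / cc))"
      using cc_pos by (intro arg_cong2[of _ _ _ _ "(*)"] sum.cong refl) (auto simp: gv simp flip: of_real_mult)
    also have "\<dots> = complex_of_real (\<Sum>x\<in>M. \<phi> i x * \<phi> j x)"
      using cc_pos by (simp add: sum_divide_distrib[symmetric] del: of_real_divide flip: of_real_sum of_real_mult)
    finally have "(\<Sum>m\<in>modes M B. \<psi> i m * \<psi> j m) = (\<Sum>x\<in>M. \<phi> i x * \<phi> j x)" using of_real_eq_iff by blast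
    then show "(\<Sum>m\<in>modes M B. \<psi> i m * \<psi> j m) = (if i = j then 1 else 0)"
      using on ij by (simp add: orthonormal_def)
  qed
  define c where "c = 1 / sqrt (fact N)"
  have c2: "c * c = 1 / fact N" by (simp add: c_def)
  define \<Psi> where "\<Psi> xs = (if xs \<in> configs M B N then complex_of_real (c * slater N \<psi> xs) else 0)" for xs
  have cf: "configs M B N = {xs. length xs = N \<and> set xs \<subseteq> modes M B}" by (simp add: configs_def)
  have sp: "in_space M B N \<Psi>"
    unfolding in_space_def
  proof (intro conjI allI impI)
    fix xs :: "'a mode list" and i j assume ij: "i < length xs" "j < length xs" "i \<noteq> j"
    have "xs[i := xs ! j, j := xs ! i] \<in> configs M B N \<longleftrightarrow> xs \<in> configs M B N"
      using ij by (simp add: configs_def)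
    then show "\<Psi> (xs[i := xs ! j, j := xs ! i]) = - \<Psi> xs"
      using slater_antisym[of i N j xs \<psi>] ij by (auto simp: \<Psi>_def configs_def)
  qed (simp add: \<Psi>_def)
  have "(\<Sum>xs\<in>configs M B N. (cmod (\<Psi> xs))\<^sup>2) = (\<Sum>xs\<in>configs M B N. c * c * (slater N \<psi> xs)\<^sup>2)"
    by (intro sum.cong refl) (simp only: \<Psi>_def if_True norm_of_real power2_abs power_mult_distrib, simp add: power2_eq_square)
  also have "\<dots> = 1" unfolding cf sum_distrib_left[symmetric] slater_norm[OF finite_modes on'] by (simp add: c2)
  finally have nm: "normalized M B N \<Psi>" by (simp add: normalized_def)
  have form: "Re (braket M B N \<Psi> (one_body (modes M B) (\<lambda>m m'. of_real (h m m')) \<Psi>))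
     = (\<Sum>k<N. Re (\<Sum>m'\<in>modes M B. \<Sum>m\<in>modes M B. cnj (of_real (\<psi> k m')) * (of_real (h m' m) * of_real (\<psi> k m))))" for h
  proof -
    have "braket M B N \<Psi> (one_body (modes M B) (\<lambda>m m'. of_real (h m m')) \<Psi>)
      = (\<Sum>xs\<in>configs M B N. of_real (c * c * (slater N \<psi> xs * (\<Sum>k<N. \<Sum>m\<in>modes M B. h (xs ! k) m * slater N \<psi> (xs[k := m])))))"
      unfolding braket_def
    proof (intro sum.cong refl)
      fix xs assume xs: "xs \<in> configs M B N"
      have "one_body (modes M B) (\<lambda>m m'. of_real (h m m')) \<Psi> xs
        = (\<Sum>k<N. \<Sum>m\<in>modes M B. of_real (h (xs ! k) m) * of_real (c * slater N \<psi> (xs[k := m])))"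
        unfolding one_body_def length_configs[OF xs] by (intro sum.cong refl) (simp add: \<Psi>_def update_configs[OF xs])
      then show "cnj (\<Psi> xs) * one_body (modes M B) (\<lambda>m m'. of_real (h m m')) \<Psi> xs
         = of_real (c * c * (slater N \<psi> xs * (\<Sum>k<N. \<Sum>m\<in>modes M B. h (xs ! k) m * slater N \<psi> (xs[k := m]))))"
        using xs by (simp add: \<Psi>_def sum_distrib_left mult_ac)
    qed
    then have "Re (braket M B N \<Psi> (one_body (modes M B) (\<lambda>m m'. of_real (h m m')) \<Psi>))
      = c * c * (\<Sum>xs\<in>configs M B N. slater N \<psi> xs * (\<Sum>k<N. \<Sum>m\<in>modes M B. h (xs ! k) m * slater N \<psi> (xs[k := m])))"
      by (simp only: Re_sum Re_complex_of_real sum_distrib_left)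
    also have "\<dots> = (\<Sum>k<N. \<Sum>m'\<in>modes M B. \<Sum>m\<in>modes M B. \<psi> k m' * (h m' m * \<psi> k m))"
      unfolding cf slater_one_body[OF finite_modes on'] by (simp add: c2)
    finally show ?thesis by simp
  qed
  have loc: "(\<Sum>z\<in>Lam M B. w z * complex_of_real (\<psi> k (z, True))) = (\<Sum>z\<in>Lam M B. w z * complex_of_real (g k z))"
    "(\<Sum>z\<in>Lam M B. w z * complex_of_real (\<psi> k (z, False))) = 0" for k w
    by (simp_all add: \<psi>_def)
  have te: "t_energy N t \<Psi> = t * (\<Sum>k<N. \<Sum>(x,y)\<in>symE B. \<phi> k x * \<phi> k y)"
  proof -
    have "(\<Sum>m'\<in>modes M B. \<Sum>m\<in>modes M B. cnj (of_real (\<psi> k m')) * (of_real (hop_mat B t \<mu> m' m) * of_real (\<psi> k m)))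
      = complex_of_real (t * (\<Sum>(x,y)\<in>symE B. \<phi> k x * \<phi> k y))" for k
    proof -
      have "(\<Sum>(x,y)\<in>symE B. \<Sum>\<sigma>\<in>UNIV. cnj (\<Sum>z\<in>Lam M B. of_real (acoef B \<mu> x z) * complex_of_real (\<psi> k (z, \<sigma>)))
        * (\<Sum>z\<in>Lam M B. of_real (acoef B \<mu> y z) * complex_of_real (\<psi> k (z, \<sigma>))))
        = (\<Sum>(x,y)\<in>symE B. complex_of_real (\<phi> k x * \<phi> k y))"
      proof (intro sum.cong refl, clarify)
        fix x y assume "(x, y) \<in> symE B"
        then have "x \<in> M" "y \<in> M" using symE_D by auto
        then show "(\<Sum>\<sigma>\<in>UNIV. cnj (\<Sum>z\<in>Lam M B. of_real (acoef B \<mu> x z) * complex_of_real (\<psi> k (z, \<sigma>)))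
          * (\<Sum>z\<in>Lam M B. of_real (acoef B \<mu> y z) * complex_of_real (\<psi> k (z, \<sigma>)))) = complex_of_real (\<phi> k x * \<phi> k y)"
          by (simp only: UNIV_bool) (simp add: loc ga del: cnj_sum)
      qed
      then show ?thesis unfolding hop_form by (simp add: case_prod_beta)
    qed
    then show ?thesis unfolding t_energy_def hopping_def form by (simp only: Re_complex_of_real sum_distrib_left)
  qed
  have be: "b_energy N \<Psi> = 0"
  proof -
    have "(\<Sum>z\<in>Lam M B. of_real (bcoef \<mu> v z) * complex_of_real (g k z)) = 0" if "v \<in> Ovs B" for v k
      using gl[of k] that unfolding lext_iff_bcoef by blast
    then have "(\<Sum>z\<in>Lam M B. of_real (bcoef \<mu> v z) * complex_of_real (\<psi> k (z, \<sigma>))) = 0" if "v \<in> Ovs B" for v k \<sigma>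
      using that by (cases \<sigma>) (simp_all add: loc)
    then show ?thesis unfolding b_energy_def form b_form by simp
  qed
  have nd: "nodouble \<Psi>"
  proof -
    have "d_energy N \<Psi> = 0" unfolding d_energy_def
    proof (intro sum.neutral ballI)
      fix xs assume xs: "xs \<in> configs M B N"
      show "real (double_occ xs) * (cmod (\<Psi> xs))\<^sup>2 = 0"
      proof (cases "double_occ xs = 0")
        case False
        then obtain j where j: "j < length xs" "\<not> snd (xs ! j)" unfolding double_occ_zero by blast
        then have pz: "(\<Prod>i<N. \<psi> (\<pi> i) (xs ! i)) = 0" for \<pi>
          using length_configs[OF xs] by (intro prod_zero) (auto simp: \<psi>_def)
        have "slater N \<psi> xs = 0" unfolding slater_def by (simp only: pz mult_zero_right sum.neutral_const)
        then show ?thesis by (simp add: \<Psi>_def)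
      qed simp
    qed
    then show ?thesis using d_energy_zero_iff[OF sp] by simp
  qed
  have "lim_energy M B N t \<mu> \<Psi> = ereal (t_energy N t \<Psi>)"
    unfolding lim_energy_eq using be nd d_energy_zero_iff[OF sp] by simp
  then show ?thesis using sp nm te by auto
qed

text \<open>The electrons fill an orthonormal basis of the complement of the hole orbitals
  \<open>f\<close>. Over a complete basis the hopping sums vanish, as bonds join distinct sites, so
  the filled orbitals contribute minus what the hole orbitals would.\<close>

lemma trial_state:
  assumes on: "orthonormal M n f" and n: "N + n = card M"
  shows "\<exists>\<Psi>. in_space M B N \<Psi> \<and> normalized M B N \<Psi> \<and>
    lim_energy M B N t \<mu> \<Psi> = ereal (- t * (\<Sum>k<n. \<Sum>(x,y)\<in>symE B. f k x * f k y))"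
proof -
  obtain f' where f': "orthonormal M (card M) f'" "\<And>j. j < n \<Longrightarrow> f' j = f j"
    using orthonormal_extend[OF finite_M on, of "card M"] n by auto
  define \<phi> where "\<phi> k = f' (n + k)" for k
  have "orthonormal M N \<phi>" using f'(1) n unfolding orthonormal_def \<phi>_def by auto
  moreover have "(\<Sum>k<N. \<Sum>(x,y)\<in>symE B. \<phi> k x * \<phi> k y) = - (\<Sum>k<n. \<Sum>(x,y)\<in>symE B. f k x * f k y)"
  proof -
    have "(\<Sum>k<card M. \<Sum>(x,y)\<in>symE B. f' k x * f' k y) = (\<Sum>e\<in>symE B. \<Sum>k<card M. f' k (fst e) * f' k (snd e))"
      unfolding case_prod_beta by (rule sum.swap)
    also have "\<dots> = 0"
    proof (rule sum.neutral, rule ballI)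
      fix e assume "e \<in> symE B"
      then have "fst e \<in> M" "snd e \<in> M" "fst e \<noteq> snd e" using symE_D[of "fst e" "snd e"] by auto
      then show "(\<Sum>k<card M. f' k (fst e) * f' k (snd e)) = 0"
        using orthonormal_complete[OF finite_M f'(1)] by simp
    qed
    finally have "0 = (\<Sum>k<n + N. \<Sum>(x,y)\<in>symE B. f' k x * f' k y)" using n by (simp add: add.commute)
    also have "\<dots> = (\<Sum>k<n. \<Sum>(x,y)\<in>symE B. f' k x * f' k y) + (\<Sum>k<N. \<Sum>(x,y)\<in>symE B. \<phi> k x * \<phi> k y)"
      unfolding \<phi>_def by (induction N) simp_all
    also have "(\<Sum>k<n. \<Sum>(x,y)\<in>symE B. f' k x * f' k y) = (\<Sum>k<n. \<Sum>(x,y)\<in>symE B. f k x * f k y)"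
      using f'(2) by simp
    finally show ?thesis by simp
  qed
  ultimately show ?thesis using slater_state[of N \<phi> t] by simp
qed

section \<open>Energy comparison\<close>

text \<open>\<open>e\<close> bounds the energy, in units of t, that the trial holes lose. A part of
  low spin would have a wall of more than \<open>e\<close> holes, hence energy strictly above the
  trial state; but no part lies below the ground state energy times its squared norm, and together
  they attain it. The fraction (1 - \<nu>) / 16 is the share (1 - \<nu>) / 4 of separated pairs
  times the 1/4 of \<open>cluster_partition\<close>.\<close>

theorem ground_state_spin:
  fixes e :: real
  assumes \<mu>: "\<mu> \<noteq> 0" and t: "t > 0" and \<nu>: "0 < \<nu>" "\<nu> < 1" and n: "N + n = card M"
    and nb: "\<And>x0 y z. x0 \<in> M \<Longrightarrow> y \<in> nbrs B x0 \<Longrightarrow> z \<in> nbrs B x0 \<Longrightarrow> (y, z) \<in> (symE B \<inter> (nbrs B x0 \<times> nbrs B x0))\<^sup>*"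
    and on: "orthonormal M n f"
    and f: "(\<Sum>k<n. \<Sum>(x,y)\<in>symE B. f k x * f k y) \<ge> real \<zeta> * real n - e"
    and iso: "\<And>W V H. W \<union> V \<union> H = M \<Longrightarrow> W \<inter> V = {} \<Longrightarrow> W \<inter> H = {} \<Longrightarrow> V \<inter> H = {} \<Longrightarrow>
       \<forall>x\<in>W. \<forall>y\<in>V. (x, y) \<notin> symE B \<Longrightarrow> N > 0 \<Longrightarrow>
       (1 - \<nu>) / 16 * real N \<le> real (card W) \<Longrightarrow> (1 - \<nu>) / 16 * real N \<le> real (card V) \<Longrightarrow> e < real (card H)"
    and gs: "ground_state_lim M B N t \<mu> \<Phi>"
  shows "total_spin_ge M B N (\<nu> * (real N / 2)) \<Phi>"
proof -
  define S0 where "S0 = \<nu> * (real N / 2)"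
  have S0: "0 \<le> S0" using \<nu> by (simp add: S0_def)
  have sp: "in_space M B N \<Phi>" and nm: "normalized M B N \<Phi>" and fe: "\<Phi> \<in> finite_energy N"
    using gs lim_energy_finite_iff by (auto simp: ground_state_lim_def)
  define E0 where "E0 = t_energy N t \<Phi>"
  have minE: "ereal E0 \<le> lim_energy M B N t \<mu> \<Psi>" if "in_space M B N \<Psi>" "normalized M B N \<Psi>" for \<Psi>
    using gs that lim_energy_finite[OF fe, of t] by (auto simp: ground_state_lim_def E0_def)
  have E0: "E0 \<le> t * (e - real \<zeta> * real n)"
  proof -
    obtain \<Psi> where "in_space M B N \<Psi>" "normalized M B N \<Psi>"
      "lim_energy M B N t \<mu> \<Psi> = ereal (- t * (\<Sum>k<n. \<Sum>(x,y)\<in>symE B. f k x * f k y))"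
      using trial_state[OF on n] by blast
    then have "E0 \<le> - t * (\<Sum>k<n. \<Sum>(x,y)\<in>symE B. f k x * f k y)" using minE by force
    also have "\<dots> \<le> t * (e - real \<zeta> * real n)"
      using mult_left_mono[OF f, of t] t by (simp add: algebra_simps)
    finally show ?thesis .
  qed
  obtain R part where R: "finite (R::real set)"
     and part: "\<And>r. r\<in>R \<Longrightarrow> part r \<in> finite_energy N" "\<And>r. r \<in> R \<Longrightarrow> Stot_sq M B (part r) = (\<lambda>x. complex_of_real r * part r x)"
     and \<Phi>: "\<Phi> = (\<lambda>x. \<Sum>r\<in>R. part r x)"
    using spin.spectral_all[OF fe] unfolding spin.spectral_def by blast
  define nn where "nn r = (\<Sum>xs\<in>configs M B N. (cmod (part r xs))\<^sup>2)" for r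
  have nn0: "nn r \<ge> 0" for r unfolding nn_def by (intro sum_nonneg) auto
  have nz: "nn r > 0" if "r \<in> R" "part r \<noteq> (\<lambda>x. 0)" for r
  proof (rule ccontr)
    assume "\<not> ?thesis"
    then have "nn r = 0" using nn0[of r] by simp
    then have "\<forall>xs\<in>configs M B N. part r xs = 0"
      unfolding nn_def by (subst (asm) sum_nonneg_eq_0_iff) (auto simp: finite_configs)
    then have "part r = (\<lambda>x. 0)" using spin.supp[OF part(1)[OF that(1)]] by auto
    then show False using that by simp
  qed
  have low: "t_energy N t (part r) \<ge> E0 * nn r" if r: "r \<in> R" for r
  proof (cases "part r = (\<lambda>x. 0)")
    case True
    then show ?thesis by (simp add: nn_def t_energy_def braket_def)
  next
    case False
    define c where "c = 1 / sqrt (nn r)"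
    have c2: "c\<^sup>2 = 1 / nn r" using nn0[of r] by (simp add: c_def power_divide)
    define \<Psi> where "\<Psi> = (\<lambda>x. complex_of_real c * part r x + 0 * part r x)"
    have "\<Psi> \<in> finite_energy N" unfolding \<Psi>_def by (rule finite_energy_comb) (use part(1)[OF r] in auto)
    have "(\<Sum>xs\<in>configs M B N. (cmod (\<Psi> xs))\<^sup>2) = c\<^sup>2 * nn r"
      by (simp add: \<Psi>_def nn_def norm_mult power_mult_distrib sum_distrib_left)
    then have "normalized M B N \<Psi>" using nz[OF r False] by (simp add: normalized_def c2)
    have "hopping t \<Psi> = (\<lambda>x. complex_of_real c * hopping t (part r) x)"
      unfolding hopping_def \<Psi>_def one_body_linear by simp
    then have "braket M B N \<Psi> (hopping t \<Psi>) = of_real (c\<^sup>2) * braket M B N (part r) (hopping t (part r))"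
      by (simp add: braket_def \<Psi>_def sum_distrib_left power2_eq_square mult_ac)
    then have "t_energy N t \<Psi> = c\<^sup>2 * t_energy N t (part r)" by (simp add: t_energy_def)
    moreover have "E0 \<le> t_energy N t \<Psi>"
      using minE[of \<Psi>] lim_energy_finite[OF \<open>\<Psi> \<in> finite_energy N\<close>, of t] \<open>\<Psi> \<in> finite_energy N\<close> \<open>normalized M B N \<Psi>\<close>
      by (simp add: finite_energy_def)
    ultimately have "E0 * nn r \<le> c\<^sup>2 * t_energy N t (part r) * nn r" using nn0[of r] by (intro mult_right_mono) auto
    then show ?thesis using nz[OF r False] by (simp add: c2)
  qed
  have high: "S0 * (S0 + 1) \<le> r" if r: "r \<in> R" and p0: "part r \<noteq> (\<lambda>x. 0)" for r
  proof (rule ccontr)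
    assume "\<not> ?thesis"
    then have rS: "r < S0 * (S0 + 1)" by simp
    have Q: "e < real (hole_pairs (occ xs))" if xs: "xs \<in> Mconfigs N" "distinct (map site xs)" "part r xs \<noteq> 0" for xs
    proof -
      let ?A = "occ xs"
      have cA: "card ?A = N" using card_occ[OF xs(2)] Mconfigs_length[OF xs(1)] by simp
      have AM: "?A \<subseteq> M" using occ_subset[OF xs(1)] .
      have fA: "finite ?A" using AM finite_M finite_subset by blast
      have "real (card {p \<in> ?A \<times> ?A. p \<notin> clusters ?A}) \<ge> real N / 2 + (real N)\<^sup>2 / 4 - r"
        using spin_eigenvalue_lower[OF part(1)[OF r] \<mu> xs part(2)[OF r]] by simp
      \<comment> \<open>By \<nu>^2 \<le> \<nu>; so a low spin puts more than a share (1 - \<nu>) / 4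
        of all pairs into different clusters.\<close>
      moreover have "S0 * (S0 + 1) \<le> real N / 2 + (real N)\<^sup>2 / 4 - (1 - \<nu>) / 4 * (real N)\<^sup>2"
      proof -
        have "S0 * (S0 + 1) = \<nu> * (real N / 2) + \<nu>\<^sup>2 * ((real N)\<^sup>2 / 4)"
          by (simp add: S0_def power2_eq_square algebra_simps)
        also have "\<dots> \<le> 1 * (real N / 2) + \<nu> * ((real N)\<^sup>2 / 4)"
          using \<nu> by (intro add_mono mult_right_mono) (auto simp: power2_eq_square mult_le_one)
        finally show ?thesis by (simp add: field_simps)
      qed
      ultimately have diff: "real (card {p \<in> ?A \<times> ?A. p \<notin> clusters ?A}) > (1 - \<nu>) / 4 * (real N)\<^sup>2" using rS by linarith
      have "N > 0"
      proof (rule ccontr)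
        assume "\<not> N > 0"
        then have "?A = {}" using cA fA by simp
        then show False using diff \<nu> \<open>\<not> N > 0\<close> by simp
      qed
      have "\<exists>W\<subseteq>?A. (\<forall>x\<in>W. \<forall>y\<in>?A. (x, y) \<in> clusters ?A \<longrightarrow> y \<in> W) \<and>
        real (card W) \<ge> (1 - \<nu>) / 4 / 4 * real (card ?A) \<and> real (card (?A - W)) \<ge> (1 - \<nu>) / 4 / 4 * real (card ?A)"
        by (rule cluster_partition[OF fA clusters_equiv]) (use \<nu> diff cA in auto)
      then obtain W where W: "W \<subseteq> ?A" "\<forall>x\<in>W. \<forall>y\<in>?A. (x, y) \<in> clusters ?A \<longrightarrow> y \<in> W"
        "real (card W) \<ge> (1 - \<nu>) / 4 / 4 * real (card ?A)" "real (card (?A - W)) \<ge> (1 - \<nu>) / 4 / 4 * real (card ?A)"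
        by blast
      have Wc: "\<And>x y. x \<in> W \<Longrightarrow> y \<in> ?A \<Longrightarrow> (x, y) \<in> clusters ?A \<Longrightarrow> y \<in> W" using W(2) by blast
      obtain W' V' H where s: "W \<subseteq> W'" "?A - W \<subseteq> V'" "W' \<union> V' \<union> H = M" "W' \<inter> V' = {}" "W' \<inter> H = {}" "V' \<inter> H = {}"
        "\<forall>x\<in>W'. \<forall>y\<in>V'. (x, y) \<notin> symE B" "card H \<le> hole_pairs ?A"
        by (rule separator[OF nb AM W(1) Wc])
      have "finite (W' \<union> V' \<union> H)" using s(3) finite_M by simp
      then have "finite W'" "finite V'" by auto
      then have "card W \<le> card W'" "card (?A - W) \<le> card V'" using s(1,2) card_mono by blast+
      then have "(1 - \<nu>) / 16 * real N \<le> real (card W')" "(1 - \<nu>) / 16 * real N \<le> real (card V')"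
        using W(3,4) cA by auto
      then have "e < real (card H)" using iso[OF s(3-7) \<open>N > 0\<close>] by blast
      then show ?thesis using s(8) by linarith
    qed
    have nM: "real (card M) - real N = real n" using n by (simp flip: n)
    have strict: "t_energy N t (part r) > E0 * nn r"
    proof -
      have "E0 * nn r \<le> t * (e - real \<zeta> * real n) * nn r" by (rule mult_right_mono[OF E0 nn0])
      also have "\<dots> < t_energy N t (part r)"
        using t_energy_strict_lower[OF part(1)[OF r] t _ Q] nz[OF r p0] unfolding nn_def nM by blast
      finally show ?thesis .
    qed
    have "(\<Sum>r\<in>R. E0 * nn r) < (\<Sum>r\<in>R. t_energy N t (part r))"
      using R low strict r by (intro sum_strict_mono_ex1) auto
    also have "\<dots> = E0" using t_energy_spectral(1)[OF R part, of t] unfolding E0_def \<Phi> by simp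
    also have "(\<Sum>r\<in>R. E0 * nn r) = E0"
      using nm t_energy_spectral(2)[OF R part] unfolding normalized_def \<Phi> nn_def by (simp flip: sum_distrib_left)
    finally show False by simp
  qed
  \<comment> \<open>Vanishing parts are dropped, since nothing is known about their
    eigenvalues.\<close>
  define R' where "R' = {r \<in> R. part r \<noteq> (\<lambda>x. 0)}"
  have fR': "finite R'" using R by (simp add: R'_def)
  obtain h where h: "bij_betw h {..<card R'} R'"
    using ex_bij_betw_nat_finite[OF fR'] by (auto simp: atLeast0LessThan)
  have hR: "h i \<in> R'" if "i < card R'" for i using h that by (auto simp: bij_betw_def)
  \<comment> \<open>The nonnegative solution S of S (S + 1) = r.\<close>
  define Sv where "Sv r = (sqrt (1 + 4 * r) - 1) / 2" for r
  have Sv: "Sv r \<ge> S0" "Sv r * (Sv r + 1) = r" if "r \<in> R'" for r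
  proof -
    have r: "S0 * (S0 + 1) \<le> r" using high that by (auto simp: R'_def)
    have "r \<ge> 0" using r S0 by (meson add_nonneg_nonneg mult_nonneg_nonneg order_trans zero_le_one)
    have "(2 * S0 + 1)\<^sup>2 \<le> 1 + 4 * r" using r by (simp add: power2_eq_square algebra_simps)
    then have "2 * S0 + 1 \<le> sqrt (1 + 4 * r)" by (rule real_le_rsqrt)
    then show "Sv r \<ge> S0" by (simp add: Sv_def)
    have "sqrt (1 + 4 * r) * sqrt (1 + 4 * r) = 1 + 4 * r" using \<open>r \<ge> 0\<close> by simp
    then show "Sv r * (Sv r + 1) = r" by (simp add: Sv_def field_simps)
  qed
  have "\<Phi> = (\<lambda>xs. \<Sum>i<card R'. part (h i) xs)"
  proof
    fix xs
    have "\<Phi> xs = (\<Sum>r\<in>R'. part r xs)"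
      unfolding \<Phi> by (rule sum.mono_neutral_right) (auto simp: R R'_def)
    also have "\<dots> = (\<Sum>i<card R'. part (h i) xs)" by (rule sum.reindex_bij_betw[OF h, symmetric])
    finally show "\<Phi> xs = (\<Sum>i<card R'. part (h i) xs)" .
  qed
  moreover have "in_space M B N (part (h i)) \<and> Sv (h i) \<ge> S0 \<and>
     Stot_sq M B (part (h i)) = (\<lambda>xs. complex_of_real (Sv (h i) * (Sv (h i) + 1)) * part (h i) xs)" if "i < card R'" for i
    using hR[OF that] part Sv[OF hR[OF that]] by (auto simp: R'_def finite_energy_def)
  ultimately show ?thesis unfolding total_spin_ge_def S0_def[symmetric]
    by (intro exI[of _ "card R'"] exI[of _ "\<lambda>i. part (h i)"] exI[of _ "\<lambda>i. Sv (h i)"]) auto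
qed

end

section \<open>Walks in the periodic lattice\<close>

text \<open>Zero beyond the end of the list, so that displacements are functions and can be added
  without regard to length.\<close>

definition vec :: "int list \<Rightarrow> nat \<Rightarrow> int" where
  "vec v i = (if i < length v then v ! i else 0)"

definition shift :: "nat \<Rightarrow> nat \<Rightarrow> int list \<Rightarrow> (nat \<Rightarrow> int) \<Rightarrow> int list" where
  "shift d L x u = map (\<lambda>i. (x ! i + u i) mod int L) [0..<d]"

text \<open>The displacement \<open>u\<close> is recorded in Z^d and not modulo L, so a walk depends
  on the bond types alone and is available on every torus.\<close>

inductive walk :: "('k \<times> 'k \<times> int list) set \<Rightarrow> 'k \<Rightarrow> (nat \<Rightarrow> int) \<Rightarrow> 'k \<Rightarrow> nat \<Rightarrow> bool" for T where
  walk_nil: "walk T k (\<lambda>_. 0) k 0"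
| walk_fwd: "walk T k u k' n \<Longrightarrow> (k', k'', v) \<in> T \<Longrightarrow> walk T k (\<lambda>i. u i + vec v i) k'' (Suc n)"
| walk_bwd: "walk T k u k'' n \<Longrightarrow> (k', k'', v) \<in> T \<Longrightarrow> walk T k (\<lambda>i. u i - vec v i) k' (Suc n)"

lemma walk_trans: "walk T k' w k'' m \<Longrightarrow> walk T k u k' n \<Longrightarrow> walk T k (\<lambda>i. u i + w i) k'' (n + m)"
proof (induction rule: walk.induct)
  case (walk_nil k)
  then show ?case by simp
next
  case (walk_fwd k w k' n k'' v)
  then show ?case using walk.walk_fwd[OF walk_fwd.IH[OF walk_fwd.prems] walk_fwd.hyps(2)] by (simp add: add.assoc)
next
  case (walk_bwd k w k'' n k' v)
  then show ?case using walk.walk_bwd[OF walk_bwd.IH[OF walk_bwd.prems] walk_bwd.hyps(2)] by (simp add: add_diff_eq)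
qed

lemma walk_rev: "walk T k u k' n \<Longrightarrow> walk T k' (\<lambda>i. - u i) k n"
proof (induction rule: walk.induct)
  case (walk_nil k)
  then show ?case using walk.walk_nil by simp
next
  case (walk_fwd k u k' n k'' v)
  have e: "(\<lambda>i. - (u i + vec v i)) = (\<lambda>i. 0 - vec v i + - u i)" by auto
  show ?case
    unfolding e using walk_trans[OF walk_fwd.IH walk.walk_bwd[OF walk.walk_nil walk_fwd.hyps(2)]] by simp
next
  case (walk_bwd k u k'' n k' v)
  then show ?case
    using walk_trans[OF walk_bwd.IH walk.walk_fwd[OF walk.walk_nil walk_bwd.hyps(2)]] by simp
qed

lemma walk_power:
  assumes "walk T k u k n"
  shows "walk T k (\<lambda>i. int a * u i) k (a * n)"
proof (induction a)
  case 0
  then show ?case using walk_nil by simp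
next
  case (Suc a)
  then show ?case using walk_trans[OF Suc assms] by (simp add: distrib_right add.commute)
qed

lemma walk_int_power:
  assumes "walk T k u k n"
  shows "walk T k (\<lambda>i. a * u i) k (nat \<bar>a\<bar> * n)"
proof (cases "a \<ge> 0")
  case True
  then show ?thesis using walk_power[OF assms, of "nat a"] by simp
next
  case False
  then show ?thesis using walk_power[OF walk_rev[OF assms], of "nat (- a)"] by simp
qed

text \<open>In each direction j the loop is run |a j| times, backwards where a j is
  negative.\<close>

lemma walk_coordinates:
  assumes "\<And>i. i < d \<Longrightarrow> \<exists>n\<le>n0. walk T k (\<lambda>j. if j = i then N else 0) k n"
    and "\<And>i. i < d \<Longrightarrow> \<bar>a i\<bar> \<le> int r" and "m \<le> d"
  shows "\<exists>n\<le>m * r * n0. walk T k (\<lambda>j. if j < m then N * a j else 0) k n"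
  using assms(3)
proof (induction m)
  case 0
  then show ?case using walk_nil[of T k] by auto
next
  case (Suc m)
  then obtain n where n: "n \<le> m * r * n0" "walk T k (\<lambda>j. if j < m then N * a j else 0) k n" by auto
  obtain n' where n': "n' \<le> n0" "walk T k (\<lambda>j. if j = m then N else 0) k n'" using assms(1)[of m] Suc by auto
  have "nat \<bar>a m\<bar> * n' \<le> r * n0" using assms(2)[of m] Suc n' by (intro mult_mono) auto
  moreover have "(\<lambda>j. (if j < m then N * a j else 0) + a m * (if j = m then N else 0)) = (\<lambda>j. if j < Suc m then N * a j else 0)"
    by (auto simp: fun_eq_iff less_Suc_eq)
  ultimately show ?case
    using walk_trans[OF walk_int_power[OF n'(2), of "a m"] n(2)] n(1)
    by (intro exI[of _ "n + nat \<bar>a m\<bar> * n'"]) (auto simp: distrib_right)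
qed

text \<open>Gauss-Jordan elimination; the congruences modulo L survive each step and keep the pivots nonzero.\<close>

lemma diagonal_multiples:
  fixes P :: "(nat \<Rightarrow> int) \<Rightarrow> bool" and L :: int
  assumes comb: "\<And>u w a b. P u \<Longrightarrow> P w \<Longrightarrow> P (\<lambda>i. a * u i + b * w i)"
    and supp: "\<And>u j. P u \<Longrightarrow> d \<le> j \<Longrightarrow> u j = 0"
    and L: "L \<ge> 2"
    and gen: "\<And>i. i < d \<Longrightarrow> \<exists>u. P u \<and> (\<forall>j<d. L dvd u j - (if j = i then 1 else 0))"
  shows "\<exists>D. \<forall>i<d. D i \<noteq> 0 \<and> P (\<lambda>j. if j = i then D i else 0)"
proof -
  have "\<exists>g. (\<forall>i<d. P (g i) \<and> (\<forall>j<d. L dvd g i j - (if j = i then 1 else 0))) \<and>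
     (\<forall>c<m. \<forall>i<d. i \<noteq> c \<longrightarrow> g i c = 0)" if "m \<le> d" for m
    using that
  proof (induction m)
    case 0
    have "\<forall>i. \<exists>u. i < d \<longrightarrow> P u \<and> (\<forall>j<d. L dvd u j - (if j = i then 1 else 0))" using gen by blast
    from choice[OF this] obtain g where "\<forall>i. i < d \<longrightarrow> P (g i) \<and> (\<forall>j<d. L dvd g i j - (if j = i then 1 else 0))"
      by blast
    then show ?case by (intro exI[of _ g]) simp
  next
    case (Suc m)
    have "m \<le> d" using Suc.prems by simp
    with Suc.IH obtain g where G: "\<forall>i<d. P (g i) \<and> (\<forall>j<d. L dvd g i j - (if j = i then 1 else 0))"
      "\<forall>c<m. \<forall>i<d. i \<noteq> c \<longrightarrow> g i c = 0" by blast
    have g: "P (g i)" if "i < d" for i using G(1) that by blast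
    have g2: "L dvd g i j - (if j = i then 1 else 0)" if "i < d" "j < d" for i j using G(1) that by blast
    have g3: "g i c = 0" if "c < m" "i < d" "i \<noteq> c" for c i using G(2) that by blast
    have m: "m < d" using Suc by simp
    define g' where "g' i = (if i = m then g m else (\<lambda>j. g m m * g i j + (- g i m) * g m j))" for i
    have "P (g' i)" if "i < d" for i
      using comb[OF g[OF that] g[OF m], of "g m m" "- g i m"] g[OF m] unfolding g'_def by simp
    moreover have "L dvd g' i j - (if j = i then 1 else 0)" if ij: "i < d" "j < d" for i j
    proof (cases "i = m")
      case True
      then show ?thesis using g2 ij by (simp add: g'_def)
    next
      case False
      have "L dvd (g m m - 1) * g i j + (g i j - (if j = i then 1 else 0)) - g i m * g m j"
      proof -
        have "L dvd g m m - 1" "L dvd g i m" using g2[OF m m] g2[OF ij(1) m] False by auto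
        then have "L dvd (g m m - 1) * g i j" "L dvd g i m * g m j" by (simp_all add: dvd_mult2)
        then show ?thesis by (intro dvd_diff[OF dvd_add[OF _ g2[OF ij]]])
      qed
      moreover have "g' i j - (if j = i then 1 else 0) = (g m m - 1) * g i j + (g i j - (if j = i then 1 else 0)) - g i m * g m j"
        using False by (simp add: g'_def algebra_simps)
      ultimately show ?thesis by metis
    qed
    moreover have "g' i c = 0" if "c < Suc m" "i < d" "i \<noteq> c" for c i
      using that g3[of c i] g3[of c m] m by (cases "c = m") (auto simp: g'_def less_Suc_eq)
    ultimately show ?case by (intro exI[of _ g']) blast
  qed
  from this[of d] obtain g where G: "\<forall>i<d. P (g i) \<and> (\<forall>j<d. L dvd g i j - (if j = i then 1 else 0))"
      "\<forall>c<d. \<forall>i<d. i \<noteq> c \<longrightarrow> g i c = 0" by blast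
  have g: "P (g i)" if "i < d" for i using G(1) that by blast
  have g2: "L dvd g i j - (if j = i then 1 else 0)" if "i < d" "j < d" for i j using G(1) that by blast
  have g3: "g i c = 0" if "c < d" "i < d" "i \<noteq> c" for c i using G(2) that by blast
  have "g i i \<noteq> 0 \<and> P (\<lambda>j. if j = i then g i i else 0)" if i: "i < d" for i
  proof
    have "\<not> L dvd - 1" using L zdvd_imp_le[of L 1] by auto
    then show "g i i \<noteq> 0" using g2[OF i i] by auto
    have "(if j = i then g i i else 0) = g i j" for j
      using g3[of j i] i supp[OF g[OF i], of j] by (cases "j < d") auto
    then have "(\<lambda>j. if j = i then g i i else 0) = g i" by (rule ext)
    then show "P (\<lambda>j. if j = i then g i i else 0)" using g[OF i] by simp
  qed
  then show ?thesis by (intro exI[of _ "\<lambda>i. g i i"]) blast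
qed

section \<open>Translations, lifted paths, and loops common to all tori\<close>

locale lattice_data =
  fixes d :: nat and K :: "'k set" and T :: "('k \<times> 'k \<times> int list) set"
  assumes d: "d \<ge> 2" and finite_K: "finite K" and finite_T: "finite T"
    and T_subset: "T \<subseteq> K \<times> K \<times> {v. length v = d}"
begin

lemma T_D: "(k, k', v) \<in> T \<Longrightarrow> k \<in> K \<and> k' \<in> K \<and> length v = d"
  using T_subset by auto

lemma cells_lists: "cells d L = {x. set x \<subseteq> {0..<int L} \<and> length x = d}"
  unfolding cells_def by (auto simp: set_conv_nth)

lemma finite_cells: "finite (cells d L)"
  unfolding cells_lists by (rule finite_lists_length_eq) simp

lemma card_cells: "card (cells d L) = L ^ d"
  unfolding cells_lists by (subst card_lists_length_eq) auto

lemma cells_D: "x \<in> cells d L \<Longrightarrow> length x = d" "x \<in> cells d L \<Longrightarrow> i < d \<Longrightarrow> 0 \<le> x ! i \<and> x ! i < int L"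
  by (auto simp: cells_def)

lemma finite_lsites: "finite (lsites d L K)"
  by (simp add: lsites_def finite_cells finite_K)

lemma card_lsites: "card (lsites d L K) = card K * L ^ d"
  by (simp add: lsites_def card_cartesian_product card_cells)

lemma length_shift [simp]: "length (shift d L x u) = d"
  by (simp add: shift_def)

lemma nth_shift: "i < d \<Longrightarrow> shift d L x u ! i = (x ! i + u i) mod int L"
  by (simp add: shift_def)

lemma shift_cells: "L > 0 \<Longrightarrow> shift d L x u \<in> cells d L"
  by (simp add: cells_def nth_shift)

lemma shift_shift: "shift d L (shift d L x u) w = shift d L x (\<lambda>i. u i + w i)"
  by (rule nth_equalityI) (auto simp: nth_shift mod_add_left_eq add.assoc)

lemma shift_zero: "x \<in> cells d L \<Longrightarrow> shift d L x (\<lambda>_. 0) = x"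
  by (rule nth_equalityI) (auto simp: nth_shift cells_def)

lemma shift_inverse: "x \<in> cells d L \<Longrightarrow> shift d L (shift d L x u) (\<lambda>i. - u i) = x"
  by (simp add: shift_shift shift_zero)

lemma shift_inverse': "x \<in> cells d L \<Longrightarrow> shift d L (shift d L x (\<lambda>i. - u i)) u = x"
  by (simp add: shift_shift shift_zero)

lemma inj_shift: "inj_on (\<lambda>x. shift d L x u) (cells d L)"
  by (rule inj_on_inverseI[of _ "\<lambda>x. shift d L x (\<lambda>i. - u i)"]) (rule shift_inverse)

lemma shift_cong: "(\<And>i. i < d \<Longrightarrow> u i mod int L = w i mod int L) \<Longrightarrow> shift d L x u = shift d L x w"
  by (rule nth_equalityI) (auto simp: nth_shift intro: mod_add_cong)

lemma lbonds_shift: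
  "lbonds d L T = {((x, k), (shift d L x (vec v), k')) | x k k' v. x \<in> cells d L \<and> (k, k', v) \<in> T}"
proof -
  have e: "map2 (\<lambda>a b. (a + b) mod int L) x v = shift d L x (vec v)" if "x \<in> cells d L" "(k, k', v) \<in> T" for x k k' v
    using cells_D(1)[OF that(1)] T_D[OF that(2)] by (intro nth_equalityI) (auto simp: nth_shift vec_def)
  show ?thesis
  proof (intro equalityI subsetI)
    fix p assume "p \<in> lbonds d L T"
    then obtain x k k' v where p: "p = ((x, k), (map2 (\<lambda>a b. (a + b) mod int L) x v, k'))" "x \<in> cells d L" "(k, k', v) \<in> T"
      unfolding lbonds_def by blast
    then show "p \<in> {((x, k), (shift d L x (vec v), k')) | x k k' v. x \<in> cells d L \<and> (k, k', v) \<in> T}"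
      unfolding p(1) e[OF p(2,3)] by blast
  next
    fix p assume "p \<in> {((x, k), (shift d L x (vec v), k')) | x k k' v. x \<in> cells d L \<and> (k, k', v) \<in> T}"
    then obtain x k k' v where p: "p = ((x, k), (shift d L x (vec v), k'))" "x \<in> cells d L" "(k, k', v) \<in> T" by blast
    then show "p \<in> lbonds d L T"
      unfolding p(1) e[OF p(2,3), symmetric] lbonds_def by blast
  qed
qed

lemma walk_supp: "walk T k u k' n \<Longrightarrow> d \<le> i \<Longrightarrow> u i = 0"
  by (induction rule: walk.induct) (auto simp: vec_def dest: T_D)

text \<open>A path on the torus lifts to a walk; of its displacement only the reduction modulo L is
  controlled.\<close>

lemma connected_walk:
  assumes "(p, q) \<in> (symE (lbonds d L T))\<^sup>*" "fst p \<in> cells d L"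
  shows "\<exists>u n. walk T (snd p) u (snd q) n \<and> fst q = shift d L (fst p) u"
  using assms(1)
proof (induction rule: rtrancl_induct)
  case base
  then show ?case using walk_nil[of T] shift_zero[OF assms(2)] by metis
next
  case (step q q')
  then obtain u n where un: "walk T (snd p) u (snd q) n" "fst q = shift d L (fst p) u" by blast
  have "(q, q') \<in> lbonds d L T \<or> (q', q) \<in> lbonds d L T" using step(2) by (auto simp: symE_def)
  then show ?case
  proof
    assume "(q, q') \<in> lbonds d L T"
    then obtain v where v: "(snd q, snd q', v) \<in> T" "fst q' = shift d L (fst q) (vec v)" unfolding lbonds_shift by auto
    then show ?thesis using walk_fwd[OF un(1) v(1)] un(2) by (auto simp: shift_shift)
  next
    assume "(q', q) \<in> lbonds d L T"
    then obtain v where v: "(snd q', snd q, v) \<in> T" "fst q = shift d L (fst q') (vec v)" "fst q' \<in> cells d L" unfolding lbonds_shift by auto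
    have "fst q' = shift d L (fst q) (\<lambda>i. - vec v i)" using v shift_inverse by simp
    then have "fst q' = shift d L (fst p) (\<lambda>i. u i - vec v i)" unfolding un(2) by (simp add: shift_shift)
    then show ?thesis using walk_bwd[OF un(1) v(1)] by blast
  qed
qed

definition connected_torus :: "nat \<Rightarrow> bool" where
  "connected_torus L \<longleftrightarrow> (\<forall>p\<in>lsites d L K. \<forall>q\<in>lsites d L K. (p, q) \<in> (symE (lbonds d L T))\<^sup>*)"

lemma connected_torus_walk:
  assumes "connected_torus L" "L > 0" "k \<in> K" "k' \<in> K" "\<delta> \<in> cells d L"
  shows "\<exists>u n. walk T k u k' n \<and> (\<forall>i<d. u i mod int L = \<delta> ! i)"
proof -
  let ?o = "shift d L (replicate d 0) (\<lambda>_. 0)"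
  have o: "?o \<in> cells d L" using shift_cells assms(2) by blast
  have oi: "?o ! i = 0" if "i < d" for i using that by (simp add: nth_shift)
  have "((?o, k), (\<delta>, k')) \<in> (symE (lbonds d L T))\<^sup>*"
    using assms o unfolding connected_torus_def lsites_def by blast
  then obtain u n where "walk T k u k' n" "\<delta> = shift d L ?o u" using connected_walk o by fastforce
  moreover from this(2) have "\<forall>i<d. u i mod int L = \<delta> ! i" using oi by (metis add_0 nth_shift)
  ultimately show ?thesis by blast
qed

text \<open>Connectedness of one torus with L at least 2 gives closed walks with displacement
  congruent to each unit vector modulo L. Their integer combinations contain an exact nonzero
  multiple of every unit vector, and these loops no longer refer to L.\<close>

lemma loops_at:
  assumes "connected_torus L" "L \<ge> 2" "k \<in> K"
  shows "\<exists>N>0. \<forall>i<d. \<exists>n. walk T k (\<lambda>j. if j = i then int N else 0) k n"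
proof -
  have "\<exists>D. \<forall>i<d. D i \<noteq> 0 \<and> (\<exists>n. walk T k (\<lambda>j. if j = i then D i else 0) k n)"
  proof (rule diagonal_multiples[of "\<lambda>u. \<exists>n. walk T k u k n" d "int L"])
    fix u w a b assume "\<exists>n. walk T k u k n" "\<exists>n. walk T k w k n"
    then obtain n m where "walk T k u k n" "walk T k w k m" by blast
    then show "\<exists>n. walk T k (\<lambda>i. a * u i + b * w i) k n"
      using walk_trans[OF walk_int_power[of T k w m b] walk_int_power[of T k u n a]] by blast
  next
    fix i assume i: "i < d"
    define \<delta> where "\<delta> = map (\<lambda>j. if j = i then 1 else 0 :: int) [0..<d]"
    have "\<delta> \<in> cells d L" using assms(2) by (auto simp: cells_def \<delta>_def)
    then obtain u n where "walk T k u k n" "\<forall>j<d. u j mod int L = \<delta> ! j"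
      using connected_torus_walk[OF assms(1) _ assms(3,3)] assms(2) by force
    moreover have "int L dvd u j - (if j = i then 1 else 0)" if "j < d" "u j mod int L = \<delta> ! j" for j
    proof -
      have "u j mod int L = (if j = i then 1 else 0) mod int L" using that assms(2) by (simp add: \<delta>_def)
      then show ?thesis by (simp add: mod_eq_dvd_iff)
    qed
    ultimately show "\<exists>u. (\<exists>n. walk T k u k n) \<and> (\<forall>j<d. int L dvd u j - (if j = i then 1 else 0))" by blast
  qed (use assms(2) walk_supp in auto)
  then obtain D where D: "\<And>i. i < d \<Longrightarrow> D i \<noteq> 0 \<and> (\<exists>n. walk T k (\<lambda>j. if j = i then D i else 0) k n)" by blast
  define N where "N = nat \<bar>\<Prod>i<d. D i\<bar>"
  have "(\<Prod>i<d. D i) \<noteq> 0" using D by simp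
  then have "N > 0" by (simp add: N_def)
  moreover have "\<exists>n. walk T k (\<lambda>j. if j = i then int N else 0) k n" if i: "i < d" for i
  proof -
    have "D i dvd int N" using i by (simp add: N_def dvd_prodI)
    then obtain a where "int N = a * D i" by (metis dvdE mult.commute)
    obtain n where w: "walk T k (\<lambda>j. if j = i then D i else 0) k n" using D i by blast
    have "walk T k (\<lambda>j. a * (if j = i then D i else 0)) k (nat \<bar>a\<bar> * n)" by (rule walk_int_power[OF w])
    moreover have "(\<lambda>j. a * (if j = i then D i else 0)) = (\<lambda>j. if j = i then int N else 0)"
      using \<open>int N = a * D i\<close> by auto
    ultimately show ?thesis by auto
  qed
  ultimately show ?thesis by blast
qed

lemma finite_bounded_witness:
  assumes "finite A" "\<And>x. x \<in> A \<Longrightarrow> \<exists>n::nat. Q x n"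
  shows "\<exists>n0. \<forall>x\<in>A. \<exists>n\<le>n0. Q x n"
proof -
  obtain g where g: "\<And>x. x \<in> A \<Longrightarrow> Q x (g x)" using assms(2) by metis
  have "g x \<le> sum g A" if "x \<in> A" for x using member_le_sum[of x A g] that assms(1) by auto
  then show ?thesis using g by blast
qed

text \<open>A common multiple serves all sites of the unit cell, and finiteness bounds the
  lengths.\<close>

lemma loops:
  assumes "connected_torus L" "L \<ge> 2"
  shows "\<exists>N>0. \<exists>n0. \<forall>k\<in>K. \<forall>i<d. \<exists>n\<le>n0. walk T k (\<lambda>j. if j = i then int N else 0) k n"
proof -
  obtain Nf where Nf: "\<And>k. k \<in> K \<Longrightarrow> Nf k > 0 \<and> (\<forall>i<d. \<exists>n. walk T k (\<lambda>j. if j = i then int (Nf k) else 0) k n)"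
    using loops_at[OF assms] by metis
  define N where "N = (\<Prod>k\<in>K. Nf k)"
  have "N > 0" using Nf by (auto simp: N_def intro: prod_pos)
  moreover have "\<exists>n. walk T (fst p) (\<lambda>j. if j = snd p then int N else 0) (fst p) n" if pK: "p \<in> K \<times> {..<d}" for p
  proof -
    obtain k i where p: "p = (k, i)" "k \<in> K" "i < d" using pK by (cases p) auto
    have "Nf k dvd N" using p finite_K by (simp add: N_def dvd_prodI)
    then obtain a where a: "N = a * Nf k" by (metis dvdE mult.commute)
    obtain n where "walk T k (\<lambda>j. if j = i then int (Nf k) else 0) k n" using Nf p by blast
    then have "walk T k (\<lambda>j. int a * (if j = i then int (Nf k) else 0)) k (a * n)" by (rule walk_power)
    moreover have "(\<lambda>j. int a * (if j = i then int (Nf k) else 0)) = (\<lambda>j. if j = i then int N else 0)" using a by auto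
    ultimately show ?thesis using p by auto
  qed
  then have "\<exists>n0. \<forall>p\<in>K \<times> {..<d}. \<exists>n\<le>n0. walk T (fst p) (\<lambda>j. if j = snd p then int N else 0) (fst p) n"
    by (intro finite_bounded_witness) (use finite_K in auto)
  then obtain n0 where n0: "\<And>p. p \<in> K \<times> {..<d} \<Longrightarrow> \<exists>n\<le>n0. walk T (fst p) (\<lambda>j. if j = snd p then int N else 0) (fst p) n"
    by blast
  have "\<exists>n\<le>n0. walk T k (\<lambda>j. if j = i then int N else 0) k n" if "k \<in> K" "i < d" for k i
    using n0[of "(k, i)"] that by simp
  ultimately show ?thesis by blast
qed

section \<open>Isoperimetry\<close>

text \<open>A walk from W to V begins its last step in V or in H, as W and V are not adjacent.
  Translations are injective, so each step of the walk meets H for at most \<open>card H\<close>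
  starting points.\<close>

lemma crossing:
  assumes L: "L > 0" and part: "W \<union> V \<union> H = lsites d L K" "W \<inter> V = {}"
    and noE: "\<forall>x\<in>W. \<forall>y\<in>V. (x, y) \<notin> symE (lbonds d L T)" and w: "walk T k u k' n"
  shows "card {x \<in> cells d L. (x, k) \<in> W \<and> (shift d L x u, k') \<in> V} \<le> n * card H"
proof -
  have fH: "finite H" using part(1) finite_lsites by (metis finite_Un)
  have edge: "((x, k), (shift d L x (vec v), k')) \<in> symE (lbonds d L T) \<and> ((shift d L x (vec v), k'), (x, k)) \<in> symE (lbonds d L T)"
    if "x \<in> cells d L" "(k, k', v) \<in> T" for x k k' v
    using that unfolding symE_def lbonds_shift by blast
  have cH: "card {x \<in> cells d L. (shift d L x u, k') \<in> H} \<le> card H" for u k'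
  proof (rule card_inj_on_le[of "\<lambda>x. (shift d L x u, k')"])
    show "inj_on (\<lambda>x. (shift d L x u, k')) {x \<in> cells d L. (shift d L x u, k') \<in> H}"
      using inj_shift[of L u] by (auto simp: inj_on_def)
  qed (use fH in auto)
  have site: "(shift d L x u, k) \<in> W \<union> V \<union> H" if "k \<in> K" for x u k
    unfolding part(1) lsites_def using that shift_cells[OF L] by blast
  have step: "card {x \<in> cells d L. (x, k) \<in> W \<and> (shift d L x u', k'') \<in> V} \<le> Suc n * card H"
    if IH: "card {x \<in> cells d L. (x, k) \<in> W \<and> (shift d L x u, k') \<in> V} \<le> n * card H"
      and k': "k' \<in> K" and e: "\<And>x. x \<in> cells d L \<Longrightarrow> ((shift d L x u, k'), (shift d L x u', k'')) \<in> symE (lbonds d L T)"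
    for k u k' n u' k''
  proof -
    have "{x \<in> cells d L. (x, k) \<in> W \<and> (shift d L x u', k'') \<in> V}
       \<subseteq> {x \<in> cells d L. (x, k) \<in> W \<and> (shift d L x u, k') \<in> V} \<union> {x \<in> cells d L. (shift d L x u, k') \<in> H}"
      using site[OF k', of _ u] e noE by blast
    then have "card {x \<in> cells d L. (x, k) \<in> W \<and> (shift d L x u', k'') \<in> V}
       \<le> card ({x \<in> cells d L. (x, k) \<in> W \<and> (shift d L x u, k') \<in> V} \<union> {x \<in> cells d L. (shift d L x u, k') \<in> H})"
      by (intro card_mono) (auto simp: finite_cells)
    also have "\<dots> \<le> n * card H + card H" using card_Un_le IH cH[of u k'] by (meson add_mono order_trans)
    finally show ?thesis by simp
  qed
  show ?thesis using w
  proof (induction rule: walk.induct)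
    case (walk_nil k)
    have e: "{x \<in> cells d L. (x, k) \<in> W \<and> (shift d L x (\<lambda>_. 0), k) \<in> V} = {}"
      using part(2) shift_zero by auto
    show ?case unfolding e by simp
  next
    case (walk_fwd k u k' n k'' v)
    show ?case
    proof (rule step[OF walk_fwd.IH])
      show "k' \<in> K" using T_D walk_fwd(2) by blast
      fix x assume "x \<in> cells d L"
      show "((shift d L x u, k'), (shift d L x (\<lambda>i. u i + vec v i), k'')) \<in> symE (lbonds d L T)"
        using edge[OF shift_cells[OF L] walk_fwd(2), of x u] by (simp add: shift_shift)
    qed
  next
    case (walk_bwd k u k'' n k' v)
    show ?case
    proof (rule step[OF walk_bwd.IH])
      show "k'' \<in> K" using T_D walk_bwd(2) by blast
      fix x assume "x \<in> cells d L"
      have "shift d L (shift d L x (\<lambda>i. u i - vec v i)) (vec v) = shift d L x u" by (simp add: shift_shift)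
      then show "((shift d L x u, k''), (shift d L x (\<lambda>i. u i - vec v i), k')) \<in> symE (lbonds d L T)"
        using edge[OF shift_cells[OF L] walk_bwd(2), of x "\<lambda>i. u i - vec v i"] by simp
    qed
  qed
qed

text \<open>Few of the r^d translates of a small set by multiples of N stay inside it.\<close>

lemma small_set:
  assumes L: "L > 0" and part: "W \<union> V \<union> H = lsites d L K" "W \<inter> V = {}"
    and noE: "\<forall>x\<in>W. \<forall>y\<in>V. (x, y) \<notin> symE (lbonds d L T)"
    and loop: "\<And>k i. k \<in> K \<Longrightarrow> i < d \<Longrightarrow> \<exists>n\<le>n0. walk T k (\<lambda>j. if j = i then int N else 0) k n" and N: "N > 0"
    and r: "N * r \<le> L" "4 * card W \<le> r ^ d" "r > 0" and HW: "card H \<le> card W"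
  shows "card W \<le> 2 * card K * d * n0 * r * card H"
proof -
  have fin: "finite W" "finite V" "finite H" using part(1) finite_lsites by (metis finite_Un)+
  define u where "u a = (\<lambda>j. if j < d then int N * vec a j else 0)" for a
  have walks: "\<exists>n\<le>d * r * n0. walk T k (u a) k n" if "k \<in> K" "a \<in> cells d r" for k a
  proof -
    have "\<bar>vec a i\<bar> \<le> int r" if "i < d" for i
      using cells_D(2)[OF \<open>a \<in> cells d r\<close> that] by (auto simp: vec_def)
    then show ?thesis unfolding u_def using walk_coordinates[of d n0 T k "int N" "vec a" r d] loop that(1) by blast
  qed
  \<comment> \<open>\<open>N * r \<le> L\<close> keeps the translates from wrapping around the
    torus.\<close>
  have inj: "inj_on (\<lambda>a. shift d L x (u a)) (cells d r)" for x
  proof (rule inj_onI)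
    fix a b assume a: "a \<in> cells d r" and b: "b \<in> cells d r" and e: "shift d L x (u a) = shift d L x (u b)"
    show "a = b"
    proof (rule nth_equalityI)
      show "length a = length b" using a b by (simp add: cells_def)
      fix i assume "i < length a"
      then have i: "i < d" using a by (simp add: cells_def)
      have "(x ! i + int N * a ! i) mod int L = (x ! i + int N * b ! i) mod int L"
        using arg_cong[OF e, of "\<lambda>l. l ! i"] i a b by (simp add: nth_shift u_def vec_def cells_def)
      then have "int L dvd int N * a ! i - int N * b ! i" by (simp add: mod_eq_dvd_iff)
      moreover have "int N * y < int L" "0 \<le> int N * y" if "0 \<le> y" "y < int r" for y
      proof -
        have "int N * y < int N * int r" using that N by (intro mult_strict_left_mono) auto
        also have "\<dots> \<le> int L" using r(1) by (simp flip: of_nat_mult)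
        finally show "int N * y < int L" .
      qed (use that in auto)
      ultimately have "int N * a ! i = int N * b ! i"
        using cells_D(2)[OF a i] cells_D(2)[OF b i]
        by (metis mod_eq_dvd_iff mod_pos_pos_trivial)
      then show "a ! i = b ! i" using N by simp
    qed
  qed
  \<comment> \<open>Sites of W together with a translation carrying them into V, counted from above
    by \<open>crossing\<close> and from below site by site.\<close>
  define S where "S = {(k, a, x). k \<in> K \<and> a \<in> cells d r \<and> x \<in> cells d L \<and> (x, k) \<in> W \<and> (shift d L x (u a), k) \<in> V}"
  have "S = (SIGMA k:K. SIGMA a:cells d r. {x \<in> cells d L. (x, k) \<in> W \<and> (shift d L x (u a), k) \<in> V})"
    by (auto simp: S_def)
  then have "card S = (\<Sum>k\<in>K. \<Sum>a\<in>cells d r. card {x \<in> cells d L. (x, k) \<in> W \<and> (shift d L x (u a), k) \<in> V})"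
    by (simp add: card_SigmaI finite_K finite_cells)
  also have "\<dots> \<le> (\<Sum>k\<in>K. \<Sum>a\<in>cells d r. d * r * n0 * card H)"
  proof (intro sum_mono)
    fix k a assume "k \<in> K" "a \<in> cells d r"
    then obtain n where n: "n \<le> d * r * n0" "walk T k (u a) k n" using walks by blast
    show "card {x \<in> cells d L. (x, k) \<in> W \<and> (shift d L x (u a), k) \<in> V} \<le> d * r * n0 * card H"
      using crossing[OF L part noE n(2)] mult_right_mono[OF n(1), of "card H"] by linarith
  qed
  also have "\<dots> = card K * r ^ d * (d * r * n0 * card H)" by (simp add: card_cells)
  finally have up: "card S \<le> card K * r ^ d * (d * r * n0 * card H)" .
  have img: "S = (\<lambda>((x, k), a). (k, a, x)) ` (SIGMA p:W. {a \<in> cells d r. (shift d L (fst p) (u a), snd p) \<in> V})"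
  proof (intro equalityI subsetI)
    fix q assume "q \<in> S"
    then obtain k a x where "q = (k, a, x)" "((x, k), a) \<in> (SIGMA p:W. {a \<in> cells d r. (shift d L (fst p) (u a), snd p) \<in> V})"
      by (auto simp: S_def)
    then show "q \<in> (\<lambda>((x, k), a). (k, a, x)) ` (SIGMA p:W. {a \<in> cells d r. (shift d L (fst p) (u a), snd p) \<in> V})"
      by (intro image_eqI[of _ _ "((x, k), a)"]) auto
  next
    fix q assume "q \<in> (\<lambda>((x, k), a). (k, a, x)) ` (SIGMA p:W. {a \<in> cells d r. (shift d L (fst p) (u a), snd p) \<in> V})"
    then show "q \<in> S" using part(1) by (auto simp: S_def lsites_def)
  qed
  have inj': "inj_on (\<lambda>((x, k), a). (k, a, x)) X" for X :: "((int list \<times> 'k) \<times> int list) set"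
    by (auto simp: inj_on_def)
  have "card S = card (SIGMA p:W. {a \<in> cells d r. (shift d L (fst p) (u a), snd p) \<in> V})"
    unfolding img by (rule card_image[OF inj'])
  also have "\<dots> = (\<Sum>p\<in>W. card {a \<in> cells d r. (shift d L (fst p) (u a), snd p) \<in> V})"
    by (rule card_SigmaI) (auto simp: fin finite_cells)
  finally have cS: "card S = \<dots>" .
  have "r ^ d \<le> 2 * card {a \<in> cells d r. (shift d L (fst p) (u a), snd p) \<in> V}" if p: "p \<in> W" for p
  proof -
    have "p \<in> lsites d L K" using p part(1) by blast
    then have k: "snd p \<in> K" by (auto simp: lsites_def)
    \<comment> \<open>At most 2 \<open>card W\<close> translates end in W or H; by
      \<open>4 * card W \<le> r ^ d\<close> at least half of them end in V.\<close>
    have "card {a \<in> cells d r. (shift d L (fst p) (u a), snd p) \<in> W \<union> H} \<le> card (W \<union> H)"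
    proof (rule card_inj_on_le[of "\<lambda>a. (shift d L (fst p) (u a), snd p)"])
      show "inj_on (\<lambda>a. (shift d L (fst p) (u a), snd p)) {a \<in> cells d r. (shift d L (fst p) (u a), snd p) \<in> W \<union> H}"
        using inj[of "fst p"] by (auto simp: inj_on_def)
    qed (use fin in auto)
    also have "\<dots> \<le> 2 * card W" using card_Un_le[of W H] HW by simp
    finally have 1: "card {a \<in> cells d r. (shift d L (fst p) (u a), snd p) \<in> W \<union> H} \<le> 2 * card W" .
    define X Y where "X = {a \<in> cells d r. (shift d L (fst p) (u a), snd p) \<in> V}"
      and "Y = {a \<in> cells d r. (shift d L (fst p) (u a), snd p) \<in> W \<union> H}"
    have "cells d r = X \<union> Y"
      using shift_cells[OF L] k part(1) unfolding lsites_def X_def Y_def by blast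
    then have "card (cells d r) \<le> card X + card Y" by (simp add: card_Un_le)
    then have "r ^ d \<le> card X + card Y" unfolding card_cells .
    then have "r ^ d \<le> 2 * card X" using 1 r(2) unfolding Y_def[symmetric] by linarith
    then show ?thesis unfolding X_def .
  qed
  then have "card W * r ^ d \<le> (\<Sum>p\<in>W. 2 * card {a \<in> cells d r. (shift d L (fst p) (u a), snd p) \<in> V})"
    using sum_mono[of W "\<lambda>_. r ^ d"] by simp
  also have "\<dots> = 2 * card S" by (simp add: cS sum_distrib_left)
  also have "\<dots> \<le> (2 * card K * d * n0 * r * card H) * r ^ d" using up by (simp add: mult_ac)
  finally show ?thesis using r(3) by simp
qed

text \<open>The length must be of order L with one constant for all L. Loops first bring the
  displacement of some walk to its residue modulo N; the finitely many residues that occur have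
  walks of bounded length. Loops with coefficients reduced modulo L then restore the displacement
  modulo L.\<close>

lemma torus_walks:
  assumes loop: "\<And>k i. k \<in> K \<Longrightarrow> i < d \<Longrightarrow> \<exists>n\<le>n0. walk T k (\<lambda>j. if j = i then int N else 0) k n" and N: "N > 0"
  shows "\<exists>C. \<forall>L k k' \<delta>. connected_torus L \<longrightarrow> L > 0 \<longrightarrow> k \<in> K \<longrightarrow> k' \<in> K \<longrightarrow> \<delta> \<in> cells d L \<longrightarrow>
    (\<exists>u n. walk T k u k' n \<and> n \<le> C * L \<and> (\<forall>i<d. u i mod int L = \<delta> ! i))"
proof -
  define A where "A = {(k, k', \<rho>). k \<in> K \<and> k' \<in> K \<and> \<rho> \<in> cells d N \<and> (\<exists>n. walk T k (vec \<rho>) k' n)}"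
  have "finite A" by (rule finite_subset[of _ "K \<times> K \<times> cells d N"]) (auto simp: A_def finite_K finite_cells)
  then have "\<exists>n1. \<forall>p\<in>A. \<exists>n\<le>n1. walk T (fst p) (vec (snd (snd p))) (fst (snd p)) n"
    by (rule finite_bounded_witness) (auto simp: A_def)
  then obtain n1 where n1: "\<And>k k' \<rho>. (k, k', \<rho>) \<in> A \<Longrightarrow> \<exists>n\<le>n1. walk T k (vec \<rho>) k' n" by fastforce
  have "\<exists>u n. walk T k u k' n \<and> n \<le> (n1 + d * n0) * L \<and> (\<forall>i<d. u i mod int L = \<delta> ! i)"
    if c: "connected_torus L" "L > 0" and k: "k \<in> K" "k' \<in> K" and \<delta>: "\<delta> \<in> cells d L" for L k k' \<delta>
  proof -
    obtain u0 m where u0: "walk T k u0 k' m" "\<forall>i<d. u0 i mod int L = \<delta> ! i"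
      using connected_torus_walk[OF c k \<delta>] by blast
    define \<rho> where "\<rho> = map (\<lambda>i. u0 i mod int N) [0..<d]"
    have \<rho>: "\<rho> \<in> cells d N" using N by (simp add: \<rho>_def cells_def)
    have v\<rho>: "vec \<rho> = (\<lambda>j. u0 j + (if j < d then int N * (- (u0 j div int N)) else 0))"
      using walk_supp[OF u0(1)] by (auto simp: \<rho>_def vec_def fun_eq_iff not_less minus_mult_div_eq_mod)
    define b where "b = Max ((\<lambda>j. \<bar>u0 j div int N\<bar>) ` {..<d})"
    have b: "\<bar>- (u0 j div int N)\<bar> \<le> int (nat b)" if "j < d" for j
    proof -
      have "\<bar>u0 j div int N\<bar> \<le> b" unfolding b_def using that by (intro Max_ge) auto
      then show ?thesis by simp
    qed
    obtain m' where "walk T k' (\<lambda>j. if j < d then int N * (- (u0 j div int N)) else 0) k' m'"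
      using walk_coordinates[of d n0 T k' "int N" "\<lambda>j. - (u0 j div int N)" "nat b" d] loop k b by blast
    then have "walk T k (vec \<rho>) k' (m + m')" unfolding v\<rho> by (rule walk_trans[OF _ u0(1)])
    then have "(k, k', \<rho>) \<in> A" using k \<rho> by (auto simp: A_def)
    then obtain n where n: "n \<le> n1" "walk T k (vec \<rho>) k' n" using n1 by blast
    define a where "a j = (u0 j div int N) mod int L" for j
    have a: "\<bar>a j\<bar> \<le> int L" for j using c(2) by (simp add: a_def less_imp_le)
    obtain n' where n': "n' \<le> d * L * n0" "walk T k' (\<lambda>j. if j < d then int N * a j else 0) k' n'"
      using walk_coordinates[of d n0 T k' "int N" a L d] loop k a by blast
    have "walk T k (\<lambda>j. vec \<rho> j + (if j < d then int N * a j else 0)) k' (n + n')" by (rule walk_trans[OF n'(2) n(2)])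
    moreover have "n + n' \<le> (n1 + d * n0) * L"
    proof -
      have "n \<le> n1 * L" using n(1) c(2) by (metis One_nat_def Suc_leI le_trans mult_le_mono2 mult.right_neutral)
      then show ?thesis using n'(1) by (simp add: algebra_simps)
    qed
    moreover have "(vec \<rho> i + (if i < d then int N * a i else 0)) mod int L = \<delta> ! i" if "i < d" for i
    proof -
      have "(vec \<rho> i + int N * a i) mod int L = (u0 i mod int N + int N * (u0 i div int N)) mod int L"
      proof -
        have "(int N * a i) mod int L = (int N * (u0 i div int N)) mod int L"
          unfolding a_def by (rule mod_mult_right_eq)
        then show ?thesis using that by (simp add: vec_def \<rho>_def mod_add_cong)
      qed
      then show ?thesis using u0(2) that by simp
    qed
    ultimately show ?thesis by blast
  qed
  then show ?thesis by blast
qed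

text \<open>Each pair in W x V is joined by a walk of length at most C L, one walk for each
  displacement and pair of sites in the cell; \<open>crossing\<close> bounds the pairs served by one
  walk by C L \<open>card H\<close>.\<close>

lemma large_set:
  assumes L: "L > 0" and part: "W \<union> V \<union> H = lsites d L K" "W \<inter> V = {}"
    and noE: "\<forall>x\<in>W. \<forall>y\<in>V. (x, y) \<notin> symE (lbonds d L T)"
    and walks: "\<And>k k' \<delta>. k \<in> K \<Longrightarrow> k' \<in> K \<Longrightarrow> \<delta> \<in> cells d L \<Longrightarrow>
      \<exists>u n. walk T k u k' n \<and> n \<le> C * L \<and> (\<forall>i<d. u i mod int L = \<delta> ! i)"
  shows "card W * card V \<le> (card K)\<^sup>2 * L ^ d * (C * L * card H)"
proof -
  have fin: "finite W" "finite V" "finite H" using part(1) finite_lsites by (metis finite_Un)+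
  define S where "S = (SIGMA k:K. SIGMA k':K. SIGMA \<delta>:cells d L. {x \<in> cells d L. (x, k) \<in> W \<and> (shift d L x (vec \<delta>), k') \<in> V})"
  have finS: "finite S" unfolding S_def by (intro finite_SigmaI) (auto simp: finite_K finite_cells)
  have "W \<times> V \<subseteq> (\<lambda>(k, k', \<delta>, x). ((x, k), (shift d L x (vec \<delta>), k'))) ` S"
  proof
    fix p assume "p \<in> W \<times> V"
    then obtain x k y k' where p: "p = ((x, k), (y, k'))" "(x, k) \<in> W" "(y, k') \<in> V" by auto
    then have m: "x \<in> cells d L" "y \<in> cells d L" "k \<in> K" "k' \<in> K" using part(1) by (auto simp: lsites_def)
    define \<delta> where "\<delta> = shift d L y (\<lambda>i. - vec x i)"
    have \<delta>: "\<delta> \<in> cells d L" using shift_cells[OF L] by (simp add: \<delta>_def)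
    have "shift d L x (vec \<delta>) = y"
      using cells_D[OF m(1)] cells_D[OF m(2)] cells_D[OF \<delta>]
      by (intro nth_equalityI) (auto simp: nth_shift vec_def \<delta>_def mod_simps)
    then show "p \<in> (\<lambda>(k, k', \<delta>, x). ((x, k), (shift d L x (vec \<delta>), k'))) ` S"
      using p m \<delta> by (intro image_eqI[of _ _ "(k, k', \<delta>, x)"]) (auto simp: S_def)
  qed
  then have "card (W \<times> V) \<le> card S" using finS by (meson card_image_le card_mono finite_imageI order_trans)
  also have "card S = (\<Sum>k\<in>K. \<Sum>k'\<in>K. \<Sum>\<delta>\<in>cells d L. card {x \<in> cells d L. (x, k) \<in> W \<and> (shift d L x (vec \<delta>), k') \<in> V})"
    by (simp add: S_def card_SigmaI finite_K finite_cells)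
  also have "\<dots> \<le> (\<Sum>k\<in>K. \<Sum>k'\<in>K. \<Sum>\<delta>\<in>cells d L. C * L * card H)"
  proof (intro sum_mono)
    fix k k' \<delta> assume k: "k \<in> K" "k' \<in> K" "\<delta> \<in> cells d L"
    then obtain u n where u: "walk T k u k' n" "n \<le> C * L" "\<forall>i<d. u i mod int L = \<delta> ! i" using walks by blast
    have e: "shift d L x (vec \<delta>) = shift d L x u" for x
      by (rule shift_cong) (use u(3) cells_D[OF k(3)] in \<open>auto simp: vec_def\<close>)
    have "n * card H \<le> C * L * card H" by (rule mult_right_mono[OF u(2)]) simp
    then show "card {x \<in> cells d L. (x, k) \<in> W \<and> (shift d L x (vec \<delta>), k') \<in> V} \<le> C * L * card H"
      unfolding e by (rule order_trans[OF crossing[OF L part noE u(1)]])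
  qed
  also have "\<dots> = (card K)\<^sup>2 * L ^ d * (C * L * card H)" by (simp add: card_cells power2_eq_square mult_ac)
  finally show ?thesis by (simp add: card_cartesian_product)
qed

lemma symE_lsites:
  assumes "(p, q) \<in> symE (lbonds d L T)" "L > 0"
  shows "p \<in> lsites d L K" "q \<in> lsites d L K"
proof -
  have "a \<in> lsites d L K \<and> b \<in> lsites d L K" if ab: "(a, b) \<in> lbonds d L T" for a b
  proof -
    obtain x k k' v where e: "a = (x, k)" "b = (shift d L x (vec v), k')" "x \<in> cells d L" "(k, k', v) \<in> T"
      using ab unfolding lbonds_shift by blast
    then show ?thesis using T_D[OF e(4)] shift_cells[OF assms(2)] by (simp add: lsites_def)
  qed
  then show "p \<in> lsites d L K" "q \<in> lsites d L K" using assms(1) unfolding symE_def by blast+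
qed

lemma lsites_nonempty: "p \<in> lsites d L K \<Longrightarrow> L > 0"
proof -
  assume "p \<in> lsites d L K"
  then have "fst p \<in> cells d L" by (auto simp: lsites_def)
  then have "0 \<le> fst p ! 0 \<and> fst p ! 0 < int L" using cells_D(2) d by auto
  then show ?thesis by linarith
qed

lemma separator_nonempty:
  assumes con: "connected_torus L" and part: "W \<union> V \<union> H = lsites d L K" "W \<inter> V = {}"
    and noE: "\<forall>x\<in>W. \<forall>y\<in>V. (x, y) \<notin> symE (lbonds d L T)" and ne: "W \<noteq> {}" "V \<noteq> {}"
  shows "card H > 0"
proof (rule ccontr)
  assume "\<not> card H > 0"
  moreover have "finite H" using part(1) finite_lsites by (metis finite_Un)
  ultimately have H: "H = {}" by simp
  obtain p q where pq: "p \<in> W" "q \<in> V" using ne by blast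
  then have m: "p \<in> lsites d L K" "q \<in> lsites d L K" using part(1) by blast+
  then have "(p, q) \<in> (symE (lbonds d L T))\<^sup>*" using con unfolding connected_torus_def by blast
  then have "q \<in> W"
  proof (induction rule: rtrancl_induct)
    case (step y z)
    then have "z \<in> lsites d L K" using symE_lsites lsites_nonempty[OF m(1)] by blast
    then show ?case using step noE part(1) H by blast
  qed (rule pq(1))
  then show False using pq part(2) by blast
qed

text \<open>Boxes of side r of order |W|^(1/d), scaled by N, either fit into the torus, where
  \<open>small_set\<close> applies, or L is itself at most of order |W|^(1/d), and then
  \<open>large_set\<close> with |V| \<ge> |W| gives the same bound.\<close>

lemma isoperimetry_large_torus:
  assumes con0: "connected_torus L0" "L0 \<ge> 2"
  shows "\<exists>Z>0. \<forall>L W V H. connected_torus L \<longrightarrow> L > 0 \<longrightarrow> W \<union> V \<union> H = lsites d L K \<longrightarrow> W \<inter> V = {} \<longrightarrow>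
    (\<forall>x\<in>W. \<forall>y\<in>V. (x, y) \<notin> symE (lbonds d L T)) \<longrightarrow> W \<noteq> {} \<longrightarrow> card W \<le> card V \<longrightarrow>
    real (card W) \<le> Z * real (card W) powr (1 / real d) * real (card H)"
proof -
  obtain N n0 where N: "N > 0" and loop: "\<And>k i. k \<in> K \<Longrightarrow> i < d \<Longrightarrow> \<exists>n\<le>n0. walk T k (\<lambda>j. if j = i then int N else 0) k n"
    using loops[OF con0] by blast
  obtain C where C: "\<And>L k k' \<delta>. connected_torus L \<Longrightarrow> L > 0 \<Longrightarrow> k \<in> K \<Longrightarrow> k' \<in> K \<Longrightarrow> \<delta> \<in> cells d L \<Longrightarrow>
    \<exists>u n. walk T k u k' n \<and> n \<le> C * L \<and> (\<forall>i<d. u i mod int L = \<delta> ! i)"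
    using torus_walks[OF loop N] by blast
  \<comment> \<open>One summand for each case: H larger than W, a box that fits, a box that does
    not.\<close>
  define Z where "Z = 1 + real (10 * card K * d * n0) + real ((card K)\<^sup>2 * C) * (5 * real N) ^ (d + 1)"
  have Z: "Z > 0" "1 \<le> Z" "real (10 * card K * d * n0) \<le> Z" "real ((card K)\<^sup>2 * C) * (5 * real N) ^ (d + 1) \<le> Z"
  proof -
    have "0 \<le> real (10 * card K * d * n0)" "0 \<le> real ((card K)\<^sup>2 * C) * (5 * real N) ^ (d + 1)"
      by (rule of_nat_0_le_iff, intro mult_nonneg_nonneg zero_le_power) auto
    then show "Z > 0" "1 \<le> Z" "real (10 * card K * d * n0) \<le> Z" "real ((card K)\<^sup>2 * C) * (5 * real N) ^ (d + 1) \<le> Z"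
      unfolding Z_def by linarith+
  qed
  have "real (card W) \<le> Z * real (card W) powr (1 / real d) * real (card H)"
    if c: "connected_torus L" "L > 0" and part: "W \<union> V \<union> H = lsites d L K" "W \<inter> V = {}"
      and noE: "\<forall>x\<in>W. \<forall>y\<in>V. (x, y) \<notin> symE (lbonds d L T)" and ne: "W \<noteq> {}" and WV: "card W \<le> card V"
    for L W V H
  proof -
    have "finite W" using part(1) finite_lsites by (metis finite_Un)
    then have w1: "1 \<le> real (card W)" using ne by (simp add: Suc_leI card_gt_0_iff)
    define w where "w = real (card W)"
    define q where "q = w powr (1 / real d)"
    define h where "h = real (card H)"
    have h0: "h \<ge> 0" by (simp add: h_def)
    have q1: "1 \<le> q" unfolding q_def w_def using w1 by (intro ge_one_powr_ge_zero) auto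
    have qd: "q ^ d = w" using w1 d by (simp add: q_def w_def powr_realpow[symmetric] powr_powr)
    \<comment> \<open>Then r^d is at least 4^d \<open>card W\<close>, and rounding up costs at most
      1 \<le> q.\<close>
    define r where "r = nat \<lceil>4 * q\<rceil>"
    have r: "4 * q \<le> real r" "real r \<le> 5 * q" "r > 0"
      using q1 unfolding r_def by linarith+
    have zq: "z * q * h \<le> Z * q * h" if "z \<le> Z" for z
      using that q1 h0 by (intro mult_right_mono) auto
    have "w \<le> Z * q * h"
    proof (cases "card H \<le> card W")
      case False
      then have "w \<le> h" by (simp add: w_def h_def)
      also have "h \<le> 1 * q * h" using mult_right_mono[OF q1 h0] by simp
      also have "\<dots> \<le> Z * q * h" using zq[OF Z(2)] .
      finally show ?thesis .
    next
      case HW: True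
      show ?thesis
      proof (cases "N * r \<le> L")
        case True
        have "4 * w \<le> 4 ^ d * w" using d w1 self_le_power[of "4::real" d] by (intro mult_right_mono) (auto simp: w_def)
        also have "\<dots> = (4 * q) ^ d" by (simp add: power_mult_distrib qd)
        also have "\<dots> \<le> real r ^ d" using r q1 by (intro power_mono) auto
        finally have "4 * card W \<le> r ^ d" unfolding w_def by (metis of_nat_le_iff of_nat_mult of_nat_numeral of_nat_power)
        then have "card W \<le> 2 * card K * d * n0 * r * card H"
          using small_set[OF c(2) part noE loop N True _ r(3) HW] by blast
        then have "w \<le> real (2 * card K * d * n0) * real r * h"
          unfolding w_def h_def by (metis of_nat_le_iff of_nat_mult)
        also have "\<dots> \<le> real (2 * card K * d * n0) * (5 * q) * h"
          using r(2) h0 by (intro mult_right_mono mult_left_mono) auto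
        also have "\<dots> = real (10 * card K * d * n0) * q * h" by simp
        also have "\<dots> \<le> Z * q * h" by (rule zq[OF Z(3)])
        finally show ?thesis .
      next
        case False
        then have "real L \<le> real N * real r" by (metis linear of_nat_le_iff of_nat_mult)
        also have "\<dots> \<le> real N * (5 * q)" using r(2) by (intro mult_left_mono) auto
        finally have Lq: "real L \<le> 5 * real N * q" by simp
        have "card W * card W \<le> card W * card V" using WV by simp
        also have "\<dots> \<le> (card K)\<^sup>2 * L ^ d * (C * L * card H)"
          by (rule large_set[OF c(2) part noE C[OF c]])
        also have "\<dots> = (card K)\<^sup>2 * C * L ^ (d + 1) * card H" by simp
        finally have "w * w \<le> real ((card K)\<^sup>2 * C) * real L ^ (d + 1) * h"
          unfolding w_def h_def by (metis of_nat_le_iff of_nat_mult of_nat_power)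
        also have "\<dots> \<le> real ((card K)\<^sup>2 * C) * (5 * real N * q) ^ (d + 1) * h"
          using Lq h0 by (intro mult_right_mono mult_left_mono power_mono) auto
        also have "\<dots> = (real ((card K)\<^sup>2 * C) * (5 * real N) ^ (d + 1)) * q * h * w"
          by (simp add: power_mult_distrib qd[symmetric])
        also have "\<dots> \<le> Z * q * h * w" by (rule mult_right_mono[OF zq[OF Z(4)]]) (simp add: w_def)
        finally show ?thesis using w1 by (simp add: w_def)
      qed
    qed
    then show ?thesis by (simp add: w_def q_def h_def)
  qed
  then show ?thesis using Z(1) by blast
qed

text \<open>If no torus with L at least 2 is connected, only L = 1 is left: W has at most
  \<open>card K\<close> sites, and H is nonempty by connectedness. The smaller of W and V takes the
  place of W, and dividing by |W|^(1/d) leaves the exponent 1 - 1/d.\<close>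

lemma isoperimetry:
  "\<exists>c>0. \<forall>L W V H m. connected_torus L \<longrightarrow> W \<union> V \<union> H = lsites d L K \<longrightarrow> W \<inter> V = {} \<longrightarrow>
    (\<forall>x\<in>W. \<forall>y\<in>V. (x, y) \<notin> symE (lbonds d L T)) \<longrightarrow> 0 < m \<longrightarrow> m \<le> real (card W) \<longrightarrow> m \<le> real (card V) \<longrightarrow>
    c * m powr ((real d - 1) / real d) \<le> real (card H)"
proof -
  let ?ok = "\<lambda>Z L W H. real (card W) \<le> Z * real (card W) powr (1 / real d) * real (card H)"
  have "\<exists>Z>0. \<forall>L W V H. connected_torus L \<longrightarrow> L > 0 \<longrightarrow> W \<union> V \<union> H = lsites d L K \<longrightarrow> W \<inter> V = {} \<longrightarrow>
    (\<forall>x\<in>W. \<forall>y\<in>V. (x, y) \<notin> symE (lbonds d L T)) \<longrightarrow> W \<noteq> {} \<longrightarrow> card W \<le> card V \<longrightarrow> ?ok Z L W H"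
  proof (cases "\<exists>L0\<ge>2. connected_torus L0")
    case True
    then show ?thesis using isoperimetry_large_torus by blast
  next
    case False
    have "?ok (real (card K) + 1) L W H"
      if c: "connected_torus L" "L > 0" and part: "W \<union> V \<union> H = lsites d L K" "W \<inter> V = {}"
        and noE: "\<forall>x\<in>W. \<forall>y\<in>V. (x, y) \<notin> symE (lbonds d L T)" and ne: "W \<noteq> {}" and WV: "card W \<le> card V"
      for L W V H
    proof -
      have "L = 1" using False c by (metis One_nat_def Suc_leI le_neq_implies_less one_add_one plus_1_eq_Suc)
      have fin: "finite W" using part(1) finite_lsites by (metis finite_Un)
      then have "card W > 0" using ne by (simp add: card_gt_0_iff)
      then have "V \<noteq> {}" using WV by auto
      then have h: "1 \<le> real (card H)" using separator_nonempty[OF c(1) part noE ne] by simp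
      have q: "1 \<le> real (card W) powr (1 / real d)"
        using \<open>card W > 0\<close> by (intro ge_one_powr_ge_zero) auto
      have "card W \<le> card (lsites d L K)" using part(1) finite_lsites by (intro card_mono) auto
      then have "real (card W) \<le> (real (card K) + 1) * 1 * 1" using \<open>L = 1\<close> by (simp add: card_lsites)
      also have "\<dots> \<le> (real (card K) + 1) * real (card W) powr (1 / real d) * real (card H)"
        using h q by (intro mult_mono) auto
      finally show ?thesis .
    qed
    then show ?thesis by (intro exI[of _ "real (card K) + 1"]) auto
  qed
  then obtain Z where Z: "Z > 0" and ok: "\<And>L W V H. connected_torus L \<Longrightarrow> L > 0 \<Longrightarrow> W \<union> V \<union> H = lsites d L K \<Longrightarrow> W \<inter> V = {} \<Longrightarrow>
    (\<forall>x\<in>W. \<forall>y\<in>V. (x, y) \<notin> symE (lbonds d L T)) \<Longrightarrow> W \<noteq> {} \<Longrightarrow> card W \<le> card V \<Longrightarrow> ?ok Z L W H" by blast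
  have one: "1 / Z * m powr ((real d - 1) / real d) \<le> real (card H)"
    if c: "connected_torus L" and part: "W \<union> V \<union> H = lsites d L K" "W \<inter> V = {}"
      and noE: "\<forall>x\<in>W. \<forall>y\<in>V. (x, y) \<notin> symE (lbonds d L T)" and m: "0 < m" "m \<le> real (card W)" and WV: "card W \<le> card V"
    for L W V H and m :: real
  proof -
    have ne: "W \<noteq> {}" using m by auto
    then have L: "L > 0" using lsites_nonempty part(1) by blast
    define w where "w = real (card W)"
    define q where "q = w powr (1 / real d)"
    have w: "w > 0" "q > 0" using m by (auto simp: w_def q_def)
    have "w \<le> Z * q * real (card H)" using ok[OF c L part noE ne WV] by (simp add: w_def q_def)
    then have "w / q \<le> Z * real (card H)" using w by (simp add: field_simps)
    moreover have "w powr ((real d - 1) / real d) = w / q"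
    proof -
      have "(real d - 1) / real d = 1 - 1 / real d" using d by (simp add: field_simps)
      then show ?thesis using w by (simp add: powr_diff q_def)
    qed
    moreover have "m powr ((real d - 1) / real d) \<le> w powr ((real d - 1) / real d)"
      using m d by (intro powr_mono2) (auto simp: w_def)
    ultimately have "m powr ((real d - 1) / real d) \<le> Z * real (card H)" by linarith
    then show ?thesis using Z by (simp add: field_simps)
  qed
  have "1 / Z * m powr ((real d - 1) / real d) \<le> real (card H)"
    if c: "connected_torus L" and part: "W \<union> V \<union> H = lsites d L K" "W \<inter> V = {}"
      and noE: "\<forall>x\<in>W. \<forall>y\<in>V. (x, y) \<notin> symE (lbonds d L T)" and m: "0 < m" "m \<le> real (card W)" "m \<le> real (card V)"
    for L W V H and m :: real
  proof (cases "card W \<le> card V")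
    case True
    then show ?thesis using one[OF c part noE m(1,2)] by blast
  next
    case False
    have "V \<union> W \<union> H = lsites d L K" "V \<inter> W = {}" "\<forall>x\<in>V. \<forall>y\<in>W. (x, y) \<notin> symE (lbonds d L T)"
      using part noE by (auto simp: symE_def)
    then show ?thesis using one[OF c _ _ _ m(1,3)] False by simp
  qed
  then show ?thesis using Z by (intro exI[of _ "1 / Z"]) auto
qed

end

section \<open>Trial orbitals for the holes\<close>

text \<open>A tent of height about l / 2 repeated with period L. For l \<le> L the summand 1 in
  \<open>s mod L + 1\<close> makes it positive exactly on the residues 0, ..., l - 1.\<close>

definition tent :: "int \<Rightarrow> int \<Rightarrow> int \<Rightarrow> int" where
  "tent L l s = max 0 (min (s mod L + 1) (l - s mod L))"

lemma tent_mod [simp]: "tent L l (s mod L) = tent L l s"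
  by (simp add: tent_def)

text \<open>The delicate place is the seam at L - 1, where the tent has value 0 or, for l = L, value
  1 before it restarts at 1.\<close>

lemma tent_step:
  assumes "0 < l" "l \<le> L"
  shows "\<bar>tent L l (s + 1) - tent L l s\<bar> \<le> 1"
proof -
  have b: "0 \<le> s mod L" "s mod L < L" using assms by auto
  have e: "(s + 1) mod L = (s mod L + 1) mod L" by (simp add: mod_add_left_eq)
  show ?thesis
  proof (cases "s mod L = L - 1")
    case True
    then have "(s + 1) mod L = 0" unfolding e by simp
    then show ?thesis unfolding tent_def using True assms by (simp add: max_def min_def)
  next
    case False
    then have "(s + 1) mod L = s mod L + 1" unfolding e using b by simp
    then show ?thesis unfolding tent_def by (simp add: max_def min_def)
  qed
qed

lemma tent_lipschitz:
  assumes "0 < l" "l \<le> L"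
  shows "\<bar>tent L l (s + v) - tent L l s\<bar> \<le> \<bar>v\<bar>"
proof -
  have pos: "\<bar>tent L l (s + int m) - tent L l s\<bar> \<le> int m" for m s
  proof (induction m)
    case (Suc m)
    have "\<bar>tent L l (s + int m + 1) - tent L l (s + int m)\<bar> \<le> 1" using tent_step[OF assms] .
    then show ?case using Suc by (simp add: add.assoc add.commute[of 1])
  qed simp
  show ?thesis
  proof (cases "v \<ge> 0")
    case True
    then show ?thesis using pos[of s "nat v"] by simp
  next
    case False
    then show ?thesis using pos[of "s + v" "nat (- v)"] by simp
  qed
qed

context lattice_data
begin

text \<open>A pyramid on the box of side l. Taking the minimum over coordinates keeps the Lipschitz
  constant 1 of the tents.\<close>

definition bump :: "nat \<Rightarrow> nat \<Rightarrow> int list \<Rightarrow> int" where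
  "bump L l x = Min ((\<lambda>i. tent (int L) (int l) (x ! i)) ` {..<d})"

lemma bump_le: "i < d \<Longrightarrow> bump L l x \<le> tent (int L) (int l) (x ! i)"
  unfolding bump_def by (intro Min_le) auto

lemma bump_attained: "\<exists>i<d. bump L l x = tent (int L) (int l) (x ! i)"
proof -
  have "0 \<in> {..<d}" using d by simp
  then have "{..<d} \<noteq> {}" by blast
  then have "bump L l x \<in> (\<lambda>i. tent (int L) (int l) (x ! i)) ` {..<d}"
    unfolding bump_def by (intro Min_in) auto
  then show ?thesis by auto
qed

lemma bump_nonneg: "bump L l x \<ge> 0"
  using bump_attained[of L l x] by (auto simp: tent_def)

lemma bump_support:
  assumes "bump L l x \<noteq> 0" "i < d"
  shows "x ! i mod int L < int l"
proof -
  have "tent (int L) (int l) (x ! i) > 0" using bump_le[OF assms(2), of L l x] bump_nonneg[of L l x] assms(1) by linarith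
  then show ?thesis by (auto simp: tent_def)
qed

lemma bump_lipschitz:
  assumes "0 < l" "l \<le> L" "\<And>i. i < d \<Longrightarrow> \<bar>u i\<bar> \<le> D"
  shows "\<bar>bump L l (shift d L x u) - bump L l x\<bar> \<le> D"
proof -
  have t: "\<bar>tent (int L) (int l) (shift d L x u ! i) - tent (int L) (int l) (x ! i)\<bar> \<le> D" if "i < d" for i
    using tent_lipschitz[of "int l" "int L" "x ! i" "u i"] assms that by (force simp: nth_shift)
  obtain i where i: "i < d" "bump L l x = tent (int L) (int l) (x ! i)" using bump_attained by blast
  obtain j where j: "j < d" "bump L l (shift d L x u) = tent (int L) (int l) (shift d L x u ! j)" using bump_attained by blast
  show ?thesis
    using bump_le[OF i(1), of L l "shift d L x u"] bump_le[OF j(1), of L l x] t[OF i(1)] t[OF j(1)] i(2) j(2) by linarith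
qed

lemma card_bump_support:
  "card {x \<in> cells d L. bump L l x \<noteq> 0} \<le> l ^ d"
proof -
  have "{x \<in> cells d L. bump L l x \<noteq> 0} \<subseteq> cells d l"
  proof
    fix x assume x: "x \<in> {x \<in> cells d L. bump L l x \<noteq> 0}"
    then have "x ! i < int l" if "i < d" for i using bump_support[of L l x i] that by (auto simp: cells_def)
    then show "x \<in> cells d l" using x by (auto simp: cells_def)
  qed
  then show ?thesis using card_mono[OF finite_cells] card_cells by metis
qed

text \<open>On the middle half of the box, which has at least (l / 2)^d points, the pyramid is at
  least l / 4.\<close>

lemma bump_norm_lower:
  assumes "0 < l" "l \<le> L"
  shows "real l ^ (d + 2) / (16 * 2 ^ d) \<le> (\<Sum>x\<in>cells d L. (real_of_int (bump L l x))\<^sup>2)"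
proof -
  define a b where "a = l div 4" and "b = 3 * l div 4"
  define J where "J = {int a..int b}"
  define Q where "Q = {x. set x \<subseteq> J \<and> length x = d}"
  have finJ: "finite J" by (simp add: J_def)
  have ab: "4 * a \<le> l" "l < 4 * a + 4" "4 * b \<le> 3 * l" "3 * l < 4 * b + 4"
    unfolding a_def b_def by simp_all
  have cJ: "real l / 2 \<le> real (card J)"
  proof -
    have "card J = nat (int b - int a + 1)" by (simp add: J_def)
    then have "real l \<le> 2 * real (card J)" using ab by linarith
    then show ?thesis by simp
  qed
  have J: "0 \<le> s" "s < int l" "int l \<le> 4 * tent (int L) (int l) s" if "s \<in> J" for s
  proof -
    have s: "int a \<le> s" "s \<le> int b" using that by (auto simp: J_def)
    have abi: "int l < 4 * int a + 4" "4 * int b \<le> 3 * int l" using ab by linarith+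
    show s0: "0 \<le> s" using s by linarith
    show sl: "s < int l" using s ab assms(1) by linarith
    have "s mod int L = s" using s0 sl assms by simp
    moreover have "int l \<le> 4 * (s + 1)" using s(1) abi(1) by presburger
    moreover have "int l \<le> 4 * (int l - s)" using s(2) abi(2) by presburger
    ultimately show "int l \<le> 4 * tent (int L) (int l) s" unfolding tent_def by (simp add: max_def min_def)
  qed
  have QC: "Q \<subseteq> cells d L"
  proof
    fix x assume x: "x \<in> Q"
    then have "x ! i \<in> J" if "i < d" for i using that by (auto simp: Q_def)
    then have "0 \<le> x ! i" "x ! i < int L" if "i < d" for i using J[of "x ! i"] that assms by force+
    then show "x \<in> cells d L" using x by (auto simp: cells_def Q_def)
  qed
  have big: "(real l / 4)\<^sup>2 \<le> (real_of_int (bump L l x))\<^sup>2" if x: "x \<in> Q" for x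
  proof -
    obtain i where i: "i < d" "bump L l x = tent (int L) (int l) (x ! i)" using bump_attained by blast
    have "x ! i \<in> J" using x i by (auto simp: Q_def)
    then have "int l \<le> 4 * bump L l x" using J(3) i(2) by simp
    then have "real l / 4 \<le> real_of_int (bump L l x)" by linarith
    then show ?thesis by (intro power_mono) auto
  qed
  have "real l ^ (d + 2) / (16 * 2 ^ d) = (real l / 2) ^ d * (real l / 4)\<^sup>2"
    by (simp add: power_divide power_add power2_eq_square mult_ac)
  also have "\<dots> \<le> real (card J) ^ d * (real l / 4)\<^sup>2"
    using cJ by (intro mult_right_mono power_mono) auto
  also have "\<dots> = (\<Sum>x\<in>Q. (real l / 4)\<^sup>2)"
    using card_lists_length_eq[OF finJ, of d] by (simp add: Q_def)
  also have "\<dots> \<le> (\<Sum>x\<in>Q. (real_of_int (bump L l x))\<^sup>2)" by (rule sum_mono) (rule big)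
  also have "\<dots> \<le> (\<Sum>x\<in>cells d L. (real_of_int (bump L l x))\<^sup>2)"
    by (rule sum_mono2[OF finite_cells QC]) simp
  finally show ?thesis .
qed

lemma sum_cells_shift:
  assumes "L > 0"
  shows "(\<Sum>x\<in>cells d L. h (shift d L x u)) = (\<Sum>x\<in>cells d L. (h x :: real))"
  by (rule sum.reindex_bij_witness[of _ "\<lambda>x. shift d L x (\<lambda>i. - u i)" "\<lambda>x. shift d L x u"])
    (use assms in \<open>auto simp: shift_inverse shift_inverse' shift_cells\<close>)

lemma step_bound: "\<exists>D::nat. \<forall>(k, k', v)\<in>T. \<forall>i<d. \<bar>vec v i\<bar> \<le> int D"
proof -
  have "\<exists>D. \<forall>p\<in>T \<times> {..<d}. \<exists>n\<le>D. \<bar>vec (snd (snd (fst p))) (snd p)\<bar> \<le> int n"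
  proof (rule finite_bounded_witness)
    fix p :: "('k \<times> 'k \<times> int list) \<times> nat"
    show "\<exists>n. \<bar>vec (snd (snd (fst p))) (snd p)\<bar> \<le> int n"
      by (rule exI[of _ "nat \<bar>vec (snd (snd (fst p))) (snd p)\<bar>"]) simp
  qed (use finite_T in auto)
  then obtain D where D: "\<And>p. p \<in> T \<times> {..<d} \<Longrightarrow> \<exists>n\<le>D. \<bar>vec (snd (snd (fst p))) (snd p)\<bar> \<le> int n" by blast
  have "\<bar>vec v i\<bar> \<le> int D" if "(k, k', v) \<in> T" "i < d" for k k' v i
    using D[of "((k, k', v), i)"] that by force
  then show ?thesis by (intro exI[of _ D]) auto
qed

text \<open>The difference is nonzero only on the support and its translate, at most 2 l^d cells,
  where it is at most D.\<close>

lemma bump_gradient: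
  assumes L: "0 < l" "l \<le> L" and v: "\<And>i. i < d \<Longrightarrow> \<bar>v i\<bar> \<le> int D"
  shows "(\<Sum>x\<in>cells d L. (real_of_int (bump L l x) - real_of_int (bump L l (shift d L x v)))\<^sup>2) \<le> 2 * (real D)\<^sup>2 * real l ^ d"
proof -
  have L0: "L > 0" using L by simp
  define S where "S = {x \<in> cells d L. bump L l x \<noteq> 0}"
  define S' where "S' = {x \<in> cells d L. bump L l (shift d L x v) \<noteq> 0}"
  have fS: "finite S" "finite S'" by (auto simp: S_def S'_def finite_cells)
  have cS: "card S \<le> l ^ d" unfolding S_def by (rule card_bump_support)
  have "card S' \<le> card S"
    by (rule card_inj_on_le[of "\<lambda>x. shift d L x v"])
      (use inj_shift[of L v] fS L0 in \<open>auto simp: S_def S'_def inj_on_def shift_cells\<close>)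
  then have cU: "card (S \<union> S') \<le> 2 * l ^ d" using card_Un_le[of S S'] cS by linarith
  have "(\<Sum>x\<in>cells d L. (real_of_int (bump L l x) - real_of_int (bump L l (shift d L x v)))\<^sup>2)
     = (\<Sum>x\<in>S \<union> S'. (real_of_int (bump L l x) - real_of_int (bump L l (shift d L x v)))\<^sup>2)"
    by (rule sum.mono_neutral_right) (auto simp: S_def S'_def finite_cells)
  also have "\<dots> \<le> (\<Sum>x\<in>S \<union> S'. (real D)\<^sup>2)"
  proof (rule sum_mono)
    fix x
    have "\<bar>bump L l (shift d L x v) - bump L l x\<bar> \<le> int D" by (rule bump_lipschitz[OF L v])
    then have "\<bar>real_of_int (bump L l x) - real_of_int (bump L l (shift d L x v))\<bar> \<le> real D" by linarith
    then show "(real_of_int (bump L l x) - real_of_int (bump L l (shift d L x v)))\<^sup>2 \<le> (real D)\<^sup>2"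
      by (metis abs_ge_zero power2_abs power_mono)
  qed
  also have "\<dots> = real (card (S \<union> S')) * (real D)\<^sup>2" by simp
  also have "\<dots> \<le> real (2 * l ^ d) * (real D)\<^sup>2" using cU by (intro mult_right_mono) (auto simp del: of_nat_mult of_nat_power)
  finally show ?thesis by (simp add: mult_ac)
qed

text \<open>Since n boxes of side l fit into each direction without wrapping, a point of the support
  determines its box through division by l.\<close>

lemma bumps_disjoint:
  assumes L: "0 < l" "n * l \<le> L" and a: "a \<in> cells d n" "b \<in> cells d n" and x: "x \<in> cells d L"
    and nz: "bump L l (shift d L x (\<lambda>i. - (int l * vec a i))) \<noteq> 0" "bump L l (shift d L x (\<lambda>i. - (int l * vec b i))) \<noteq> 0"
  shows "a = b"
proof -
  have div: "c ! i = x ! i div int l"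
    if c: "c \<in> cells d n" and nz: "bump L l (shift d L x (\<lambda>i. - (int l * vec c i))) \<noteq> 0" and i: "i < d" for c i
  proof -
    define r where "r = (x ! i - int l * c ! i) mod int L"
    have vc: "vec c i = c ! i" using c i by (auto simp: vec_def cells_def)
    have L0: "int L > 0" using cells_D(2)[OF x i] by linarith
    have r: "0 \<le> r" "r < int l" using bump_support[OF nz i] L0 i by (auto simp: r_def nth_shift vc)
    have c0: "0 \<le> c ! i" "c ! i + 1 \<le> int n" using cells_D(2)[OF c i] by auto
    have "int l * c ! i + int l \<le> int l * int n" using mult_left_mono[OF c0(2), of "int l"] by (simp add: algebra_simps)
    also have "\<dots> \<le> int L" using L(2) by (simp add: mult.commute flip: of_nat_mult)
    finally have u: "int l * c ! i + r < int L" using r by linarith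
    have "0 \<le> int l * c ! i" using c0 by simp
    then have "int l * c ! i + r = (int l * c ! i + r) mod int L" using u r by simp
    also have "\<dots> = x ! i mod int L" unfolding r_def by (simp add: mod_simps)
    also have "\<dots> = x ! i" using cells_D(2)[OF x i] by simp
    finally have "x ! i = int l * c ! i + r" ..
    then show ?thesis using r L(1) by simp
  qed
  show ?thesis
    using a div[OF a(1) nz(1)] div[OF a(2) nz(2)] by (intro nth_equalityI) (auto simp: cells_def)
qed

text \<open>Copies of the pyramid on disjoint boxes, constant on each unit cell, are orthogonal. By
  2 f(x) f(y) = f(x)^2 + f(y)^2 - (f(x) - f(y))^2 the loss against \<zeta> is the gradient energy,
  of order l^d against a squared norm of order l^(d+2).\<close>

lemma trial_orbitals:
  "\<exists>C>0. \<forall>L n l Nh \<zeta>. bond_lattice (lsites d L K) (lbonds d L T) \<zeta> \<longrightarrow> K \<noteq> {} \<longrightarrow> 0 < n \<longrightarrow> 0 < l \<longrightarrow> n * l \<le> L \<longrightarrow> Nh \<le> n ^ d \<longrightarrow>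
    (\<exists>f. orthonormal (lsites d L K) Nh f \<and>
      real \<zeta> * real Nh - C * real Nh / (real l)\<^sup>2 \<le> (\<Sum>k<Nh. \<Sum>(x,y)\<in>symE (lbonds d L T). f k x * f k y))"
proof -
  obtain D :: nat where D: "\<And>k k' v i. (k, k', v) \<in> T \<Longrightarrow> i < d \<Longrightarrow> \<bar>vec v i\<bar> \<le> int D"
    using step_bound by fastforce
  \<comment> \<open>The number of bond types times the gradient bound over the norm bound; the 1
    makes \<open>C\<close> positive.\<close>
  define C where "C = 1 + real (card T) * (2 * (real D)\<^sup>2) * (16 * 2 ^ d)"
  have "C > 0" unfolding C_def by (intro add_pos_nonneg mult_nonneg_nonneg) auto
  moreover have "\<exists>f. orthonormal (lsites d L K) Nh f \<and>
      real \<zeta> * real Nh - C * real Nh / (real l)\<^sup>2 \<le> (\<Sum>k<Nh. \<Sum>(x,y)\<in>symE (lbonds d L T). f k x * f k y)"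
    if bl: "bond_lattice (lsites d L K) (lbonds d L T) \<zeta>" and K: "K \<noteq> {}" and n: "0 < n" and l: "0 < l" "n * l \<le> L" and Nh: "Nh \<le> n ^ d"
    for L n l Nh \<zeta>
  proof -
    \<comment> \<open>0 is a placeholder for \<mu>: the orbitals concern only the sites and bonds of
      M.\<close>
    interpret bond_lattice "lsites d L K" "lbonds d L T" \<zeta> 0 by (rule bl)
    have lL: "l \<le> L" using l n by (metis One_nat_def Suc_leI le_trans mult_le_mono1 nat_mult_1)
    have L0: "L > 0" using l lL by simp
    have cK: "1 \<le> real (card K)" using K finite_K by (simp add: Suc_leI card_gt_0_iff)
    define G where "G x = real_of_int (bump L l x)" for x
    define S where "S = (\<Sum>x\<in>cells d L. (G x)\<^sup>2)"
    define w where "w = real (card K) * S"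
    have S: "real l ^ (d + 2) / (16 * 2 ^ d) \<le> S" unfolding S_def G_def by (rule bump_norm_lower[OF l(1) lL])
    have "0 < real l ^ (d + 2) / (16 * 2 ^ d)" using l by simp
    then have S0: "S > 0" using S by linarith
    then have w0: "w > 0" "S \<le> w" using cK by (auto simp: w_def)
    obtain e where e: "inj_on e {..<Nh}" "e ` {..<Nh} \<subseteq> cells d n"
      using card_le_inj[of "{..<Nh}" "cells d n"] Nh by (auto simp: finite_cells card_cells)
    define g where "g k x = G (shift d L x (\<lambda>i. - (int l * vec (e k) i)))" for k x
    define f where "f k p = g k (fst p) / sqrt w" for k and p :: "int list \<times> 'k"
    have gsum: "(\<Sum>x\<in>cells d L. (g k x)\<^sup>2) = S" for k
      unfolding g_def S_def by (rule sum_cells_shift[OF L0, of "\<lambda>x. (G x)\<^sup>2"])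
    have ff: "f k p * f j p = g k (fst p) * g j (fst p) / w" for k j p
      using w0 by (simp add: f_def)
    have over: "(\<Sum>p\<in>lsites d L K. h (fst p)) = real (card K) * (\<Sum>x\<in>cells d L. h x)" for h :: "int list \<Rightarrow> real"
    proof -
      have "(\<Sum>p\<in>lsites d L K. h (fst p)) = (\<Sum>x\<in>cells d L. \<Sum>k\<in>K. h x)"
        unfolding lsites_def sum.cartesian_product by (simp add: case_prod_beta)
      then show ?thesis by (simp add: sum_distrib_left)
    qed
    have on: "orthonormal (lsites d L K) Nh f"
      unfolding orthonormal_def
    proof (intro allI impI)
      fix i j assume ij: "i < Nh" "j < Nh"
      have e': "(\<Sum>p\<in>lsites d L K. f i p * f j p) = real (card K) * (\<Sum>x\<in>cells d L. g i x * g j x) / w"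
        unfolding ff sum_divide_distrib[symmetric] over[of "\<lambda>x. g i x * g j x"] ..
      show "(\<Sum>p\<in>lsites d L K. f i p * f j p) = (if i = j then 1 else 0)"
      proof (cases "i = j")
        case True
        then have "(\<Sum>x\<in>cells d L. g i x * g j x) = S" using gsum[of j] by (simp add: power2_eq_square)
        then show ?thesis unfolding e' using True w0(1) by (simp add: w_def[symmetric])
      next
        case False
        then have ne: "e i \<noteq> e j" using e(1) ij by (auto simp: inj_on_def)
        have z: "g i x * g j x = 0" if "x \<in> cells d L" for x
        proof (rule ccontr)
          assume "\<not> ?thesis"
          then have "e i = e j"
            by (intro bumps_disjoint[OF l _ _ that]) (use e(2) ij in \<open>auto simp: g_def G_def\<close>)
          then show False using ne by simp
        qed
        have "(\<Sum>x\<in>cells d L. g i x * g j x) = 0" by (rule sum.neutral) (use z in blast)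
        then show ?thesis unfolding e' using False by simp
      qed
    qed
    have grad: "(\<Sum>x\<in>cells d L. (g k x - g k (shift d L x (vec v)))\<^sup>2) \<le> 2 * (real D)\<^sup>2 * real l ^ d"
      if "(a, b, v) \<in> T" for k a b v
    proof -
      define u where "u i = - (int l * vec (e k) i)" for i
      have "(\<Sum>x\<in>cells d L. (g k x - g k (shift d L x (vec v)))\<^sup>2)
        = (\<Sum>x\<in>cells d L. (G (shift d L x u) - G (shift d L (shift d L x u) (vec v)))\<^sup>2)"
        unfolding g_def u_def shift_shift by (simp add: add.commute)
      also have "\<dots> = (\<Sum>x\<in>cells d L. (G x - G (shift d L x (vec v)))\<^sup>2)"
        by (rule sum_cells_shift[OF L0, of "\<lambda>x. (G x - G (shift d L x (vec v)))\<^sup>2"])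
      also have "\<dots> \<le> 2 * (real D)\<^sup>2 * real l ^ d"
        unfolding G_def by (rule bump_gradient[OF l(1) lL]) (use D that in auto)
      finally show ?thesis .
    qed
    have each: "real \<zeta> - C / (real l)\<^sup>2 \<le> (\<Sum>(x,y)\<in>symE (lbonds d L T). f k x * f k y)" if k: "k < Nh" for k
    proof -
      have norm: "(\<Sum>p\<in>lsites d L K. (f k p)\<^sup>2) = 1" using on k by (simp add: orthonormal_def power2_eq_square)
      have diff: "(\<Sum>(x,y)\<in>lbonds d L T. (f k x - f k y)\<^sup>2) \<le> C / (real l)\<^sup>2"
      proof -
        have img: "lbonds d L T = (\<lambda>((a, b, v), x). ((x, a), (shift d L x (vec v), b))) ` (T \<times> cells d L)"
          unfolding lbonds_shift by force
        \<comment> \<open>An inequality only, because on a small torus several bond types may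
          produce the same bond.\<close>
        have "(\<Sum>(x,y)\<in>lbonds d L T. (f k x - f k y)\<^sup>2)
          \<le> (\<Sum>q\<in>T \<times> cells d L. ((\<lambda>(x,y). (f k x - f k y)\<^sup>2) \<circ> (\<lambda>((a, b, v), x). ((x, a), (shift d L x (vec v), b)))) q)"
          unfolding img by (rule sum_image_le) (auto simp: finite_T finite_cells)
        also have "\<dots> = (\<Sum>t\<in>T. \<Sum>x\<in>cells d L. (g k x - g k (shift d L x (vec (snd (snd t)))))\<^sup>2 / w)"
          unfolding sum.cartesian_product using w0
          by (intro sum.cong refl) (auto simp: f_def power_divide simp flip: diff_divide_distrib)
        also have "\<dots> \<le> (\<Sum>t\<in>T. 2 * (real D)\<^sup>2 * real l ^ d / w)"
          unfolding sum_divide_distrib[symmetric] using grad w0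
          by (intro divide_right_mono sum_mono) auto
        also have "\<dots> = real (card T) * (2 * (real D)\<^sup>2) * (real l ^ d / w)" by simp
        also have "real l ^ d / w \<le> 16 * 2 ^ d / (real l)\<^sup>2"
        proof -
          have "real l ^ (d + 2) \<le> S * (16 * 2 ^ d)" using S by (simp add: field_simps)
          also have "\<dots> \<le> w * (16 * 2 ^ d)" by (rule mult_right_mono[OF w0(2)]) simp
          finally have "real l ^ (d + 2) \<le> (16 * 2 ^ d) * w" by (simp only: mult.commute)
          then show ?thesis using l w0 by (simp add: field_simps power_add power2_eq_square)
        qed
        finally have "(\<Sum>(x,y)\<in>lbonds d L T. (f k x - f k y)\<^sup>2) \<le> real (card T) * (2 * (real D)\<^sup>2) * (16 * 2 ^ d / (real l)\<^sup>2)"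
          by (simp add: mult_left_mono)
        also have "\<dots> \<le> C / (real l)\<^sup>2" unfolding C_def by (simp add: divide_right_mono add_divide_distrib)
        finally show ?thesis .
      qed
      have "(\<Sum>(x,y)\<in>symE (lbonds d L T). f k x * f k y) = (\<Sum>(x,y)\<in>lbonds d L T. (f k x)\<^sup>2 + (f k y)\<^sup>2 - (f k x - f k y)\<^sup>2)"
        unfolding sum_symE_B by (intro sum.cong refl) (auto simp: power2_eq_square algebra_simps)
      also have "\<dots> = (\<Sum>(x,y)\<in>lbonds d L T. (f k x)\<^sup>2 + (f k y)\<^sup>2) - (\<Sum>(x,y)\<in>lbonds d L T. (f k x - f k y)\<^sup>2)"
        by (simp add: case_prod_beta sum_subtractf)
      also have "(\<Sum>(x,y)\<in>lbonds d L T. (f k x)\<^sup>2 + (f k y)\<^sup>2) = real \<zeta>"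
        unfolding sum_bond_ends[of "\<lambda>x. (f k x)\<^sup>2"] norm by simp
      finally show ?thesis using diff by linarith
    qed
    have "real \<zeta> * real Nh - C * real Nh / (real l)\<^sup>2 = (\<Sum>k<Nh. real \<zeta> - C / (real l)\<^sup>2)"
      by (simp add: algebra_simps)
    also have "\<dots> \<le> (\<Sum>k<Nh. \<Sum>(x,y)\<in>symE (lbonds d L T). f k x * f k y)" by (rule sum_mono) (use each in auto)
    finally show ?thesis using on by blast
  qed
  ultimately show ?thesis by (intro exI[of _ C]) blast
qed

end

section \<open>Choice of the constant\<close>

context lattice_data
begin

lemma closely_packed_bond_lattice:
  assumes "closely_packed (lsites d L K) (lbonds d L T)"
  obtains \<zeta> where "bond_lattice (lsites d L K) (lbonds d L T) \<zeta>"
proof -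
  obtain \<zeta> where "\<forall>x\<in>lsites d L K. card (nbrs (lbonds d L T) x) = \<zeta>" using assms by (auto simp: closely_packed_def)
  then have "bond_lattice (lsites d L K) (lbonds d L T) \<zeta>"
    using assms finite_lsites by unfold_locales (auto simp: closely_packed_def)
  then show ?thesis using that by blast
qed

text \<open>The kinetic energy lost by squeezing the holes into disjoint boxes stays below the energy of a
  separating wall of holes.\<close>

lemma hole_energy_below_wall:
  fixes c C \<beta> :: real
  assumes c: "c > 0" and C: "C > 0" and \<beta>: "0 < \<beta>" "\<beta> < 1" and L: "L > 0" and K: "K \<noteq> {}"
    and C': "0 < C'" "C' \<le> 1" "1024 * C * real (card K) * C' \<le> c"
    and Nh: "0 < Nh" "real Nh \<le> C' * \<beta> powr ((real d - 1) / (real d + 2)) * real (card (lsites d L K)) powr ((real d + 1) / (real d + 2))"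
    and l: "real L \<le> 4 * real Nh powr (1 / real d) * real l" "l > 0"
    and m: "\<beta> * real (card (lsites d L K)) / 32 \<le> m"
  shows "C * real Nh / (real l)\<^sup>2 < c * m powr ((real d - 1) / real d)"
proof -
  define M where "M = real (card (lsites d L K))"
  define D where "D = real d"
  define \<alpha> where "\<alpha> = (D - 1) / D"
  define p where "p = real Nh powr (1 / D)"
  define \<kappa> where "\<kappa> = real (card K)"
  have D: "D \<ge> 2" using d by (simp add: D_def)
  have \<kappa>: "\<kappa> \<ge> 1" using K finite_K by (simp add: \<kappa>_def Suc_leI card_gt_0_iff)
  have M: "M = \<kappa> * real L ^ d" by (simp add: M_def \<kappa>_def card_lsites)
  have M0: "M > 0" using \<kappa> L unfolding M by (intro mult_pos_pos) auto
  have p0: "p > 0" using Nh by (simp add: p_def)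
  have \<alpha>: "0 \<le> \<alpha>" "\<alpha> \<le> 1" using D by (auto simp: \<alpha>_def)
  \<comment> \<open>The power (D + 2) / D turns the hypothesis on \<open>Nh\<close> into the
    exponents of the wall: \<alpha> for \<beta>, and \<alpha> + 2 / D for M.\<close>
  have "real Nh powr ((D + 2) / D) \<le> (C' * \<beta> powr ((D - 1) / (D + 2)) * M powr ((D + 1) / (D + 2))) powr ((D + 2) / D)"
    using Nh D by (intro powr_mono2) (auto simp: M_def D_def)
  also have "\<dots> = C' powr ((D + 2) / D) * \<beta> powr \<alpha> * M powr ((D + 1) / D)"
    using C' \<beta> M0 D by (simp add: powr_mult powr_powr \<alpha>_def)
  also have "\<dots> \<le> C' * \<beta> powr \<alpha> * M powr ((D + 1) / D)"
  proof -
    have "C' powr ((D + 2) / D) \<le> C' powr 1" using C' D by (intro powr_mono') auto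
    then show ?thesis using C' by (intro mult_right_mono) auto
  qed
  also have "M powr ((D + 1) / D) = M powr \<alpha> * M powr (2 / D)"
  proof -
    have "(D + 1) / D = \<alpha> + 2 / D" using D by (simp add: \<alpha>_def field_simps)
    then show ?thesis by (simp add: powr_add)
  qed
  also have "M powr (2 / D) \<le> \<kappa> * (real L)\<^sup>2"
  proof -
    have "M powr (2 / D) = \<kappa> powr (2 / D) * (real L powr D) powr (2 / D)"
      using \<kappa> L unfolding M D_def by (simp add: powr_mult powr_realpow)
    also have "(real L powr D) powr (2 / D) = real L powr 2" using D by (simp add: powr_powr)
    also have "real L powr 2 = (real L)\<^sup>2" using L by simp
    also have "\<kappa> powr (2 / D) \<le> \<kappa> powr 1" using \<kappa> D by (intro powr_mono) auto
    finally show ?thesis using \<kappa> by (simp add: mult_right_mono)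
  qed
  finally have "real Nh powr ((D + 2) / D) \<le> C' * \<beta> powr \<alpha> * (M powr \<alpha> * (\<kappa> * (real L)\<^sup>2))"
    using C' by (simp add: mult_left_mono)
  moreover have "real Nh powr ((D + 2) / D) = real Nh * p\<^sup>2"
  proof -
    have "(D + 2) / D = 1 + (1 / D + 1 / D)" using D by (simp add: field_simps)
    then have "real Nh powr ((D + 2) / D) = real Nh powr 1 * (p * p)" by (simp only: powr_add p_def)
    then show ?thesis using Nh by (simp add: power2_eq_square)
  qed
  ultimately have Np: "real Nh * p\<^sup>2 \<le> C' * \<kappa> * (\<beta> * M) powr \<alpha> * (real L)\<^sup>2"
    using \<beta> M0 by (simp add: powr_mult mult_ac)
  have "(real L)\<^sup>2 \<le> (4 * p * real l)\<^sup>2" using l p0 by (intro power_mono) (auto simp: p_def D_def)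
  then have L2: "(real L)\<^sup>2 \<le> 16 * p\<^sup>2 * (real l)\<^sup>2" by (simp add: power_mult_distrib)
  have L20: "(real L)\<^sup>2 > 0" using L by simp
  have "C * real Nh * (real L)\<^sup>2 \<le> C * real Nh * (16 * p\<^sup>2 * (real l)\<^sup>2)"
    using L2 C by (intro mult_left_mono) auto
  also have "\<dots> = 16 * C * (real l)\<^sup>2 * (real Nh * p\<^sup>2)" by simp
  also have "\<dots> \<le> 16 * C * (real l)\<^sup>2 * (C' * \<kappa> * (\<beta> * M) powr \<alpha> * (real L)\<^sup>2)"
    using Np C by (intro mult_left_mono) auto
  finally have "C * real Nh * (real L)\<^sup>2 \<le> (16 * C * C' * \<kappa> * (\<beta> * M) powr \<alpha> * (real l)\<^sup>2) * (real L)\<^sup>2" by (simp add: mult_ac)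
  then have "C * real Nh \<le> 16 * C * C' * \<kappa> * (\<beta> * M) powr \<alpha> * (real l)\<^sup>2" using L20 by (rule mult_right_le_imp_le)
  then have "C * real Nh / (real l)\<^sup>2 \<le> 16 * C * C' * \<kappa> * (\<beta> * M) powr \<alpha>"
    using l(2) by (simp add: pos_divide_le_eq)
  \<comment> \<open>1024 is 16 times 64: the 16 is the square of the 4 in the bound on L, and 64 in
    place of the 32 in the bound on \<open>m\<close> leaves room for a strict inequality.\<close>
  also have "\<dots> \<le> c / 64 * (\<beta> * M) powr \<alpha>"
    using C'(3) by (intro mult_right_mono) (auto simp: \<kappa>_def mult_ac)
  also have "\<dots> < c / 32 * (\<beta> * M) powr \<alpha>" using c \<beta> M0 by simp
  also have "\<dots> = c * (1 / 32 * (\<beta> * M) powr \<alpha>)" by simp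
  also have "\<dots> \<le> c * ((1 / 32) powr \<alpha> * (\<beta> * M) powr \<alpha>)"
  proof -
    have "(1 / 32 :: real) powr 1 \<le> (1 / 32) powr \<alpha>" using \<alpha> by (intro powr_mono') auto
    then show ?thesis using c by (intro mult_left_mono mult_right_mono) auto
  qed
  also have "(1 / 32) powr \<alpha> * (\<beta> * M) powr \<alpha> = (\<beta> * M / 32) powr \<alpha>"
    using \<beta> M0 by (simp add: powr_mult[symmetric])
  also have "c * (\<beta> * M / 32) powr \<alpha> \<le> c * m powr \<alpha>"
    using m c \<alpha> \<beta> M0 by (intro mult_left_mono powr_mono2) (auto simp: M_def)
  finally show ?thesis by (simp add: \<alpha>_def D_def)
qed

text \<open>With n the d-th root of \<open>Nh\<close> rounded up and l = L div n, each rounding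
  loses at most a factor 2, hence the 4. The hypothesis \<open>Nh \<le> L ^ d\<close> gives n \<le>
  L, so that l is positive.\<close>

lemma boxes:
  assumes L: "L > 0" and Nh: "0 < Nh" "Nh \<le> L ^ d"
  shows "\<exists>n l. 0 < n \<and> 0 < l \<and> n * l \<le> L \<and> Nh \<le> n ^ d \<and> real L \<le> 4 * real Nh powr (1 / real d) * real l"
proof -
  define p where "p = real Nh powr (1 / real d)"
  have p1: "1 \<le> p" unfolding p_def using Nh by (intro ge_one_powr_ge_zero) auto
  have pd: "p ^ d = real Nh" using Nh d by (simp add: p_def powr_realpow[symmetric] powr_powr)
  define n where "n = nat \<lceil>p\<rceil>"
  have n: "p \<le> real n" "real n \<le> 2 * p" "n > 0" using p1 unfolding n_def by linarith+
  have "p ^ d \<le> real L ^ d" using Nh(2) unfolding pd by (metis of_nat_le_iff of_nat_power)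
  then have "p \<le> real L" using d by (subst (asm) power_mono_iff) (use p1 in auto)
  then have nL: "n \<le> L" unfolding n_def by linarith
  define l where "l = L div n"
  have l: "l > 0" using nL n by (simp add: l_def div_greater_zero_iff)
  have "L < n * (l + 1)" unfolding l_def using n(3) by (metis Suc_eq_plus1 dividend_less_times_div mult_Suc_right add.commute)
  also have "\<dots> \<le> n * (2 * l)" using l by (intro mult_left_mono) auto
  finally have "real L \<le> real n * (2 * real l)" by (metis less_imp_le of_nat_le_iff of_nat_mult of_nat_numeral)
  also have "\<dots> \<le> 2 * p * (2 * real l)" using n by (intro mult_right_mono) auto
  finally have "real L \<le> 4 * p * real l" by simp
  moreover have "Nh \<le> n ^ d"
  proof -
    have "real Nh \<le> real n ^ d" using n(1) p1 unfolding pd[symmetric] by (intro power_mono) auto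
    then show ?thesis by (metis of_nat_le_iff of_nat_power)
  qed
  moreover have "n * l \<le> L" by (simp add: l_def)
  ultimately show ?thesis using n(3) l unfolding p_def by blast
qed

lemma ferromagnetism:
  "\<exists>C' > 0. \<forall>(L::nat) (t::real) (\<mu>::real) (\<nu>::real) (Ne::nat) (\<Phi> :: (int list \<times> 'k) wavefn).
           closely_packed (lsites d L K) (lbonds d L T) \<and> t > 0 \<and> \<mu> > 0 \<and> 0 < \<nu> \<and> \<nu> < 1 \<and>
           Ne \<le> card (lsites d L K) \<and>
           real Ne \<ge> real (card (lsites d L K))
              - C' * (1 - \<nu>) powr ((real d - 1) / (real d + 2))
                   * real (card (lsites d L K)) powr ((real d + 1) / (real d + 2)) \<and>
           ground_state_lim (lsites d L K) (lbonds d L T) Ne t \<mu> \<Phi>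
           \<longrightarrow> total_spin_ge (lsites d L K) (lbonds d L T) Ne (\<nu> * (real Ne / 2)) \<Phi>"
proof -
  obtain c where c: "c > 0" and iso: "\<And>L W V H m. connected_torus L \<Longrightarrow> W \<union> V \<union> H = lsites d L K \<Longrightarrow> W \<inter> V = {} \<Longrightarrow>
    (\<forall>x\<in>W. \<forall>y\<in>V. (x, y) \<notin> symE (lbonds d L T)) \<Longrightarrow> 0 < m \<Longrightarrow> m \<le> real (card W) \<Longrightarrow> m \<le> real (card V) \<Longrightarrow>
    c * m powr ((real d - 1) / real d) \<le> real (card H)"
    using isoperimetry by blast
  obtain C where C: "C > 0" and trial: "\<And>L n l Nh \<zeta>. bond_lattice (lsites d L K) (lbonds d L T) \<zeta> \<Longrightarrow> K \<noteq> {} \<Longrightarrow> 0 < n \<Longrightarrow> 0 < l \<Longrightarrow> n * l \<le> L \<Longrightarrow> Nh \<le> n ^ d \<Longrightarrow>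
    (\<exists>f. orthonormal (lsites d L K) Nh f \<and>
      real \<zeta> * real Nh - C * real Nh / (real l)\<^sup>2 \<le> (\<Sum>k<Nh. \<Sum>(x,y)\<in>symE (lbonds d L T). f k x * f k y))"
    using trial_orbitals by blast
  define \<eta> where "\<eta> = real (card K)"
  \<comment> \<open>1 / 2 makes \<open>Ne\<close> at least |M| / 2, 1 / (\<eta> + 1) keeps the holes
    below L^d so that the boxes exist, and the last term is for the energy comparison. The shift to
    \<eta> + 1 avoids division by zero for empty \<open>K\<close>.\<close>
  define C' where "C' = min (1 / 2) (min (1 / (\<eta> + 1)) (c / (1024 * C * (\<eta> + 1))))"
  have \<eta>0: "\<eta> \<ge> 0" by (simp add: \<eta>_def)
  have C'0: "C' > 0" using c C \<eta>0 by (simp add: C'_def add_nonneg_pos)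
  have C'1: "C' \<le> 1 / 2" "C' * (\<eta> + 1) \<le> 1" "1024 * C * (\<eta> + 1) * C' \<le> c"
  proof -
    show "C' \<le> 1 / 2" by (simp add: C'_def)
    have "C' \<le> 1 / (\<eta> + 1)" by (simp add: C'_def)
    then show "C' * (\<eta> + 1) \<le> 1" using \<eta>0 by (simp add: pos_le_divide_eq)
    have "C' \<le> c / (1024 * C * (\<eta> + 1))" by (simp add: C'_def)
    moreover have "0 < 1024 * C * (\<eta> + 1)" using C \<eta>0 by simp
    ultimately show "1024 * C * (\<eta> + 1) * C' \<le> c" by (simp add: pos_le_divide_eq mult.commute)
  qed
  have "total_spin_ge (lsites d L K) (lbonds d L T) Ne (\<nu> * (real Ne / 2)) \<Phi>"
    if cp: "closely_packed (lsites d L K) (lbonds d L T)" and t: "t > 0" and \<mu>: "\<mu> > 0" and \<nu>: "0 < \<nu>" "\<nu> < 1"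
      and Ne: "Ne \<le> card (lsites d L K)"
      and NeC: "real Ne \<ge> real (card (lsites d L K)) - C' * (1 - \<nu>) powr ((real d - 1) / (real d + 2))
                   * real (card (lsites d L K)) powr ((real d + 1) / (real d + 2))"
      and gs: "ground_state_lim (lsites d L K) (lbonds d L T) Ne t \<mu> \<Phi>"
    for L t \<mu> \<nu> Ne and \<Phi> :: "(int list \<times> 'k) wavefn"
  proof -
    define M where "M = real (card (lsites d L K))"
    define Nh where "Nh = card (lsites d L K) - Ne"
    have sum: "Ne + Nh = card (lsites d L K)" using Ne by (simp add: Nh_def)
    obtain \<zeta> where bl: "bond_lattice (lsites d L K) (lbonds d L T) \<zeta>" using closely_packed_bond_lattice[OF cp] .
    interpret bond_lattice "lsites d L K" "lbonds d L T" \<zeta> \<mu> by (rule bl)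
    have con: "connected_torus L" using cp unfolding closely_packed_def connected_torus_def by blast
    have NhM: "real Nh = M - real Ne" using sum unfolding M_def by (simp flip: sum)
    have Nh: "real Nh \<le> C' * (1 - \<nu>) powr ((real d - 1) / (real d + 2)) * M powr ((real d + 1) / (real d + 2))"
      using NeC NhM by (simp add: M_def)
    have NhC: "real Nh \<le> C' * M"
    proof (cases "M = 0")
      case True
      then show ?thesis using Nh by simp
    next
      case False
      then have M1: "1 \<le> M" by (simp add: M_def)
      have "(1 - \<nu>) powr ((real d - 1) / (real d + 2)) \<le> 1" using \<nu> d by (intro powr_le1) auto
      moreover have "M powr ((real d + 1) / (real d + 2)) \<le> M powr 1" using M1 d by (intro powr_mono) auto
      ultimately have "C' * (1 - \<nu>) powr ((real d - 1) / (real d + 2)) * M powr ((real d + 1) / (real d + 2)) \<le> C' * 1 * M"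
        using C'0 M1 by (intro mult_mono) auto
      then show ?thesis using Nh by simp
    qed
    have M0: "M \<ge> 0" by (simp add: M_def)
    have half: "M / 2 \<le> real Ne" using NhC NhM mult_right_mono[OF C'1(1) M0] by linarith
    obtain f e where f: "orthonormal (lsites d L K) Nh f"
      "real \<zeta> * real Nh - e \<le> (\<Sum>k<Nh. \<Sum>(x,y)\<in>symE (lbonds d L T). f k x * f k y)"
      and e: "\<And>m. Ne > 0 \<Longrightarrow> (1 - \<nu>) / 16 * real Ne \<le> m \<Longrightarrow> e < c * m powr ((real d - 1) / real d)"
    proof (cases "Nh = 0")
      \<comment> \<open>Without holes nothing is lost, and e = 0 lies below any positive
        wall.\<close>
      case True
      show ?thesis
      proof (rule that[of "\<lambda>_ _. 0" 0])
        fix m assume "Ne > 0" "(1 - \<nu>) / 16 * real Ne \<le> m"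
        moreover have "0 < (1 - \<nu>) / 16 * real Ne" using \<nu> \<open>Ne > 0\<close> by simp
        ultimately show "0 < c * m powr ((real d - 1) / real d)" using c by simp
      qed (use True in \<open>auto simp: orthonormal_def\<close>)
    next
      case False
      then have "M > 0" using sum by (simp add: M_def)
      then have KL: "real (card K) * real L ^ d > 0" by (simp add: M_def card_lsites)
      then have K: "K \<noteq> {}" by auto
      have L: "L > 0"
      proof (rule ccontr)
        assume "\<not> L > 0"
        then have "real L ^ d = 0" using d by simp
        then show False using KL by (metis less_irrefl mult_zero_right)
      qed
      have "real Nh \<le> C' * \<eta> * real L ^ d" using NhC by (simp add: M_def \<eta>_def card_lsites)
      also have "\<dots> \<le> 1 * real L ^ d" using C'1(2) C'0 by (intro mult_right_mono) (auto simp: algebra_simps)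
      finally have "Nh \<le> L ^ d" by (metis mult_1 of_nat_le_iff of_nat_power)
      then obtain n l where nl: "0 < n" "0 < l" "n * l \<le> L" "Nh \<le> n ^ d" "real L \<le> 4 * real Nh powr (1 / real d) * real l"
        using boxes[OF L] False by blast
      obtain f where f: "orthonormal (lsites d L K) Nh f"
        "real \<zeta> * real Nh - C * real Nh / (real l)\<^sup>2 \<le> (\<Sum>k<Nh. \<Sum>(x,y)\<in>symE (lbonds d L T). f k x * f k y)"
        using trial[OF bl K nl(1-4)] by blast
      show ?thesis
      proof (rule that[OF f])
        fix m assume "Ne > 0" and m: "(1 - \<nu>) / 16 * real Ne \<le> m"
        \<comment> \<open>32 is 16 times 2, the 2 coming from \<open>half\<close>.\<close>
        have "(1 - \<nu>) * M / 32 \<le> (1 - \<nu>) / 16 * real Ne"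
          using mult_left_mono[OF half, of "(1 - \<nu>) / 16"] \<nu> by simp
        then have m': "(1 - \<nu>) * real (card (lsites d L K)) / 32 \<le> m" using m unfolding M_def by linarith
        have "1024 * C * real (card K) * C' \<le> 1024 * C * (\<eta> + 1) * C'"
          using C C'0 by (intro mult_right_mono mult_left_mono) (auto simp: \<eta>_def)
        then have "1024 * C * real (card K) * C' \<le> c" using C'1(3) by linarith
        then show "C * real Nh / (real l)\<^sup>2 < c * m powr ((real d - 1) / real d)"
          using \<nu> C'1(1) False
          by (intro hole_energy_below_wall[OF c C _ _ L K C'0 _ _ _ Nh[unfolded M_def] nl(5,2) m']) auto
      qed
    qed
    show ?thesis
    proof (rule ground_state_spin[OF _ t \<nu> sum _ f(1) f(2) _ gs])
      show "\<mu> \<noteq> 0" using \<mu> by simp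
      show "(y, z) \<in> (symE (lbonds d L T) \<inter> nbrs (lbonds d L T) x0 \<times> nbrs (lbonds d L T) x0)\<^sup>*"
        if "x0 \<in> lsites d L K" "y \<in> nbrs (lbonds d L T) x0" "z \<in> nbrs (lbonds d L T) x0" for x0 y z
        using cp that unfolding closely_packed_def by blast
      fix W V H assume W: "W \<union> V \<union> H = lsites d L K" "W \<inter> V = {}" "W \<inter> H = {}" "V \<inter> H = {}"
        "\<forall>x\<in>W. \<forall>y\<in>V. (x, y) \<notin> symE (lbonds d L T)" "Ne > 0"
        "(1 - \<nu>) / 16 * real Ne \<le> real (card W)" "(1 - \<nu>) / 16 * real Ne \<le> real (card V)"
      have "0 < (1 - \<nu>) / 16 * real Ne" using \<nu> W(6) by simp
      then have "c * ((1 - \<nu>) / 16 * real Ne) powr ((real d - 1) / real d) \<le> real (card H)"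
        using iso[OF con W(1,2,5) _ W(7,8)] by blast
      then show "e < real (card H)" using e[OF W(6) order_refl] by linarith
    qed
  qed
  then show ?thesis using C'0 by (intro exI[of _ C']) blast
qed

end

theorem theorem4:
  fixes d :: nat and K :: "'k set" and T :: "('k \<times> 'k \<times> int list) set"
  assumes "d \<ge> 2" and "finite K" and "finite T"
    and "T \<subseteq> K \<times> K \<times> {v. length v = d}"
  shows "\<exists>C' > 0. \<forall>(L::nat) (t::real) (\<mu>::real) (\<nu>::real) (Ne::nat) (\<Phi> :: (int list \<times> 'k) wavefn).
           closely_packed (lsites d L K) (lbonds d L T) \<and> t > 0 \<and> \<mu> > 0 \<and> 0 < \<nu> \<and> \<nu> < 1 \<and>
           Ne \<le> card (lsites d L K) \<and>
           real Ne \<ge> real (card (lsites d L K))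
              - C' * (1 - \<nu>) powr ((real d - 1) / (real d + 2))
                   * real (card (lsites d L K)) powr ((real d + 1) / (real d + 2)) \<and>
           ground_state_lim (lsites d L K) (lbonds d L T) Ne t \<mu> \<Phi>
           \<longrightarrow> total_spin_ge (lsites d L K) (lbonds d L T) Ne (\<nu> * (real Ne / 2)) \<Phi>"
proof -
  interpret lattice_data d K T by unfold_locales (rule assms)+
  show ?thesis by (rule ferromagnetism)
qed

end
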